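(* Let $\Delta$ be the set of first dynamical degrees of automorphisms of simple complex abelian varieties (of any dimension), with the value $1$ removed. Then $\Delta$ has no minimum element; more precisely, for every $\epsilon>0$ there is an automorphism $f$ of a simple complex abelian variety with $1<\lambda_1(f)<1+\epsilon$.
   Context: A complex abelian variety is simple if it contains no abelian subvarieties other than $0$ and itself; an automorphism means an invertible group-preserving endomorphism. For a holomorphic self-map $f$ of a compact Kähler manifold $X$, the first dynamical degree $\lambda_1(f)$ is the spectral radius of $f^*$ on $H^{1,1}(X)$. *)

theory Defs
  imports Complex_Main "Jordan_Normal_Form.Spectral_Radius"
begin

text \<open>Complex tori of dimension g are modelled as C^g / Lambda, where the lattice
 Lambda is the Z-span of the 2g columns of a complex g x 2g matrix P whose columns
 are R-linearly independent.\<close>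

definition lattice_pts :: "nat \<Rightarrow> complex mat \<Rightarrow> complex vec set" where
  "lattice_pts g P = {P *\<^sub>v map_vec of_int z | z :: int vec. z \<in> carrier_vec (2*g)}"

definition is_lattice :: "nat \<Rightarrow> complex mat \<Rightarrow> bool" where
  "is_lattice g P \<longleftrightarrow> P \<in> carrier_mat g (2*g) \<and>
     (\<forall>r :: real vec. r \<in> carrier_vec (2*g) \<longrightarrow>
        P *\<^sub>v map_vec complex_of_real r = 0\<^sub>v g \<longrightarrow> r = 0\<^sub>v (2*g))"

definition herm_form :: "nat \<Rightarrow> complex mat \<Rightarrow> complex vec \<Rightarrow> complex vec \<Rightarrow> complex" where
  "herm_form g H v w = (\<Sum>i<g. \<Sum>j<g. cnj (v $ i) * H $$ (i, j) * w $ j)"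

text \<open>Riemann condition: there is a positive definite Hermitian form H whose
 imaginary part is integral on the lattice (a polarization).
 A complex torus is an abelian variety iff it admits a polarization.\<close>
definition is_abelian_variety :: "nat \<Rightarrow> complex mat \<Rightarrow> bool" where
  "is_abelian_variety g P \<longleftrightarrow> is_lattice g P \<and>
     (\<exists>H. H \<in> carrier_mat g g \<and>
        (\<forall>i<g. \<forall>j<g. H $$ (j, i) = cnj (H $$ (i, j))) \<and>
        (\<forall>v \<in> carrier_vec g. v \<noteq> 0\<^sub>v g \<longrightarrow> Re (herm_form g H v v) > 0) \<and>
        (\<forall>v \<in> lattice_pts g P. \<forall>w \<in> lattice_pts g P. Im (herm_form g H v w) \<in> \<int>))"

definition complex_subspace :: "nat \<Rightarrow> complex vec set \<Rightarrow> bool" where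
  "complex_subspace g W \<longleftrightarrow> W \<subseteq> carrier_vec g \<and> 0\<^sub>v g \<in> W \<and>
     (\<forall>v \<in> W. \<forall>w \<in> W. v + w \<in> W) \<and> (\<forall>c::complex. \<forall>v \<in> W. c \<cdot>\<^sub>v v \<in> W)"

definition real_span :: "nat \<Rightarrow> complex vec set \<Rightarrow> complex vec set" where
  "real_span g S = {Q *\<^sub>v map_vec complex_of_real r | Q r k.
      Q \<in> carrier_mat g k \<and> (\<forall>j<k. col Q j \<in> S) \<and> r \<in> carrier_vec k}"

text \<open>Abelian subvarieties of C^g/Lambda correspond to complex subspaces W such that
 W meets Lambda in a lattice of W, i.e. W is the real span of W \<inter> Lambda.\<close>
definition is_simple_abelian_variety :: "nat \<Rightarrow> complex mat \<Rightarrow> bool" where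
  "is_simple_abelian_variety g P \<longleftrightarrow> 0 < g \<and> is_abelian_variety g P \<and>
     (\<forall>W. complex_subspace g W \<and> real_span g (W \<inter> lattice_pts g P) = W \<longrightarrow>
          W = {0\<^sub>v g} \<or> W = carrier_vec g)"

text \<open>Automorphisms (as group variety) of C^g/Lambda: complex linear maps z \<mapsto> A z
 mapping the lattice onto itself.\<close>
definition is_torus_aut :: "nat \<Rightarrow> complex mat \<Rightarrow> complex mat \<Rightarrow> bool" where
  "is_torus_aut g P A \<longleftrightarrow> A \<in> carrier_mat g g \<and>
     (\<lambda>v. A *\<^sub>v v) ` lattice_pts g P = lattice_pts g P"

text \<open>Matrix of f^* on H^{1,1}(X), identified with the translation-invariant (1,1)-forms,
 in the basis dz_i \<and> d(conj z_j), indexed by i*g+j: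
 f^*(dz_i \<and> d(conj z_j)) = \<Sum>_{k,l} A_{ik} conj(A_{jl}) dz_k \<and> d(conj z_l).\<close>
definition pullback11 :: "nat \<Rightarrow> complex mat \<Rightarrow> complex mat" where
  "pullback11 g A = mat (g*g) (g*g)
     (\<lambda>(p, q). A $$ (p div g, q div g) * cnj (A $$ (p mod g, q mod g)))"

definition first_dyn_degree :: "nat \<Rightarrow> complex mat \<Rightarrow> real" where
  "first_dyn_degree g A = spectral_radius (pullback11 g A)"

end

theory Submission
  imports Defs "HOL-Real_Asymp.Real_Asymp" "HOL-Analysis.Continuum_Not_Denumerable"
begin

text \<open>Let $F = \mathbb{Q}(t)$ be a totally real field in which all conjugates of the integer $t$ lie slightly inside or
  outside $[-2,2]$, with at least one outside, and let $w + 1/w = t$. All conjugates of the unit $w$ are then real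
  of absolute value close to 1 or of absolute value 1, and not all are of the second kind. The field $F(w)$
  embeds into the totally indefinite quaternion algebra $B = F(w) \oplus F(w)u$ with $u^2 = t + 3$ and
  $uw = w^{-1}u$, and $w$ acts by left multiplication on the tori $B_{\mathbb{R}}/\mathcal{O}$, whose complex structures
  are right multiplications. A subtorus corresponds to a rational subspace of $B$ stable under the complex structure; for a
  complex structure with rationally independent coordinates it is a right ideal of $B$, so the torus is simple once $B$ is a
  division algebra. That is arranged by taking the minimal polynomial of $t$ Eisenstein at 3, with constant term 3.\<close>

section \<open>Valuations on $\mathbb{Z}[x]/(T)$\<close>

hide_const (open) Module.smult module.smult Coset.order

text \<open>Commutative multiplications cannot work. Let the automorphism come from a unit w of a
  totally real or CM field and let x be w times its complex conjugate. Then x is a totally positive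
  unit whose largest conjugate is the first dynamical degree; if x is not 1, the norm of x - 1 is a
  nonzero integer, so the conjugates of x cannot all lie in (0,2), and the degree is at least 2.
  Hence w must have both real and non-real conjugates, and a field like that acts on a simple
  abelian variety only through a noncommutative division algebra. As left and right multiplications
  commute, w acts whatever the complex structure is, which leaves the latter free to be generic. The
  number 3 serves three ends. At the prime (t), with residue field of three elements, w^2 - t w + 1
  reduces to w^2 + 1, which has no root, so the prime is inert in F(w); t + 3 is a uniformizer
  there, so B is ramified at that prime; and t + 3 is positive at all real places because |t| < 5/2,
  so B splits there and right multiplications supply complex structures.\<close>

lemma monic_division:
  fixes f g :: "'a::{comm_ring_1,semiring_1_no_zero_divisors} poly"
  assumes "lead_coeff g = 1" "degree g > 0"
  obtains q r where "f = g * q + r" "degree r < degree g"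
proof -
  obtain q r where qr: "pseudo_divmod f g = (q, r)"
    by fastforce
  have g: "g \<noteq> 0" using assms by auto
  have "f = g * q + r" "r = 0 \<or> degree r < degree g"
    using pseudo_divmod[OF g qr] assms by auto
  then have "f = g * q + r" "degree r < degree g" using assms(2) by auto
  then show ?thesis by (rule that)
qed

locale eisenstein3 =
  fixes T :: "int poly" and n :: nat
  assumes n2: "n \<ge> 2"
    and degT: "degree T = n"
    and monT: "coeff T n = 1"
    and divT: "\<And>k. k < n \<Longrightarrow> 3 dvd coeff T k"
    and T0: "coeff T 0 = 3"
begin

text \<open>Since $T$ has constant term 3 and is congruent to $x^n$ modulo 3, the class of $x$ generates the only prime of
  $\mathbb{Z}[x]/(T)$ above 3, and \<open>val\<close> is the corresponding valuation.\<close>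

definition unit0 :: "int poly \<Rightarrow> bool" where
  "unit0 p \<longleftrightarrow> \<not> 3 dvd coeff p 0"

definition val :: "int poly \<Rightarrow> nat \<Rightarrow> bool" where
  "val p k \<longleftrightarrow> (\<exists>u. unit0 u \<and> T dvd p - monom 1 k * u)"

lemma T_nz: "T \<noteq> 0" using degT n2 by auto

lemma unit0_mult: "unit0 p \<Longrightarrow> unit0 q \<Longrightarrow> unit0 (p * q)"
proof -
  have "prime (3::int)" by simp
  then show "unit0 p \<Longrightarrow> unit0 q \<Longrightarrow> unit0 (p * q)"
    unfolding unit0_def coeff_mult_0 using prime_dvd_multD by blast
qed

text \<open>Modulo T this says 3 = - x g: a factor 3 in a constant coefficient can be traded for a
  factor x.\<close>

lemma T_split: obtains g where "T = [:3:] + [:0,1:] * g" "coeff g 0 = coeff T 1"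
proof -
  have "T = pCons (coeff T 0) (poly_shift 1 T)"
    by (rule poly_eqI) (simp add: coeff_pCons coeff_poly_shift split: nat.splits)
  then have "T = [:3:] + [:0,1:] * poly_shift 1 T" using T0 by simp
  with that show ?thesis by (simp add: coeff_poly_shift)
qed

lemma T_mod3: obtains h where "T = monom 1 n + smult 3 h"
proof -
  define h where "h = (\<Sum>k<n. monom (coeff T k div 3) k)"
  have ch: "coeff h j = (if j < n then coeff T j div 3 else 0)" for j
    unfolding h_def coeff_sum coeff_monom by (simp add: sum.delta')
  have "T = monom 1 n + smult 3 h"
  proof (rule poly_eqI)
    fix j
    show "coeff T j = coeff (monom 1 n + smult 3 h) j"
      using divT[of j] monT degT coeff_eq_0[of T j]
      by (cases "j < n"; cases "j = n") (auto simp: ch coeff_monom)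
  qed
  with that show ?thesis .
qed

lemma poly_constant_coeff_split: "p = [:coeff p 0:] + [:0,1:] * poly_shift 1 (p::int poly)"
  by (rule poly_eqI) (simp add: coeff_pCons coeff_poly_shift split: nat.splits)

lemma unit0_not_dvd: "unit0 p \<Longrightarrow> \<not> T dvd p"
  unfolding unit0_def dvd_def using T0 by (auto simp: coeff_mult_0)

text \<open>Since T has nonzero constant term, x p = T h forces the constant term of h to vanish,
  and x cancels.\<close>

lemma T_dvd_cancel_x: assumes "T dvd [:0,1:] * p" shows "T dvd p"
proof -
  obtain h where h: "[:0,1:] * p = T * h" using assms by (auto simp: dvd_def)
  then have "coeff (T * h) 0 = 0" by (metis coeff_mult_0 coeff_pCons_0 mult_zero_left)
  then have "coeff h 0 = 0" using T0 by (simp add: coeff_mult_0)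
  then have "h = [:0,1:] * poly_shift 1 h" using poly_constant_coeff_split[of h] by simp
  then have "[:0,1:] * p = [:0,1:] * (T * poly_shift 1 h)" using h
    by (metis mult.left_commute)
  then have "p = T * poly_shift 1 h" by (simp only: mult_cancel_left) simp
  then show ?thesis by simp
qed

lemma T_dvd_cancel_monom: "T dvd monom 1 k * p \<Longrightarrow> T dvd p"
proof (induction k)
  case (Suc k)
  have "monom 1 (Suc k) * p = [:0,1:] * (monom 1 k * p)"
    by (simp add: monom_Suc)
  then show ?case using Suc T_dvd_cancel_x by metis
qed simp

lemma small_dvd: assumes "T dvd p" "degree p < n" shows "p = 0"
  using assms degT dvd_imp_degree_le[of T p] by fastforce

text \<open>If l > k, cancelling x^k leaves u congruent to a multiple of x modulo T; but every
  element of the ideal (x, T) has constant term divisible by 3.\<close>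

lemma val_unique_aux: assumes "unit0 u" "T dvd monom 1 k * u - monom 1 l * w" shows "l \<le> k"
proof (rule ccontr)
  assume "\<not> l \<le> k"
  then obtain d where d: "l = k + Suc d" using less_imp_Suc_add not_le by (metis add_Suc_right)
  have "monom (1::int) l = monom 1 k * ([:0,1:] * monom 1 d)"
    unfolding d by (simp add: mult_monom flip: monom_Suc)
  then have "monom 1 k * u - monom 1 l * w = monom 1 k * (u - [:0,1:] * (monom 1 d * w))"
    by (simp only: right_diff_distrib mult.assoc)
  with assms(2) have "T dvd u - [:0,1:] * (monom 1 d * w)" using T_dvd_cancel_monom by metis
  then obtain h where h: "u - [:0,1:] * (monom 1 d * w) = T * h" by (auto simp: dvd_def)
  have "coeff u 0 = coeff (u - [:0,1:] * (monom 1 d * w)) 0" by simp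
  also have "\<dots> = 3 * coeff h 0" unfolding h using T0 by (simp add: coeff_mult_0)
  finally show False using assms(1) by (simp add: unit0_def)
qed

lemma val_unique: assumes "unit0 u" "unit0 w" "T dvd p - monom 1 k * u" "T dvd p - monom 1 l * w"
  shows "k = l"
proof -
  have "T dvd monom 1 k * u - monom 1 l * w" "T dvd monom 1 l * w - monom 1 k * u"
    using dvd_diff[OF assms(4,3)] dvd_diff[OF assms(3,4)] by (simp_all add: algebra_simps)
  then show ?thesis using val_unique_aux[OF assms(1)] val_unique_aux[OF assms(2)] by (meson order_antisym)
qed

text \<open>From x^n = - 3 h modulo T. This turns divisibility by all powers of x into divisibility
  by all powers of 3.\<close>

lemma monom_power_n: "\<exists>s. T dvd monom 1 (n * k) - smult (3^k) s"
proof (induction k)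
  case 0
  show ?case by (rule exI[of _ 1]) (simp add: one_pCons monom_0)
next
  case (Suc k)
  then obtain s where s: "T dvd monom 1 (n * k) - smult (3^k) s" by blast
  obtain h where h: "T = monom 1 n + smult 3 h" using T_mod3 .
  have "monom 1 (n * Suc k) - smult (3^Suc k) (- (s * h)) =
     monom 1 n * (monom 1 (n*k) - smult (3^k) s) + smult (3^k) s * T"
    unfolding h by (simp add: algebra_simps mult_monom smult_add_right)
  moreover have "T dvd \<dots>" using s by (intro dvd_add dvd_mult) auto
  ultimately show ?case by metis
qed

text \<open>A Krull intersection argument. If extracting factors x never reached a unit, p would be
  divisible modulo T by every x^k, hence by every power of 3; as 1, x, ..., x^(n-1) is a basis of
  the quotient, each coefficient of the remainder would then be divisible by all powers of
  3.\<close>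

lemma val_exists: assumes "\<not> T dvd p" shows "\<exists>k. val p k"
proof (rule ccontr)
  assume no: "\<nexists>k. val p k"
  obtain g where g: "T = [:3:] + [:0,1:] * g" using T_split .
  have div_x: "\<exists>w. T dvd p - monom 1 k * w" for k
  proof (induction k)
    case 0 show ?case by (rule exI[of _ p]) simp
  next
    case (Suc k)
    then obtain w where w: "T dvd p - monom 1 k * w" by blast
    then have "\<not> unit0 w" using no val_def by blast
    then obtain c where c: "coeff w 0 = 3 * c" by (auto simp: unit0_def)
    have w': "w = [:3 * c:] + [:0,1:] * poly_shift 1 w" using poly_constant_coeff_split[of w] c by simp
    \<comment> \<open>The constant term of \<open>w\<close> is 3c, and 3c = - x c g modulo T, so one
      more factor x comes out.\<close>
    have e: "w - [:0,1:] * (poly_shift 1 w - smult c g) = [:c:] * T"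
      by (subst w', subst g) (simp add: algebra_simps smult_add_right)
    have "p - monom 1 (Suc k) * (poly_shift 1 w - smult c g) =
       (p - monom 1 k * w) + monom 1 k * (w - [:0,1:] * (poly_shift 1 w - smult c g))"
      by (simp add: monom_Suc algebra_simps)
    also have "T dvd \<dots>" unfolding e using w by (intro dvd_add dvd_mult) auto
    finally show ?case by blast
  qed
  obtain q r where qr: "p = T * q + r" "degree r < n"
    using monic_division[of T p] degT monT n2 by auto
  have d3: "3 ^ k dvd coeff r j" for k j
  proof -
    obtain w where w: "T dvd p - monom 1 (n*k) * w" using div_x by blast
    obtain s where s: "T dvd monom 1 (n * k) - smult (3^k) s" using monom_power_n by blast
    obtain q' r' where r': "s * w = T * q' + r'" "degree r' < n"
      using monic_division[of T "s * w"] degT monT n2 by auto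
    have "r - smult (3^k) r' = (p - monom 1 (n*k) * w) + w * (monom 1 (n*k) - smult (3^k) s)
        + T * (smult (3^k) q' - q)"
    proof -
      have a: "r = p - T * q" and b: "r' = s * w - T * q'" using qr r' by auto
      show ?thesis unfolding a b by (simp add: algebra_simps smult_diff_right smult_add_right)
    qed
    also have "T dvd \<dots>" using w s by simp
    finally have "T dvd r - smult (3^k) r'" .
    moreover have "degree (r - smult (3^k) r') < n"
      using qr(2) r'(2) degree_diff_less by (metis degree_smult_le le_less_trans)
    ultimately have "r = smult (3^k) r'" using small_dvd by fastforce
    then show ?thesis by simp
  qed
  have "r = 0"
  proof (rule poly_eqI)
    fix j
    \<comment> \<open>The exponent |c| suffices: a nonzero c divisible by 3^|c| would satisfy 3^|c|
      <= |c|.\<close>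
    have "\<bar>coeff r j\<bar> < 3 ^ nat \<bar>coeff r j\<bar>"
    proof -
      have "nat \<bar>coeff r j\<bar> < 3 ^ nat \<bar>coeff r j\<bar>" by (rule less_exp[THEN order_less_le_trans]) (simp add: power_mono)
      then have "int (nat \<bar>coeff r j\<bar>) < int (3 ^ nat \<bar>coeff r j\<bar>)" by (simp only: of_nat_less_iff)
      then show ?thesis by simp
    qed
    then show "coeff r j = coeff 0 j"
      using d3[of "nat \<bar>coeff r j\<bar>" j] dvd_imp_le_int[of "coeff r j" "3 ^ nat \<bar>coeff r j\<bar>"] by fastforce
  qed
  then show False using qr assms by simp
qed

lemma val_not_dvd: "val p k \<Longrightarrow> \<not> T dvd p"
proof
  assume "val p k" "T dvd p"
  then obtain u where u: "unit0 u" "T dvd p - monom 1 k * u" by (auto simp: val_def)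
  then have "T dvd monom 1 k * u" using \<open>T dvd p\<close> by (metis dvd_diff_commute dvd_add_right_iff diff_add_cancel)
  then show False using T_dvd_cancel_monom unit0_not_dvd u by blast
qed

lemma val_mult: assumes "val p k" "val q l" shows "val (p * q) (k + l)"
proof -
  obtain u w where u: "unit0 u" "T dvd p - monom 1 k * u" and w: "unit0 w" "T dvd q - monom 1 l * w"
    using assms by (auto simp: val_def)
  have "p * q - K * L * (u * w) = (p - K * u) * q + K * u * (q - L * w)" for K L
    by (simp add: algebra_simps)
  from this[of "monom 1 k" "monom 1 l"]
  have "p * q - monom 1 (k+l) * (u * w) = (p - monom 1 k * u) * q + monom 1 k * u * (q - monom 1 l * w)"
    by (simp only: mult_monom mult_1)
  moreover have "T dvd \<dots>" using u w by simp
  ultimately show ?thesis unfolding val_def using unit0_mult u w by metis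
qed

text \<open>Every nonzero class has a finite valuation and valuations add, so the quotient is a
  domain. This takes the place of the Eisenstein criterion.\<close>

lemma T_prime: "T dvd p * q \<Longrightarrow> T dvd p \<or> T dvd q"
  using val_exists val_mult val_not_dvd by meson

text \<open>The norm form of the quadratic extension generated by a root of $w^2 - x w + 1$.\<close>

definition nform :: "int poly \<Rightarrow> int poly \<Rightarrow> int poly" where
  "nform A B = A * A + [:0,1:] * A * B + B * B"

text \<open>Modulo x the cross term disappears and A^2 + B^2 remains over the field with three
  elements, anisotropic because -1 is not a square there.\<close>

lemma nform_unit: assumes "unit0 A \<or> unit0 B" shows "unit0 (nform A B)"
proof -
  have *: "3 dvd a \<and> 3 dvd b" if h: "3 dvd a * a + b * (b::int)" for a b
  proof -
    have sq: "(c * c) mod 3 = (if 3 dvd c then 0 else 1)" for c :: int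
    proof -
      consider "c mod 3 = 0" | "c mod 3 = 1" | "c mod 3 = 2" by linarith
      moreover have "(c * c) mod 3 = ((c mod 3) * (c mod 3)) mod 3" by (rule mod_mult_eq[symmetric])
      ultimately show ?thesis by cases (simp_all only: dvd_eq_mod_eq_0, simp_all)
    qed
    have "(X + Y) mod 3 = 0 \<Longrightarrow> X mod 3 = 0 \<or> X mod 3 = 1 \<Longrightarrow> Y mod 3 = 0 \<or> Y mod 3 = 1
        \<Longrightarrow> X mod 3 = 0 \<and> Y mod 3 = 0" for X Y :: int
      by presburger
    from this[of "a * a" "b * b"] show ?thesis using h sq[of a] sq[of b] dvd_eq_mod_eq_0
      by (metis zero_neq_one)
  qed
  have "coeff (nform A B) 0 = coeff A 0 * coeff A 0 + coeff B 0 * coeff B 0"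
    by (simp add: nform_def coeff_mult_0)
  then show ?thesis using assms * unfolding unit0_def by metis
qed

text \<open>Divide A and B by x^k with k the smaller valuation. One quotient is then a unit, so the
  form of the quotients is a unit, and the scaling contributes x^(2k).\<close>

lemma nform_val: assumes "\<not> (T dvd A \<and> T dvd B)" shows "\<exists>k. val (nform A B) (2 * k)"
proof -
  have "\<exists>k A' B'. T dvd A - monom 1 k * A' \<and> T dvd B - monom 1 k * B' \<and> (unit0 A' \<or> unit0 B')"
  proof (cases "T dvd A \<or> T dvd B")
    case True
    then show ?thesis
    proof
      assume A: "T dvd A"
      then obtain k u where "unit0 u" "T dvd B - monom 1 k * u" using assms val_exists val_def by meson
      then show ?thesis using A by (intro exI[of _ k] exI[of _ 0] exI[of _ u]) simp
    next
      assume B: "T dvd B"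
      then obtain k u where "unit0 u" "T dvd A - monom 1 k * u" using assms val_exists val_def by meson
      then show ?thesis using B by (intro exI[of _ k] exI[of _ u] exI[of _ 0]) simp
    qed
  next
    case False
    then obtain k u l w where k: "unit0 u" "T dvd A - monom 1 k * u"
      and l: "unit0 w" "T dvd B - monom 1 l * w" using val_exists val_def by meson
    show ?thesis
    proof (cases "k \<le> l")
      case True
      have "monom 1 l * w = monom 1 k * (monom 1 (l-k) * w)" using True
        by (metis (no_types, lifting) mult.assoc le_add_diff_inverse mult_1 mult_monom)
      then show ?thesis using k l by metis
    next
      case False
      then have "monom 1 k * u = monom 1 l * (monom 1 (k-l) * u)"
        by (metis (no_types, lifting) mult.assoc le_add_diff_inverse mult_1 mult_monom nat_le_linear)
      then show ?thesis using k l by metis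
    qed
  qed
  then obtain k A' B' where A: "T dvd A - monom 1 k * A'" and B: "T dvd B - monom 1 k * B'"
    and u: "unit0 A' \<or> unit0 B'" by blast
  define M where "M = monom (1::int) k"
  have M2: "monom 1 (2*k) = M * M" by (simp add: M_def mult_monom mult_2)
  have "nform A B - monom 1 (2*k) * nform A' B' =
    (A - M * A') * (A + M * A' + [:0,1:] * B) + (B - M * B') * (B + M * B' + [:0,1:] * (M * A'))"
    unfolding M2 nform_def by (simp only: ring_distribs) (simp add: algebra_simps)
  moreover have "T dvd \<dots>" using A B by (simp add: M_def)
  ultimately show ?thesis unfolding val_def using nform_unit[OF u] by metis
qed

text \<open>As 3 = - x g, the class of x + 3 is x (1 - g). The constant term of g is
  \<open>coeff T 1\<close>, a multiple of 3 because n >= 2, so 1 - g is a unit.\<close>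

lemma val_x_plus_3: "val [:3,1:] 1"
proof -
  obtain g where g: "T = [:3:] + [:0,1:] * g" "coeff g 0 = coeff T 1" using T_split .
  have "[:3,1:] - monom 1 1 * (1 - g) = T" by (subst g(1)) (simp add: monom_Suc algebra_simps)
  moreover have "unit0 (1 - g)"
    unfolding unit0_def using g(2) divT[of 1] n2 by simp presburger
  ultimately show ?thesis unfolding val_def by (metis dvd_refl)
qed

text \<open>The quaternion algebra $(x^2-4, x+3)$ is a division algebra: at the prime $(x)$ both norm forms have
  even valuation, whereas $x+3$ is a uniformizer.\<close>

lemma quaternion_norm_nonzero:
  assumes "T dvd nform A B - [:3,1:] * nform C E"
  shows "T dvd A \<and> T dvd B \<and> T dvd C \<and> T dvd E"
proof -
  have *: "val p k \<longleftrightarrow> val q k" if "T dvd p - q" for p q k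
  proof -
    have "T dvd (p - q) + (q - monom 1 k * u) \<longleftrightarrow> T dvd (q - monom 1 k * u)" for u
      using that by (rule dvd_add_right_iff)
    then show ?thesis unfolding val_def by simp
  qed
  have z: "T dvd nform X Y" if "T dvd X \<and> T dvd Y" for X Y
    using that unfolding nform_def by (intro dvd_add dvd_mult) auto
  show ?thesis
  proof (cases "T dvd C \<and> T dvd E")
    case True
    then have "T dvd nform A B" using assms z by (metis dvd_mult dvd_diff_left_iff)
    then show ?thesis using True nform_val val_not_dvd by meson
  next
    case False
    then obtain k where "val (nform C E) (2*k)" using nform_val by blast
    then have k: "val ([:3,1:] * nform C E) (1 + 2 * k)" using val_mult val_x_plus_3 by blast
    then have k': "val (nform A B) (1 + 2 * k)" using *[OF assms] by blast
    then have "\<not> T dvd nform A B" using val_not_dvd by blast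
    then obtain l where l: "val (nform A B) (2*l)" using z nform_val by blast
    obtain u w where "unit0 u" "unit0 w" "T dvd nform A B - monom 1 (1+2*k) * u"
      "T dvd nform A B - monom 1 (2*l) * w" using k' l val_def by auto
    then have "1 + 2 * k = 2 * l" using val_unique by blast
    then show ?thesis by presburger
  qed
qed

text \<open>Makes T the minimal polynomial of its real root. A counterexample p of least degree
  divides some a T, since the pseudo-remainder has the same root. T is prime and p is too small to
  be divisible by it, so T divides the cofactor and p is constant.\<close>

lemma root_small_degree:
  fixes x :: real
  assumes x: "poly (map_poly of_int T) x = 0"
  shows "degree p < n \<Longrightarrow> poly (map_poly of_int p) x = 0 \<Longrightarrow> p = 0"
proof (induction "degree p" arbitrary: p rule: less_induct)
  case less
  show ?case
  proof (rule ccontr)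
    assume p: "p \<noteq> 0"
    define r where "r = pseudo_mod T p"
    obtain a q where aq: "a \<noteq> 0" "smult a T = p * q + r" using pseudo_mod(1)[OF p, of T] r_def by auto
    have r: "r = 0 \<or> degree r < degree p" using pseudo_mod(2)[OF p, of T] r_def by auto
    interpret map_poly_comm_ring_hom "of_int :: int \<Rightarrow> real" ..
    have "poly (map_poly of_int (smult a T)) x = (0::real)" using x by (simp add: hom_distribs)
    then have "poly (map_poly of_int r) x = (0::real)" unfolding aq using less.prems by (simp add: hom_distribs)
    then have r0: "r = 0" using r less by (metis less.hyps less.prems(1) order_less_trans)
    then have e: "smult a T = p * q" using aq by simp
    have "p * q \<noteq> 0" using e aq T_nz by (metis smult_eq_0_iff)
    then have dq: "degree p + degree q = n" using e degT aq p by (metis degree_mult_eq degree_smult_eq mult_zero_right)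
    have "T dvd p * q" using e by (metis dvd_smult dvd_refl)
    then have "T dvd q" using T_prime small_dvd less.prems p by blast
    moreover have "q \<noteq> 0" using \<open>p * q \<noteq> 0\<close> by auto
    ultimately have "n \<le> degree q" using dvd_imp_degree_le[of T q] degT by simp
    then have "degree p = 0" using dq by simp
    then obtain c where "p = [:c:]" by (rule degree_eq_zeroE)
    then show False using less.prems p by simp
  qed
qed

lemma root_imp_dvd:
  fixes x :: real
  assumes x: "poly (map_poly of_int T) x = 0" and p: "poly (map_poly of_int p) x = 0"
  shows "T dvd p"
proof -
  obtain q r where qr: "p = T * q + r" "degree r < n"
    using monic_division[of T p] degT monT n2 by auto
  interpret map_poly_comm_ring_hom "of_int :: int \<Rightarrow> real" ..
  have "poly (map_poly of_int r) x = (0::real)" using p x unfolding qr by (simp add: hom_distribs)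
  then show ?thesis using root_small_degree[OF x qr(2)] qr by simp
qed

end

section \<open>Totally real Eisenstein polynomials with roots near $[-2,2]$\<close>

fun dickson :: "real \<Rightarrow> nat \<Rightarrow> real poly" where
  "dickson a 0 = [:2:]"
| "dickson a (Suc 0) = [:0, 1:]"
| "dickson a (Suc (Suc n)) = [:0, 1:] * dickson a (Suc n) - smult a (dickson a n)"

text \<open>Equal to n/(n-k) times the binomial coefficient of n-k over k, as a sum of two binomials
  to remain in the natural numbers. For k = 0 truncated subtraction would make the second summand 1
  instead of 0.\<close>

definition lucas_coeff :: "nat \<Rightarrow> nat \<Rightarrow> nat" where
  "lucas_coeff n k = (if k = 0 then 1 else (n - k choose k) + (n - k - 1 choose (k - 1)))"

lemma dickson_cos: "poly (dickson (r^2) n) (2 * r * cos x) = 2 * r ^ n * cos (n * x)"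
proof (induction "r^2" n rule: dickson.induct)
  case (3 n)
  have "cos (real (Suc (Suc n)) * x) + cos (n * x) = 2 * cos x * cos (real (Suc n) * x)"
  proof -
    have e: "real (Suc (Suc n)) * x = Suc n * x + x" "n * x = Suc n * x - x" by (auto simp: algebra_simps)
    show ?thesis unfolding e cos_add cos_diff by simp
  qed
  then have e: "cos (real (Suc (Suc n)) * x) = 2 * cos x * cos (real (Suc n) * x) - cos (n * x)" by linarith
  show ?case unfolding dickson.simps poly_diff poly_mult poly_smult 3 e
    by (simp add: power2_eq_square algebra_simps)
qed auto

lemma lucas_coeff_rec:
  assumes "n \<ge> 1" "2 * k \<le> n"
  shows "lucas_coeff (Suc (Suc n)) (Suc k) = lucas_coeff (Suc n) (Suc k) + lucas_coeff n k"
proof (cases k)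
  case 0
  then show ?thesis using assms by (simp add: lucas_coeff_def)
next
  case (Suc l)
  have "k \<le> n" using assms by simp
  then obtain d where d: "n = k + d" using le_Suc_ex by blast
  show ?thesis
  proof (cases d)
    case 0
    then show ?thesis using d Suc assms by simp
  next
    case (Suc e)
    then show ?thesis using d \<open>k = Suc l\<close> by (simp add: lucas_coeff_def)
  qed
qed

text \<open>The index 0 is exceptional: \<open>dickson a 0\<close> is 2, while
  \<open>lucas_coeff 0 0\<close> is 1.\<close>

lemma coeff_dickson:
  assumes "n \<ge> 1"
  shows "coeff (dickson a n) j =
    (if j \<le> n \<and> even (n - j) then (- a) ^ ((n - j) div 2) * lucas_coeff n ((n - j) div 2) else 0)"
  using assms
proof (induction a n arbitrary: j rule: dickson.induct)
  case (2 a)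
  then show ?case by (cases j) (auto simp: lucas_coeff_def coeff_pCons split: nat.splits)
next
  case (3 a n)
  note IH = 3
  show ?case
  proof (cases "n = 0")
    case True
    have "j = 0 \<or> j = 1 \<or> j = 2 \<or> j > 2" by linarith
    then show ?thesis using True
      by (auto simp: lucas_coeff_def coeff_pCons numeral_2_eq_2 split: nat.splits)
  next
    case False
    then have n: "n \<ge> 1" by simp
    have c: "coeff (dickson a (Suc (Suc n))) j =
      (case j of 0 \<Rightarrow> 0 | Suc i \<Rightarrow> coeff (dickson a (Suc n)) i) - a * coeff (dickson a n) j"
      by (simp add: coeff_pCons split: nat.splits)
    consider "j > Suc (Suc n)" | "j = Suc (Suc n)" | "odd (n - j)" "j \<le> n" | "j = Suc n" | k where "j + 2 * k = n"
    proof -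
      have "\<exists>k. j + 2 * k = n" if "j \<le> n" "even (n - j)"
        using that by (metis evenE le_add_diff_inverse)
      then show ?thesis using that by (metis le_Suc_eq linorder_not_le)
    qed
    then show ?thesis
    proof cases
      case 1
      then show ?thesis unfolding c using IH n by (auto split: nat.splits)
    next
      case 2
      then show ?thesis unfolding c using IH n by (auto split: nat.splits simp: lucas_coeff_def)
    next
      case 3
      then have "odd (Suc (Suc n) - j)" "\<And>i. j = Suc i \<Longrightarrow> odd (Suc n - i)" by (auto simp: Suc_diff_le)
      then show ?thesis unfolding c using IH n 3 by (auto split: nat.splits)
    next
      case 4
      then show ?thesis unfolding c using IH n by (auto split: nat.splits)
    next
      case (5 k)
      have e1: "Suc (Suc n) - j = 2 * Suc k" and e2: "n - j = 2 * k" and jn: "j \<le> n" using 5 by auto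
      have A: "coeff (dickson a n) j = (- a) ^ k * lucas_coeff n k"
        using IH(2)[OF n, of j] e2 jn by simp
      have B: "(case j of 0 \<Rightarrow> 0 | Suc i \<Rightarrow> coeff (dickson a (Suc n)) i) = (- a) ^ Suc k * lucas_coeff (Suc n) (Suc k)"
      proof (cases j)
        case 0
        \<comment> \<open>A multiple of x has no constant coefficient; accordingly both binomials in
          the formula have a lower index above the upper one.\<close>
        then have "n = 2 * k" "k \<ge> 1" using 5 n by auto
        then have "Suc n - Suc k < Suc k" "Suc n - Suc k - 1 < k" by auto
        then have "lucas_coeff (Suc n) (Suc k) = 0" by (simp add: lucas_coeff_def binomial_eq_0)
        then show ?thesis using 0 by simp
      next
        case (Suc i)
        then have "Suc n - i = 2 * Suc k" "i \<le> Suc n" using 5 by auto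
        then show ?thesis using IH(1)[of i] Suc by simp
      qed
      have "2 * k \<le> n" using 5 by simp
      show ?thesis unfolding c A B using e1 jn lucas_coeff_rec[OF n \<open>2 * k \<le> n\<close>]
        by (simp add: algebra_simps)
    qed
  qed
qed simp

text \<open>The absorption identity for binomials, in the form that exposes the factor n; for n =
  3^N it is the source of the powers of 3.\<close>

lemma lucas_coeff_mult:
  assumes "1 \<le> k" "2 * k \<le> n"
  shows "k * lucas_coeff n k = n * (n - k - 1 choose (k - 1))"
proof -
  have "k * (n - k choose k) = (n - k) * (n - k - 1 choose (k - 1))"
    using assms times_binomial_minus1_eq[of k "n - k"] by simp
  then show ?thesis using assms
    by (simp add: lucas_coeff_def distrib_left diff_mult_distrib)
qed

text \<open>By the absorption identity 3^N divides k times the coefficient, and k takes away at most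
  its own 3-adic valuation v, which is less than k because 3^v <= k.\<close>

lemma lucas_coeff_dvd:
  assumes "1 \<le> k" "2 * k \<le> 3 ^ N"
  shows "3 ^ (N - k) dvd lucas_coeff (3 ^ N) k"
proof -
  obtain k' where k': "k = 3 ^ multiplicity 3 k * k'" "\<not> 3 dvd k'"
    using multiplicity_decompose'[of k 3] assms by auto
  define v where "v = multiplicity 3 k"
  have kv: "k = 3 ^ v * k'" using k' v_def by simp
  have "v < 3 ^ v" by (rule less_exp[THEN order_less_le_trans]) (simp add: power_mono)
  also have "3 ^ v \<le> k" unfolding kv using assms kv by (cases k') auto
  finally have v: "v < k" .
  have "3 ^ N dvd k * lucas_coeff (3 ^ N) k" using lucas_coeff_mult[OF assms] by simp
  then have *: "3 ^ N dvd 3 ^ v * (k' * lucas_coeff (3 ^ N) k)" unfolding kv by (simp add: mult.assoc)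
  show ?thesis
  proof (cases "v \<le> N")
    case True
    then have "3 ^ v * 3 ^ (N - v) dvd 3 ^ v * (k' * lucas_coeff (3 ^ N) k)"
      using * by (simp flip: power_add)
    then have "3 ^ (N - v) dvd k' * lucas_coeff (3 ^ N) k" by (simp only: nat_mult_dvd_cancel_disj) simp
    moreover have "coprime (3 ^ (N - v)) k'"
      using k'(2) by (intro coprime_power_left_iff[THEN iffD2] disjI1) (simp add: prime_imp_coprime)
    ultimately have "3 ^ (N - v) dvd lucas_coeff (3 ^ N) k" by (simp add: coprime_dvd_mult_right_iff)
    moreover have "3 ^ (N - k) dvd (3::nat) ^ (N - v)" using v by (intro le_imp_power_dvd) simp
    ultimately show ?thesis by (rule dvd_trans[rotated])
  next
    case False
    then show ?thesis using v by simp
  qed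
qed

text \<open>The k-th power of 1 + 1/3^s has denominator 3^(s k), and the Lucas coefficient supplies
  3^(N-k). A factor 3 is left over once N - k >= s k + 1, which the bound on N gives for all k <=
  m.\<close>

lemma top_coeff_dickson:
  assumes k: "1 \<le> k" "k \<le> m" "2 * k \<le> 3 ^ N" and N: "(s + 1) * m + 1 \<le> N"
  shows "\<exists>z::int. coeff (dickson (1 + 1 / 3 ^ s) (3 ^ N)) (3 ^ N - 2 * k) = 3 * of_int z"
proof -
  let ?n = "(3::nat) ^ N"
  have "(s + 1) * k \<le> (s + 1) * m" using k by (intro mult_le_mono2)
  then have "(s+1)*k + 1 \<le> N" using N by linarith
  then have sk: "s * k + 1 \<le> N - k" by simp
  obtain c where c: "lucas_coeff ?n k = 3 ^ (N - k) * c" using lucas_coeff_dvd[OF k(1,3)] by (auto simp: dvd_def)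
  have "3 ^ (N - k) = (3::nat) ^ (s * k) * 3 * 3 ^ (N - k - (s * k + 1))"
    using sk by (metis le_add_diff_inverse power_add power_one_right)
  then have c': "real (lucas_coeff ?n k) = (3 ^ s) ^ k * (3 * (3 ^ (N - k - (s * k + 1)) * c))"
    unfolding c by (simp add: power_mult)
  have "?n - (?n - 2 * k) = 2 * k" using k by simp
  then have "coeff (dickson (1 + 1 / 3 ^ s) ?n) (?n - 2 * k) = (- (1 + 1 / 3 ^ s)) ^ k * lucas_coeff ?n k"
    by (subst coeff_dickson) auto
  also have "\<dots> = (- (1 + 1 / 3 ^ s) * 3 ^ s) ^ k * (3 * (3 ^ (N - k - (s * k + 1)) * c))"
    unfolding c' by (simp only: power_mult_distrib mult.assoc of_nat_mult of_nat_power of_nat_numeral)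
  also have "- (1 + 1 / 3 ^ s) * 3 ^ s = (- (3 ^ s + 1) :: real)" by (simp add: field_simps)
  finally show ?thesis by (intro exI[of _ "(- (3 ^ s + 1)) ^ k * (3 ^ (N - k - (s * k + 1)) * int c)"]) simp
qed

lemma dickson_odd_coeff:
  "coeff (dickson a (2 * j + 1)) i \<noteq> 0 \<Longrightarrow> odd i \<and> i \<le> 2 * j + 1"
  "coeff (dickson a (2 * j + 1)) (2 * j + 1) = 1"
proof -
  show "odd i \<and> i \<le> 2 * j + 1" if "coeff (dickson a (2 * j + 1)) i \<noteq> 0"
  proof -
    have "i \<le> 2 * j + 1 \<and> even (2 * j + 1 - i)"
      using that by (subst (asm) coeff_dickson) (auto split: if_splits)
    then show ?thesis by presburger
  qed
  show "coeff (dickson a (2 * j + 1)) (2 * j + 1) = 1"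
    by (subst coeff_dickson) (auto simp: lucas_coeff_def)
qed

text \<open>Works from the top degree down: a Dickson polynomial is monic, so a multiple of it by a
  number in [0,3] lifts the current coefficient to the next multiple of 3 and disturbs only lower
  ones. Odd indices keep the polynomial odd, hence its constant term zero.\<close>

lemma round_odd_poly:
  assumes "\<And>i. coeff R i \<noteq> 0 \<Longrightarrow> odd i \<and> i < 2 * j"
  shows "\<exists>\<alpha>. (\<forall>i<j. 0 \<le> \<alpha> i \<and> \<alpha> i \<le> 3) \<and>
    (\<forall>i. \<exists>z::int. coeff (R + (\<Sum>i<j. smult (\<alpha> i) (dickson a (2 * i + 1)))) i = 3 * of_int z) \<and>
    (\<forall>i. coeff (R + (\<Sum>i<j. smult (\<alpha> i) (dickson a (2 * i + 1)))) i \<noteq> 0 \<longrightarrow> odd i \<and> i < 2 * j)"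
  using assms
proof (induction j arbitrary: R)
  case 0
  then have "R = 0" by (intro poly_eqI) (metis coeff_0 mult_0_right not_less_zero)
  then show ?case by (intro exI[of _ "\<lambda>_. 0"]) (auto intro: exI[of _ 0])
next
  case (Suc j)
  define c where "c = coeff R (2 * j + 1)"
  define z where "z = \<lceil>c / 3\<rceil>"
  define x where "x = 3 * of_int z - c"
  have x: "0 \<le> x" "x \<le> 3" unfolding x_def z_def by linarith+
  define R' where "R' = R + smult x (dickson a (2 * j + 1)) - monom (3 * of_int z) (2 * j + 1)"
  have R': "odd i \<and> i < 2 * j" if "coeff R' i \<noteq> 0" for i
  proof -
    have "coeff R' (2 * j + 1) = 0"
      unfolding R'_def coeff_add coeff_diff coeff_smult dickson_odd_coeff(2) by (simp add: x_def c_def)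
    then have i: "i \<noteq> 2 * j + 1" using that by metis
    then have "coeff R i \<noteq> 0 \<or> coeff (dickson a (2 * j + 1)) i \<noteq> 0"
      using that unfolding R'_def coeff_add coeff_diff coeff_smult coeff_monom by auto
    then have "odd i \<and> i < 2 * Suc j" using Suc.prems dickson_odd_coeff(1) by fastforce
    then show ?thesis using i by presburger
  qed
  obtain \<alpha> where \<alpha>: "\<forall>i<j. 0 \<le> \<alpha> i \<and> \<alpha> i \<le> 3"
    "\<And>i. \<exists>z::int. coeff (R' + (\<Sum>i<j. smult (\<alpha> i) (dickson a (2 * i + 1)))) i = 3 * of_int z"
    "\<And>i. coeff (R' + (\<Sum>i<j. smult (\<alpha> i) (dickson a (2 * i + 1)))) i \<noteq> 0 \<Longrightarrow> odd i \<and> i < 2 * j"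
    using Suc.IH[OF R'] by blast
  define \<beta> where "\<beta> = \<alpha>(j := x)"
  define U where "U = R' + (\<Sum>i<j. smult (\<alpha> i) (dickson a (2 * i + 1)))"
  have "(\<Sum>i<j. smult (\<beta> i) (dickson a (2 * i + 1))) = (\<Sum>i<j. smult (\<alpha> i) (dickson a (2 * i + 1)))"
    by (intro sum.cong) (auto simp: \<beta>_def)
  then have e: "R + (\<Sum>i<Suc j. smult (\<beta> i) (dickson a (2 * i + 1))) = U + monom (3 * of_int z) (2 * j + 1)"
    unfolding U_def R'_def by (simp add: \<beta>_def)
  show ?case
  proof (intro exI[of _ \<beta>] conjI allI impI)
    fix i assume "i < Suc j"
    then show "0 \<le> \<beta> i" "\<beta> i \<le> 3" using \<alpha>(1) x by (auto simp: \<beta>_def less_Suc_eq)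
  next
    fix i
    obtain w where "coeff U i = 3 * of_int w" using \<alpha>(2) U_def by blast
    then show "\<exists>z::int. coeff (R + (\<Sum>i<Suc j. smult (\<beta> i) (dickson a (2 * i + 1)))) i = 3 * of_int z"
      unfolding e coeff_add coeff_monom by (intro exI[of _ "w + (if 2 * j + 1 = i then z else 0)"]) simp
  next
    fix i assume "coeff (R + (\<Sum>i<Suc j. smult (\<beta> i) (dickson a (2 * i + 1)))) i \<noteq> 0"
    then have "coeff U i \<noteq> 0 \<or> i = 2 * j + 1" unfolding e coeff_add coeff_monom by (auto split: if_splits)
    then show "odd i" "i < 2 * Suc j" using \<alpha>(3)[of i] U_def by auto
  qed
qed

section \<open>Real roots from sign changes\<close>

lemma poly_sign_changes:
  fixes p :: "real poly"
  assumes "\<And>k. k < n \<Longrightarrow> x (Suc k) < x k"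
    and "\<And>k. k \<le> n \<Longrightarrow> 0 < (- 1) ^ k * poly p (x k)"
  shows "\<exists>t. inj_on t {..<n} \<and> (\<forall>k<n. x (Suc k) < t k \<and> t k < x k \<and> poly p (t k) = 0)"
proof -
  have "\<exists>y. x (Suc k) < y \<and> y < x k \<and> poly p y = 0" if k: "k < n" for k
  proof -
    have "0 < ((- 1) ^ k * poly p (x k)) * ((- 1) ^ Suc k * poly p (x (Suc k)))"
      using k by (intro mult_pos_pos[OF assms(2) assms(2)]) auto
    also have "\<dots> = ((- 1) ^ k * (- 1) ^ Suc k) * (poly p (x (Suc k)) * poly p (x k))" by (simp only: mult_ac)
    also have "(- 1) ^ k * (- 1) ^ Suc k = (-1::real)" by (cases "even k") simp_all
    finally show ?thesis using poly_IVT[of "x (Suc k)" "x k" p] assms(1)[OF k] by auto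
  qed
  then obtain t where t: "\<And>k. k < n \<Longrightarrow> x (Suc k) < t k \<and> t k < x k \<and> poly p (t k) = 0" by metis
  have mono: "j < n \<Longrightarrow> i < j \<Longrightarrow> t j < t i" for i j
  proof (induction j)
    case (Suc j)
    then have "t (Suc j) < t j" using t[of j] t[of "Suc j"] by auto
    then show ?case using Suc by (cases "i = j") auto
  qed simp
  have "inj_on t {..<n}"
    by (rule linorder_inj_onI) (use mono in \<open>force+\<close>)
  then show ?thesis using t by blast
qed

lemma integer_poly_lift:
  fixes Q :: "real poly"
  assumes "\<And>i. coeff Q i \<in> \<int>"
  obtains T :: "int poly" where "map_poly of_int T = Q"
proof
  have "of_int \<lfloor>coeff Q i\<rfloor> = coeff Q i" for i using assms by (metis Ints_cases floor_of_int)
  then show "map_poly of_int (map_poly floor Q) = Q"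
    by (intro poly_eqI) (simp add: coeff_map_poly)
qed

text \<open>The polynomial is D_n + E + 3: the leading coefficients of D_n are good already, E
  rounds those of degree below 2j, and all but the last summand is odd. At the n + 1 extremal points
  D_n alternates between 2 r^n and - 2 r^n, where r = sqrt a, while E and 3 each stay below r^n in
  absolute value, so no sign change is lost.\<close>

lemma eisenstein_interval_poly:
  fixes a :: real and s N m j :: nat
  defines "a \<equiv> 1 + 1 / 3 ^ s"
  assumes j: "3 ^ N = 2 * m + 2 * j + 1" and N: "(s + 1) * m + 1 \<le> N"
    and am: "6 * 3 ^ s < a ^ m" and aN: "3 < sqrt a ^ (3 ^ N)" and N1: "N \<ge> 1"
  obtains T :: "int poly" and t :: "nat \<Rightarrow> real" where "eisenstein3 T (3 ^ N)" "inj_on t {..<3 ^ N}"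
    "\<forall>i<3 ^ N. poly (map_poly of_int T) (t i) = 0 \<and> \<bar>t i\<bar> < 2 * sqrt a"
    "t 0 > 2 * sqrt a * cos (pi / 3 ^ N)"
proof -
  define n :: nat where "n = 3 ^ N"
  have n: "n = 2 * m + 2 * j + 1" "odd n" using j unfolding n_def by auto
  have n3: "n \<ge> 3" unfolding n_def using N1 self_le_power[of 3 N] by simp
  have a: "a > 1" unfolding a_def by simp
  define r where "r = sqrt a"
  have r: "r > 1" "r^2 = a" using a unfolding r_def by auto
  define C where "C = dickson a n"
  have cC: "coeff C i = (if i \<le> n \<and> even (n - i) then (- a) ^ ((n - i) div 2) * lucas_coeff n ((n - i) div 2) else 0)" for i
    unfolding C_def using n3 by (intro coeff_dickson) simp
  define R where "R = poly_cutoff (2 * j) C"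
  have cR: "coeff R i = (if i < 2 * j then coeff C i else 0)" for i by (simp add: R_def coeff_poly_cutoff)
  have R: "odd i \<and> i < 2 * j" if "coeff R i \<noteq> 0" for i
  proof -
    have "i < 2 * j \<and> i \<le> n \<and> even (n - i)" using that by (auto simp: cR cC split: if_splits)
    then show ?thesis using n(2) by presburger
  qed
  obtain \<alpha> where \<alpha>: "\<And>i. i < j \<Longrightarrow> 0 \<le> \<alpha> i \<and> \<alpha> i \<le> 3"
    "\<And>i. \<exists>z::int. coeff (R + (\<Sum>i<j. smult (\<alpha> i) (dickson a (2 * i + 1)))) i = 3 * of_int z"
    "\<And>i. coeff (R + (\<Sum>i<j. smult (\<alpha> i) (dickson a (2 * i + 1)))) i \<noteq> 0 \<Longrightarrow> odd i \<and> i < 2 * j"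
    using round_odd_poly[where a=a and R=R and j=j, OF R] by blast
  define E where "E = (\<Sum>i<j. smult (\<alpha> i) (dickson a (2 * i + 1)))"
  define Q where "Q = C + E + [:3:]"
  have cQ: "coeff Q i = (coeff C i - coeff R i) + coeff (R + E) i + (if i = 0 then 3 else 0)" for i
    by (simp add: Q_def coeff_pCons split: nat.splits)
  have Cn: "coeff C n = 1" "coeff (R + E) n = 0" "coeff R n = 0"
    using \<alpha>(3)[of n] n by (auto simp: cC cR lucas_coeff_def E_def)
  have Qn: "coeff Q n = 1" unfolding cQ Cn using n3 by simp
  have Qgt: "coeff Q i = 0" if "i > n" for i
    using that \<alpha>(3)[of i] n n3 unfolding cQ by (auto simp: cC cR E_def)
  have "coeff (R + E) 0 = 0" using \<alpha>(3)[of 0] unfolding E_def by blast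
  moreover have "coeff C 0 = 0" using n by (simp add: cC)
  ultimately have Q0: "coeff Q 0 = 3" unfolding cQ by (simp add: cR)
  have Qlow: "\<exists>z::int. coeff Q i = 3 * of_int z" if "i < n" for i
  proof -
    have "\<exists>z::int. coeff C i - coeff R i = 3 * of_int z"
    proof (cases "i < 2 * j \<or> odd (n - i)")
      case True
      then show ?thesis using that by (intro exI[of _ 0]) (auto simp: cC cR)
    next
      case False
      define k where "k = (n - i) div 2"
      have k: "n - 2 * k = i" "1 \<le> k" "k \<le> m" "2 * k \<le> 3 ^ N"
        using False that n unfolding k_def n_def[symmetric] by presburger+
      show ?thesis using top_coeff_dickson[OF k(2,3,4) N] k(1) False
        unfolding cR C_def a_def n_def by simp
    qed
    then obtain z w where "coeff C i - coeff R i = 3 * of_int (z::int)" "coeff (R + E) i = 3 * of_int (w::int)"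
      using \<alpha>(2)[of i] E_def by blast
    then show ?thesis unfolding cQ by (intro exI[of _ "z + w + (if i = 0 then 1 else 0)"]) simp
  qed
  have "coeff Q i \<in> \<int>" for i
    using Qlow[of i] Qn Qgt[of i] by (cases i n rule: linorder_cases) auto
  then obtain T :: "int poly" where T: "map_poly of_int T = Q" using integer_poly_lift by blast
  have cT: "of_int (coeff T i) = coeff Q i" for i unfolding T[symmetric] by simp
  have eis: "eisenstein3 T n"
  proof
    show "2 \<le> n" using n3 by simp
    show Tn: "coeff T n = 1" using cT[of n] Qn by simp
    have "coeff T i = 0" if "i > n" for i using cT[of i] Qgt[OF that] by simp
    then show "degree T = n" using Tn by (intro antisym degree_le le_degree) auto
    show "3 dvd coeff T k" if k: "k < n" for k
    proof -
      obtain z where "coeff Q k = 3 * of_int (z::int)" using Qlow[OF k] by blast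
      then have "of_int (coeff T k) = (of_int (3 * z) :: real)" using cT[of k] by simp
      then show ?thesis by (metis dvd_triv_left of_int_eq_iff)
    qed
    show "coeff T 0 = 3" using cT[of 0] Q0 by simp
  qed
  have err: "\<bar>poly (E + [:3:]) (2 * r * cos x)\<bar> < 2 * r ^ n" for x
  proof -
    have "\<bar>poly E (2 * r * cos x)\<bar> \<le> (\<Sum>i<j. \<bar>\<alpha> i * poly (dickson (r^2) (2 * i + 1)) (2 * r * cos x)\<bar>)"
      unfolding E_def poly_sum r(2) poly_smult by (rule sum_abs)
    also have "\<dots> \<le> (\<Sum>i<j. 6 * r * a ^ i)"
    proof (rule sum_mono)
      fix i assume "i \<in> {..<j}"
      then have "0 \<le> \<alpha> i" "\<alpha> i \<le> 3" using \<alpha>(1) by auto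
      moreover have "r ^ (2 * i + 1) = r * a ^ i" using r(2) by (simp add: power_mult)
      moreover have "\<bar>cos (real (2 * i + 1) * x)\<bar> \<le> 1" by simp
      ultimately have "\<bar>\<alpha> i\<bar> * (2 * (r * a ^ i)) * \<bar>cos (real (2 * i + 1) * x)\<bar> \<le> 3 * (2 * (r * a ^ i)) * 1"
        using r a by (intro mult_mono) auto
      then show "\<bar>\<alpha> i * poly (dickson (r^2) (2 * i + 1)) (2 * r * cos x)\<bar> \<le> 6 * r * a ^ i"
        unfolding dickson_cos using \<open>r ^ (2 * i + 1) = r * a ^ i\<close> r a by (simp add: abs_mult mult_ac)
    qed
    also have "\<dots> = 6 * r * ((a ^ j - 1) / (a - 1))"
      using a by (simp add: sum_distrib_left[symmetric] geometric_sum)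
    \<comment> \<open>Since a - 1 = 1/3^s, the geometric series costs a factor 3^s; the hypothesis
      on \<open>a ^ m\<close> is there to beat it.\<close>
    also have "\<dots> = 6 * 3 ^ s * (r * (a ^ j - 1))" unfolding a_def by (simp add: field_simps)
    also have "\<dots> \<le> 6 * 3 ^ s * (r * a ^ j)" using r by (intro mult_left_mono) auto
    also have "\<dots> < a ^ m * (r * a ^ j)" using am r a by (intro mult_strict_right_mono) auto
    also have "\<dots> = r ^ n" unfolding n r(2)[symmetric] by (simp add: power_add power_mult[symmetric] mult_ac)
    finally have "\<bar>poly E (2 * r * cos x)\<bar> < r ^ n" .
    moreover have "3 < r ^ n" using aN unfolding n_def r_def .
    ultimately show ?thesis by (auto simp: abs_if split: if_splits)
  qed
  \<comment> \<open>The extremal points of D_n, where the cosine of n times the angle is 1 or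
    -1.\<close>
  define x where "x = (\<lambda>k::nat. 2 * r * cos (k * pi / n))"
  have sg: "0 < (- 1) ^ k * poly Q (x k)" for k
  proof -
    have "real n * (k * pi / n) = k * pi" using n3 by simp
    then have "poly C (x k) = 2 * r ^ n * (- 1) ^ k"
      unfolding C_def x_def r(2)[symmetric] dickson_cos by (metis cos_npi)
    then have "poly Q (x k) = 2 * r ^ n * (- 1) ^ k + poly (E + [:3:]) (x k)" by (simp add: Q_def)
    then have "(- 1) ^ k * poly Q (x k) = 2 * r ^ n + (- 1) ^ k * poly (E + [:3:]) (x k)"
      by (cases "even k") auto
    moreover have "\<bar>(- 1) ^ k * poly (E + [:3:]) (x k)\<bar> < 2 * r ^ n"
      using err[of "k * pi / n"] unfolding x_def abs_mult power_abs by simp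
    ultimately show ?thesis by linarith
  qed
  have dec: "x (Suc k) < x k" if k: "k < n" for k
  proof -
    have "real (Suc k) * pi / n \<le> pi" using k n3 by (simp add: divide_simps)
    moreover have "real k * pi / n < real (Suc k) * pi / n" using n3 by (intro divide_strict_right_mono) auto
    ultimately have "cos (real (Suc k) * pi / n) < cos (real k * pi / n)" by (intro cos_monotone_0_pi) auto
    then show ?thesis unfolding x_def using r by simp
  qed
  obtain t where t: "inj_on t {..<n}" "\<And>k. k < n \<Longrightarrow> x (Suc k) < t k \<and> t k < x k \<and> poly Q (t k) = 0"
    using poly_sign_changes[of n x Q] dec sg by blast
  show ?thesis
  proof (rule that[of T t])
    show "eisenstein3 T (3 ^ N)" using eis n_def by simp
    show "inj_on t {..<3 ^ N}" using t n_def by simp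
    have "\<bar>t k\<bar> < 2 * r" if k: "k < n" for k
    proof -
      have "\<bar>x i\<bar> \<le> 2 * r" for i unfolding x_def abs_mult using r abs_cos_le_one[of "real i * pi / n"]
        by simp
      from this[of k] this[of "Suc k"] t(2)[OF k] show ?thesis by linarith
    qed
    then show "\<forall>i<3 ^ N. poly (map_poly of_int T) (t i) = 0 \<and> \<bar>t i\<bar> < 2 * sqrt a"
      using t(2) unfolding T r_def n_def by blast
    show "t 0 > 2 * sqrt a * cos (pi / 3 ^ N)"
      using t(2)[of 0] n3 unfolding x_def r_def n_def by simp
  qed
qed

text \<open>Robinson's construction: for $n = 3^N$ and $a = 1 + 3^{-s}$ the leading coefficients of the Dickson polynomial are
  already divisible by 3, and rounding the remaining ones does not destroy its sign changes.\<close>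

lemma eisenstein_interval:
  fixes r0 :: real
  assumes "r0 > 1"
  obtains T :: "int poly" and n :: nat and t :: "nat \<Rightarrow> real" where "eisenstein3 T n" "inj_on t {..<n}"
    "\<forall>i<n. poly (map_poly of_int T) (t i) = 0 \<and> \<bar>t i\<bar> < 2 * r0" "t 0 > 2"
proof -
  have "(\<lambda>s::nat. sqrt (1 + 1 / 3 ^ s)) \<longlonglongrightarrow> 1" by real_asymp
  then have "\<forall>\<^sub>F s::nat in sequentially. sqrt (1 + 1 / 3 ^ s) < r0"
    using assms by (rule order_tendstoD(2))
  then obtain s :: nat where s: "sqrt (1 + 1 / 3 ^ s) < r0" by (auto simp: eventually_sequentially)
  define a :: real where "a = 1 + 1 / 3 ^ s"
  define r where "r = sqrt a"
  have a: "a > 1" and r: "r > 1" by (auto simp: a_def r_def)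
  obtain m where m: "6 * 3 ^ s < a ^ m" using real_arch_pow[OF a] by blast
  \<comment> \<open>The largest root lies above 2 r cos(pi / 3^N), so this limit puts it beyond 2
    for large N.\<close>
  have "(\<lambda>N::nat. r * cos (pi / 3 ^ N)) \<longlonglongrightarrow> r" by real_asymp
  then have e1: "\<forall>\<^sub>F N::nat in sequentially. 1 < r * cos (pi / 3 ^ N)" using r by (rule order_tendstoD(1))
  obtain K where K: "3 < r ^ K" using real_arch_pow[OF r] by blast
  \<comment> \<open>The summands serve the divisibility of the leading coefficients, the bound 3 <
    r^(3^N), and the inequality 2 m < 3^N that leaves room for \<open>j\<close>.\<close>
  have e2: "\<forall>\<^sub>F N in sequentially. N \<ge> (s + 1) * m + 1 + K + 2 * m" by (rule eventually_ge_at_top)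
  obtain N where N: "1 < r * cos (pi / 3 ^ N)" "N \<ge> (s + 1) * m + 1 + K + 2 * m"
    using eventually_happens[OF eventually_conj[OF e1 e2]] by auto
  have N3: "N < 3 ^ N" by (rule less_exp[THEN order_less_le_trans]) (simp add: power_mono)
  have "r ^ K \<le> r ^ (3 ^ N)" using r N N3 by (intro power_increasing) auto
  then have rN: "3 < sqrt a ^ (3 ^ N)" using K unfolding r_def by linarith
  have "\<exists>j. k = 2 * m + 2 * j + 1" if "odd k" "2 * m < k" for k :: nat
    using that by presburger
  moreover have "odd ((3::nat) ^ N)" "2 * m < 3 ^ N" using N N3 by auto
  ultimately obtain j where j: "(3::nat) ^ N = 2 * m + 2 * j + 1" by blast
  have h: "(s + 1) * m + 1 \<le> N" "1 \<le> N" using N(2) by linarith+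
  show ?thesis
  proof (rule eisenstein_interval_poly[OF j h(1) m[unfolded a_def] rN[unfolded a_def] h(2)])
    fix T :: "int poly" and t :: "nat \<Rightarrow> real"
    assume T: "eisenstein3 T (3 ^ N)" "inj_on t {..<3 ^ N}"
    "\<forall>i<3 ^ N. poly (map_poly of_int T) (t i) = 0 \<and> \<bar>t i\<bar> < 2 * sqrt (1 + 1 / 3 ^ s)"
    "t 0 > 2 * sqrt (1 + 1 / 3 ^ s) * cos (pi / 3 ^ N)"
    show thesis
    proof (rule that[OF T(1,2)])
    show "\<forall>i<3 ^ N. poly (map_poly of_int T) (t i) = 0 \<and> \<bar>t i\<bar> < 2 * r0"
      using T(3) s by fastforce
    show "t 0 > 2" using T(4) N(1) unfolding r_def a_def by linarith
    qed
  qed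
qed

section \<open>Interpolation, traces and generic parameters\<close>

lemma poly_eq_on_points:
  fixes p q :: "'a::{idom} poly"
  assumes "inj_on t {..<n}" "degree p < n" "degree q < n" "\<And>i. i < n \<Longrightarrow> poly p (t i) = poly q (t i)"
  shows "p = q"
proof (rule ccontr)
  assume "p \<noteq> q"
  then have nz: "p - q \<noteq> 0" by simp
  have "n = card (t ` {..<n})" using assms(1) by (simp add: card_image)
  also have "\<dots> \<le> card {x. poly (p - q) x = 0}"
    using assms(4) poly_roots_finite[OF nz] by (intro card_mono) auto
  also have "\<dots> \<le> degree (p - q)" using nz by (rule card_poly_roots_bound)
  also have "\<dots> < n" using assms(2,3) by (rule degree_diff_less)
  finally show False by simp
qed

lemma interpolation_exists:
  fixes F :: "nat \<Rightarrow> 'a::field"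
  assumes "inj_on t {..<n}" "n > 0"
  shows "\<exists>p. degree p < n \<and> (\<forall>i<n. poly p (t i) = F i)"
proof -
  define M where "M = (\<lambda>i. \<Prod>j\<in>{..<n}-{i}. [:- t j, 1:])"
  have dM: "degree (M i) \<le> n - 1" if "i < n" for i
  proof -
    have "degree (M i) \<le> (\<Sum>j\<in>{..<n}-{i}. degree [:- t j, 1:])" unfolding M_def by (rule order_trans[OF degree_prod_sum_le]) (simp_all add: o_def)
    also have "\<dots> = n - 1" using that by simp
    finally show ?thesis .
  qed
  have M1: "poly (M i) (t i) \<noteq> 0" if "i < n" for i
    using that assms(1) by (auto simp: M_def poly_prod inj_on_def)
  have M0: "poly (M i) (t j) = 0" if "j < n" "i \<noteq> j" for i j
    using that by (auto simp: M_def poly_prod)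
  define p where "p = (\<Sum>i<n. smult (F i / poly (M i) (t i)) (M i))"
  have "degree p \<le> n - 1" unfolding p_def
    using dM by (intro degree_sum_le) (auto intro: order_trans[OF degree_smult_le])
  moreover have "poly p (t j) = F j" if "j < n" for j
  proof -
    have "poly p (t j) = (\<Sum>i<n. if i = j then F j else 0)"
      unfolding p_def poly_sum by (intro sum.cong) (use M0 M1 that in auto)
    then show ?thesis using that by simp
  qed
  ultimately show ?thesis using assms(2) by (intro exI[of _ p]) auto
qed

text \<open>The sum is the leading coefficient of the remainder of $pS'$ modulo $S$.\<close>

lemma sum_over_roots_int:
  fixes S p :: "int poly" and w :: "nat \<Rightarrow> complex"
  assumes S: "lead_coeff S = 1" "degree S = N" "N > 0"
    and w: "inj_on w {..<N}" "\<And>l. l < N \<Longrightarrow> poly (map_poly of_int S) (w l) = 0"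
  shows "(\<Sum>l<N. poly (map_poly of_int p) (w l)) \<in> \<int>"
proof -
  interpret map_poly_inj_comm_ring_hom "of_int :: int \<Rightarrow> complex" ..
  obtain Q R where QR: "p * pderiv S = S * Q + R" "degree R < N"
    using monic_division[of S "p * pderiv S"] S by auto
  define S' where "S' = map_poly (of_int :: int \<Rightarrow> complex) S"
  have S'0: "S' \<noteq> 0" using S unfolding S'_def by auto
  have dS': "degree S' = N" "lead_coeff S' = 1" using S unfolding S'_def by auto
  have "\<exists>U. S' = [:- w l, 1:] * U" if "l < N" for l
    using w(2)[OF that] by (simp add: S'_def poly_eq_0_iff_dvd dvd_def)
  then obtain U where U: "\<And>l. l < N \<Longrightarrow> S' = [:- w l, 1:] * U l" by metis
  have dU: "degree (U l) = N - 1" "coeff (U l) (N - 1) = 1" if "l < N" for l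
  proof -
    have nz: "U l \<noteq> 0" using U[OF that] S'0 by auto
    then have d: "degree S' = 1 + degree (U l)" unfolding U[OF that] by (subst degree_mult_eq) auto
    then show "degree (U l) = N - 1" using dS' by simp
    then show "coeff (U l) (N - 1) = 1" using dS'(2) U[OF that] lead_coeff_mult[of "[:- w l, 1:]" "U l"] by simp
  qed
  have UU: "poly (U l) (w l) = poly (pderiv S') (w l)" if "l < N" for l
  proof -
    have "pderiv S' = pderiv ([:- w l, 1:] * U l)" using U[OF that] by simp
    then show ?thesis by (simp only: pderiv_mult poly_add poly_mult) (simp add: pderiv_pCons)
  qed
  have U0: "poly (U l) (w m) = 0" if "l < N" "m < N" "l \<noteq> m" for l m
  proof -
    have "poly S' (w m) = (w m - w l) * poly (U l) (w m)" by (subst U[OF that(1)]) (simp add: algebra_simps)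
    moreover have "w m \<noteq> w l" using that w(1) by (auto simp: inj_on_def)
    ultimately show ?thesis using w(2)[OF that(2)] by (simp add: S'_def)
  qed
  let ?p = "\<lambda>l. poly (map_poly of_int p) (w l)"
  \<comment> \<open>Lagrange interpolation of p S' in the basis S/(x - w_l). Such a basis element
    has the value S'(w_l) at w_l, so the weights are just the p(w_l); it is monic of degree N - 1,
    so the weights add up to the top coefficient.\<close>
  have "map_poly of_int R = (\<Sum>l<N. smult (?p l) (U l))"
  proof (rule poly_eq_on_points[OF w(1)])
    show "degree (map_poly of_int R :: complex poly) < N" using QR by simp
    have "degree (\<Sum>l<N. smult (?p l) (U l)) \<le> N - 1"
      using dU by (intro degree_sum_le) (auto intro: order_trans[OF degree_smult_le])
    then show "degree (\<Sum>l<N. smult (?p l) (U l)) < N" using S by simp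
    fix m assume m: "m < N"
    have "poly (\<Sum>l<N. smult (?p l) (U l)) (w m) = (\<Sum>l<N. if l = m then ?p m * poly (U m) (w m) else 0)"
      unfolding poly_sum by (intro sum.cong) (use U0 m in auto)
    also have "\<dots> = ?p m * poly (pderiv S') (w m)" using m UU by simp
    also have "pderiv S' = map_poly of_int (pderiv S)" unfolding S'_def by (simp add: of_int_hom.map_poly_pderiv)
    also have "?p m * poly (map_poly of_int (pderiv S)) (w m) = poly (map_poly of_int (p * pderiv S)) (w m)"
      by (simp add: hom_distribs)
    also have "\<dots> = poly (map_poly of_int R) (w m)" unfolding QR(1) using w(2)[OF m] by (simp add: hom_distribs)
    finally show "poly (map_poly of_int R) (w m) = poly (\<Sum>l<N. smult (?p l) (U l)) (w m)" by simp
  qed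
  then have "of_int (coeff R (N - 1)) = coeff (\<Sum>l<N. smult (?p l) (U l)) (N - 1)"
    by (metis coeff_map_poly of_int_0)
  also have "\<dots> = (\<Sum>l<N. ?p l)" unfolding coeff_sum coeff_smult using dU by simp
  finally show ?thesis by (metis Ints_of_int)
qed

text \<open>Extend \<open>th\<close> to a basis of the reals over the rationals. Additivity is all
  that is recorded, because the functional will be moved past integer coordinates.\<close>

lemma rational_dual_functional:
  fixes th :: "nat \<Rightarrow> real"
  assumes li: "\<And>q::nat \<Rightarrow> rat. (\<Sum>k<K. of_rat (q k) * th k) = 0 \<Longrightarrow> \<forall>k<K. q k = 0"
    and m: "m < K"
  shows "\<exists>f :: real \<Rightarrow> real. (\<forall>x y. f (x + y) = f x + f y) \<and> (\<forall>k<K. f (th k) = (if k = m then 1 else 0))"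
proof -
  interpret R: vector_space "\<lambda>(q::rat) (x::real). of_rat q * x"
    by unfold_locales (auto simp: algebra_simps of_rat_add of_rat_mult)
  interpret P: vector_space_pair "\<lambda>(q::rat) (x::real). of_rat q * x" "\<lambda>(q::rat) (x::real). of_rat q * x" ..
  \<comment> \<open>Independence concerns the set of values, the hypothesis the family; a repeated
    value would already be a relation.\<close>
  have inj: "inj_on th {..<K}"
  proof (rule inj_onI)
    fix i j assume ij: "i \<in> {..<K}" "j \<in> {..<K}" "th i = th j"
    show "i = j"
    proof (rule ccontr)
      assume ne: "i \<noteq> j"
      define q :: "nat \<Rightarrow> rat" where "q = (\<lambda>k. (if k = i then 1 else 0) - (if k = j then 1 else 0))"
      have "(\<Sum>k<K. of_rat (q k) * th k) = (\<Sum>k<K. (if k = i then th i else 0) - (if k = j then th j else 0))"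
        by (intro sum.cong) (auto simp: q_def of_rat_diff)
      also have "\<dots> = 0" using ij by (simp add: sum_subtractf)
      finally have "q i = 0" using li ij by auto
      then show False using ne by (simp add: q_def)
    qed
  qed
  have "R.independent (th ` {..<K})"
  proof
    assume "R.dependent (th ` {..<K})"
    then obtain u where u: "\<exists>v\<in>th ` {..<K}. u v \<noteq> 0" "(\<Sum>v\<in>th ` {..<K}. of_rat (u v) * v) = 0"
      by (subst (asm) R.dependent_finite) auto
    have "(\<Sum>k<K. of_rat (u (th k)) * th k) = 0" using u(2) by (subst (asm) sum.reindex[OF inj]) simp
    then have "\<forall>k<K. u (th k) = 0" by (rule li)
    then show False using u(1) by auto
  qed
  then obtain f where f: "Vector_Spaces.linear (\<lambda>(q::rat) (x::real). of_rat q * x) (\<lambda>(q::rat) (x::real). of_rat q * x) f" "\<forall>x\<in>th ` {..<K}. f x = (if x = th m then 1 else 0)"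
    using P.linear_independent_extend[of _ "\<lambda>x. if x = th m then 1 else 0"] by blast
  show ?thesis
  proof (intro exI[of _ f] conjI allI impI)
    show "f (x + y) = f x + f y" for x y using f(1) by (rule P.linear_add)
    show "f (th k) = (if k = m then 1 else 0)" if "k < K" for k
      using f(2) that inj m by (auto simp: inj_on_def)
  qed
qed

text \<open>A rational relation between the coefficients is a Laurent polynomial equation in z. Its
  exponents -(i+1) and i+1 are pairwise distinct, so \<open>det\<close> makes it nontrivial. There
  are countably many relations, each with finitely many solutions, and some z in (0,1) escapes them
  all.\<close>

lemma generic_interpolation:
  fixes t a1 a2 c1 c2 :: "nat \<Rightarrow> real"
  assumes t: "inj_on t {..<n}" and n: "n > 0"
    and det: "\<And>i. i < n \<Longrightarrow> a1 i * c2 i - a2 i * c1 i \<noteq> 0"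
  shows "\<exists>z>0. \<forall>p1 p3. degree p1 < n \<longrightarrow> degree p3 < n \<longrightarrow>
    (\<forall>i<n. poly p1 (t i) = a1 i / z ^ (i + 1) + a2 i * z ^ (i + 1) \<and>
           poly p3 (t i) = c1 i / z ^ (i + 1) + c2 i * z ^ (i + 1)) \<longrightarrow>
    (\<forall>q q' :: nat \<Rightarrow> rat. (\<Sum>k<n. of_rat (q k) * coeff p1 k + of_rat (q' k) * coeff p3 k) = 0 \<longrightarrow>
       (\<forall>k<n. q k = 0 \<and> q' k = 0))"
proof -
  have "\<forall>i. \<exists>p. degree p < n \<and> (\<forall>j<n. poly p (t j) = (if i = j then 1 else 0))"
    by (intro allI interpolation_exists[OF t n])
  then obtain L :: "nat \<Rightarrow> real poly" where L: "\<And>i. degree (L i) < n" "\<And>i j. j < n \<Longrightarrow> poly (L i) (t j) = (if i = j then 1 else 0)"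
    by metis
  have expand: "p = (\<Sum>i<n. smult (poly p (t i)) (L i))" if "degree p < n" for p
  proof (rule poly_eq_on_points[OF t that])
    have "degree (L i) \<le> n - 1" for i using L(1)[of i] by linarith
    then have "degree (\<Sum>i<n. smult (poly p (t i)) (L i)) \<le> n - 1"
      by (intro degree_sum_le order_trans[OF degree_smult_le]) simp_all
    then show "degree (\<Sum>i<n. smult (poly p (t i)) (L i)) < n" using n by simp
    fix j assume "j < n"
    then show "poly p (t j) = poly (\<Sum>i<n. smult (poly p (t i)) (L i)) (t j)"
      by (simp add: poly_sum L(2) if_distrib sum.delta cong: if_cong)
  qed
  \<comment> \<open>The functional with coefficient vector q, expressed through the values of a
    polynomial at the points \<open>t i\<close> instead of its coefficients.\<close>
  define c where "c = (\<lambda>(q::nat \<Rightarrow> rat) i. \<Sum>k<n. of_rat (q k) * coeff (L i) k)"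
  have functional: "(\<Sum>k<n. of_rat (q k) * coeff p k) = (\<Sum>i<n. poly p (t i) * c q i)" if "degree p < n" for p q
  proof -
    have "(\<Sum>k<n. of_rat (q k) * coeff p k) = (\<Sum>k<n. \<Sum>i<n. of_rat (q k) * (poly p (t i) * coeff (L i) k))"
      by (subst expand[OF that]) (simp add: coeff_sum sum_distrib_left)
    also have "\<dots> = (\<Sum>i<n. poly p (t i) * c q i)"
      by (subst sum.swap) (simp add: c_def sum_distrib_left mult_ac)
    finally show ?thesis .
  qed
  have c0: "q k = 0" if "\<And>i. i < n \<Longrightarrow> c q i = 0" "k < n" for q k
  proof -
    have "(\<Sum>j<n. of_rat (q j) * coeff (monom 1 k) j) = (0::real)"
      using functional[of "monom 1 k" q] that by (simp add: degree_monom_eq)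
    then show ?thesis using that(2) by (simp add: coeff_monom if_distrib cong: if_cong)
  qed
  define u where "u = (\<lambda>q q' i. c q i * a1 i + c q' i * c1 i)"
  define v where "v = (\<lambda>q q' i. c q i * a2 i + c q' i * c2 i)"
  \<comment> \<open>z^n times the Laurent polynomial: the exponents n - 1 - i and n + 1 + i do not
    collide, so every \<open>u\<close> and \<open>v\<close> can be read off as a
    coefficient.\<close>
  define F where "F = (\<lambda>q q'. (\<Sum>i<n. monom (u q q' i) (n - 1 - i) + monom (v q q' i) (n + 1 + i)))"
  have F0: "q k = 0 \<and> q' k = 0" if F: "F q q' = 0" and k: "k < n" for q q' k
  proof -
    have cF: "coeff (F q q') j = (\<Sum>i<n. (if n - 1 - i = j then u q q' i else 0) + (if n + 1 + i = j then v q q' i else 0))" for j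
      unfolding F_def coeff_sum coeff_add coeff_monom by simp
    have uv: "u q q' i = 0 \<and> v q q' i = 0" if i: "i < n" for i
    proof
      have "coeff (F q q') (n - 1 - i) = (\<Sum>l<n. if l = i then u q q' i else 0)"
        unfolding cF by (intro sum.cong) (use i in auto)
      then show "u q q' i = 0" using F i by simp
      have "coeff (F q q') (n + 1 + i) = (\<Sum>l<n. if l = i then v q q' i else 0)"
        unfolding cF by (intro sum.cong) (use i in auto)
      then show "v q q' i = 0" using F i by simp
    qed
    have "c q i = 0 \<and> c q' i = 0" if i: "i < n" for i
    proof -
      have "(a1 i * c2 i - a2 i * c1 i) * c q i = u q q' i * c2 i - v q q' i * c1 i"
        "(a1 i * c2 i - a2 i * c1 i) * c q' i = v q q' i * a1 i - u q q' i * a2 i"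
        by (simp_all add: u_def v_def algebra_simps)
      then show ?thesis using uv[OF i] det[OF i] by simp
    qed
    then show ?thesis using c0 k by blast
  qed
  \<comment> \<open>Pairs of lists of rationals index the relations because functions from the
    naturals to the rationals are uncountable.\<close>
  define Bad where "Bad = (\<Union>(xs, ys)\<in>{(xs, ys). F (nth xs) (nth ys) \<noteq> 0}. {z. poly (F (nth xs) (nth ys)) z = 0})"
  have "countable Bad" unfolding Bad_def
    by (intro countable_UN) (auto intro!: countable_finite poly_roots_finite)
  then have "\<not> {0<..<1} \<subseteq> Bad" using uncountable_open_interval[of 0 1] countable_subset by auto
  then obtain z where "z \<in> {0<..<1}" and zB: "z \<notin> Bad" by blast
  then have z: "z > 0" "z \<notin> Bad" by auto
  show ?thesis
  proof (intro exI[of _ z] conjI allI impI)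
    show "z > 0" by (rule z)
    fix p1 p3 :: "real poly" and q q' :: "nat \<Rightarrow> rat" and k
    assume d: "degree p1 < n" "degree p3 < n" and k: "k < n"
      and p: "\<forall>i<n. poly p1 (t i) = a1 i / z ^ (i + 1) + a2 i * z ^ (i + 1) \<and>
           poly p3 (t i) = c1 i / z ^ (i + 1) + c2 i * z ^ (i + 1)"
      and rel: "(\<Sum>k<n. of_rat (q k) * coeff p1 k + of_rat (q' k) * coeff p3 k) = 0"
    define r where "r = nth (map q [0..<n])"
    define r' where "r' = nth (map q' [0..<n])"
    have "0 = (\<Sum>k<n. of_rat (r k) * coeff p1 k) + (\<Sum>k<n. of_rat (r' k) * coeff p3 k)"
      using rel by (simp add: r_def r'_def sum.distrib)
    also have "\<dots> = (\<Sum>i<n. poly p1 (t i) * c r i + poly p3 (t i) * c r' i)"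
      using functional d by (simp add: sum.distrib)
    also have "\<dots> = (\<Sum>i<n. u r r' i / z ^ (i + 1) + v r r' i * z ^ (i + 1))"
      using p by (intro sum.cong) (auto simp: u_def v_def add_divide_distrib ring_distribs mult_ac)
    finally have "0 = z ^ n * (\<Sum>i<n. u r r' i / z ^ (i + 1) + v r r' i * z ^ (i + 1))" by simp
    also have "\<dots> = poly (F r r') z"
      unfolding F_def poly_sum sum_distrib_left
    proof (intro sum.cong refl)
      fix i assume "i \<in> {..<n}"
      then have "n = (n - 1 - i) + (i + 1)" by simp
      then have e: "z ^ n = z ^ (n - 1 - i) * z ^ (i + 1)" by (metis power_add)
      have "z ^ n * (u r r' i / z ^ (i + 1)) = u r r' i * z ^ (n - 1 - i)"
        unfolding e using z(1) by simp
      moreover have "z ^ n * (v r r' i * z ^ (i + 1)) = v r r' i * z ^ (n + 1 + i)"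
        by (simp add: power_add)
      ultimately show "z ^ n * (u r r' i / z ^ (i + 1) + v r r' i * z ^ (i + 1)) =
        poly (monom (u r r' i) (n - 1 - i) + monom (v r r' i) (n + 1 + i)) z"
        by (simp only: distrib_left poly_add poly_monom)
    qed
    finally have "poly (F r r') z = 0" by simp
    then have "F r r' = 0" using z(2) unfolding Bad_def r_def r'_def by blast
    from F0[OF this k] show "q k = 0" "q' k = 0" using k by (auto simp: r_def r'_def)
  qed
qed

section \<open>The quaternionic torus\<close>

lemma sum_lessThan_add:
  fixes f :: "nat \<Rightarrow> 'a::comm_monoid_add"
  shows "(\<Sum>k<a+b. f k) = (\<Sum>k<a. f k) + (\<Sum>k<b. f (a + k))"
  by (induction b) (simp_all add: add.assoc)

text \<open>Rows $2i$ and $2i+1$ of the period matrix belong to the two embeddings of $L = F(w)$ above the embedding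
  $t \mapsto t_i$ of $F$; \<open>pr\<close> exchanges them. The nonzero real $y_i$ parametrizes the complex structure at the place $i$, whose
  period is $\<i>y_i$.\<close>

locale quaternion_torus = eisenstein3 T n for T n +
  fixes t y :: "nat \<Rightarrow> real"
  assumes t_inj: "inj_on t {..<n}"
    and t_root: "\<And>i. i < n \<Longrightarrow> poly (map_poly of_int T) (t i) = 0"
    and t_bound: "\<And>i. i < n \<Longrightarrow> \<bar>t i\<bar> < 5 / 2"
    and y_nz: "\<And>i. i < n \<Longrightarrow> y i \<noteq> 0"
begin

section \<open>The places of F and the embeddings of L above them\<close>

definition disc :: "nat \<Rightarrow> real" where "disc i = (t i)\<^sup>2 - 4"
definition bq :: "nat \<Rightarrow> real" where "bq i = t i + 3"
definition rq :: "nat \<Rightarrow> real" where "rq i = sqrt (bq i)"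
text \<open>The image of w - 1/w under the embedding \<open>l\<close>; \<open>om\<close> is the
  image of w.\<close>

definition dl :: "nat \<Rightarrow> complex" where
  "dl l = (if even l then 1 else -1) * csqrt (of_real (disc (l div 2)))"
definition om :: "nat \<Rightarrow> complex" where "om l = (of_real (t (l div 2)) + dl l) / 2"
definition pr :: "nat \<Rightarrow> nat" where "pr l = (if even l then l + 1 else l - 1)"
text \<open>Let u act on the coordinates \<open>l\<close> and \<open>pr l\<close> as
  \<open>rq\<close> times the swap. Then a + c u acts by the matrix with rows (a, rq c) and (rq c',
  a'), the prime denoting the conjugate embedding. The embedding of the algebra will apply this
  matrix to the vector (\<open>al l\<close>, \<open>al (pr l)\<close>): left multiplications become
  complex linear, and the vector encodes the complex structure.\<close>

definition al :: "nat \<Rightarrow> complex" where "al l = 1 + \<i> * dl l * of_real (y (l div 2))"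

lemma partner_simps [simp]: "pr l div 2 = l div 2" "pr (pr l) = l" "pr l < 2 * n \<longleftrightarrow> l < 2 * n"
  by (auto simp: pr_def elim!: oddE evenE)

lemma place_less [simp]: "l < 2 * n \<Longrightarrow> l div 2 < n" by auto

lemma dl_pr [simp]: "dl (pr l) = - dl l"
  using partner_simps(1)[of l] by (auto simp: dl_def pr_def)

lemma dl_sq: "dl l * dl l = of_real (disc (l div 2))"
proof -
  have "dl l * dl l = (csqrt (of_real (disc (l div 2))))\<^sup>2" by (simp add: dl_def power2_eq_square)
  then show ?thesis by simp
qed

lemma om_sum: "om l + om (pr l) = of_real (t (l div 2))" by (simp add: om_def field_simps)
lemma om_diff: "om l - om (pr l) = dl l" by (simp add: om_def field_simps)
lemma om_prod: "om l * om (pr l) = 1"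
proof -
  have "om l * om (pr l) = (of_real (t (l div 2)) * of_real (t (l div 2)) - dl l * dl l) / 4"
    by (simp add: om_def field_simps)
  also have "\<dots> = 1" unfolding dl_sq by (simp add: disc_def power2_eq_square)
  finally show ?thesis .
qed

lemma om_nz [simp]: "om l \<noteq> 0" using om_prod[of l] by auto

lemma al_pr: "al (pr l) = 1 - \<i> * dl l * of_real (y (l div 2))" by (simp add: al_def)
lemma al_add: "al l + al (pr l) = 2" by (simp add: al_def)

text \<open>Otherwise \<open>t i\<close> would be 2 or -2, the root of a linear integer polynomial,
  contrary to the minimality of T.\<close>

lemma disc_nz: assumes "i < n" shows "disc i \<noteq> 0"
proof
  assume "disc i = 0"
  then have "t i = 2 \<or> t i = -2" using power2_eq_iff[of "t i" 2] by (auto simp: disc_def)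
  then have "\<exists>c::int. poly (map_poly of_int [:- c, 1:]) (t i) = 0"
    by (elim disjE) (rule exI[of _ 2], simp, rule exI[of _ "-2"], simp)
  then obtain c :: int where c: "poly (map_poly of_int [:- c, 1:]) (t i) = 0" by blast
  show False using root_small_degree[OF t_root[OF assms] _ c] n2 by simp
qed

lemma dl_nz: "l < 2 * n \<Longrightarrow> dl l \<noteq> 0"
  using dl_sq[of l] disc_nz[OF place_less] by auto

lemma bq_pos: "i < n \<Longrightarrow> bq i > 0" using t_bound[of i] by (auto simp: bq_def)
lemma rq_pos: "i < n \<Longrightarrow> rq i > 0" using bq_pos by (simp add: rq_def)
lemma rq_sq: "i < n \<Longrightarrow> rq i * rq i = bq i" using bq_pos[of i] by (simp add: rq_def)

lemma dl_neg: "disc (l div 2) < 0 \<Longrightarrow> cnj (dl l) = - dl l"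
  by (simp add: dl_def csqrt_of_real_nonpos)
lemma dl_pos: "disc (l div 2) > 0 \<Longrightarrow> cnj (dl l) = dl l"
  by (simp add: dl_def csqrt_of_real_nonneg)

lemma om_inj: "inj_on om {..<2 * n}"
proof (rule inj_onI)
  fix l m assume lm: "l \<in> {..<2 * n}" "m \<in> {..<2 * n}" and e: "om l = om m"
  have "om (pr l) = om (pr m)" using om_prod[of l] om_prod[of m] e by (metis mult_left_cancel om_nz)
  then have "complex_of_real (t (l div 2)) = of_real (t (m div 2))" using om_sum e by metis
  then have d: "l div 2 = m div 2" using lm t_inj by (auto simp: inj_on_def)
  show "l = m"
  proof (rule ccontr)
    assume "l \<noteq> m"
    then have "m = pr l" using d unfolding pr_def by presburger
    then have "dl l = 0" using om_diff[of l] e by simp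
    then show False using dl_nz lm by auto
  qed
qed

section \<open>Integral and real elements of L as functions on the embeddings\<close>

definition ev :: "int poly \<Rightarrow> nat \<Rightarrow> complex" where
  "ev p l = poly (map_poly of_int p) (om l)"

lemma ev_hom: "ev (p + q) l = ev p l + ev q l" "ev (p * q) l = ev p l * ev q l"
  "ev (p - q) l = ev p l - ev q l" "ev (- p) l = - ev p l" "ev 0 l = 0" "ev 1 l = 1" "ev (p ^ k) l = ev p l ^ k"
  "ev [:0,1:] l = om l" "ev [:c:] l = of_int c" "ev (smult c p) l = of_int c * ev p l"
proof -
  interpret map_poly_comm_ring_hom "of_int :: int \<Rightarrow> complex" ..
  show "ev (p + q) l = ev p l + ev q l" "ev (p * q) l = ev p l * ev q l"
  "ev (p - q) l = ev p l - ev q l" "ev (- p) l = - ev p l" "ev 0 l = 0" "ev 1 l = 1" "ev (p ^ k) l = ev p l ^ k"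
  "ev [:0,1:] l = om l" "ev [:c:] l = of_int c" "ev (smult c p) l = of_int c * ev p l"
    by (simp_all add: ev_def hom_distribs)
qed

text \<open>The reciprocal polynomial $x^n T(x + 1/x)$.\<close>

definition S :: "int poly" where
  "S = (\<Sum>k\<le>n. smult (coeff T k) (monom 1 (n - k) * [:1, 0, 1:] ^ k))"

lemma ev_sum: "ev (\<Sum>i\<in>A. f i) l = (\<Sum>i\<in>A. ev (f i) l)"
  by (induction A rule: infinite_finite_induct) (auto simp: ev_hom)

lemma ev_monom: "ev (monom 1 k) l = om l ^ k"
  by (simp add: ev_def map_poly_monom poly_monom)

lemma ev_S: assumes "l < 2 * n" shows "ev S l = 0"
proof -
  let ?t = "complex_of_real (t (l div 2))"
  have "ev [:1, 0, 1:] l = om l * om l + 1" by (simp add: ev_def algebra_simps)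
  also have "\<dots> = om l * ?t" unfolding om_sum[symmetric] ring_distribs om_prod ..
  finally have e: "ev [:1, 0, 1:] l = om l * ?t" .
  have "ev S l = (\<Sum>k\<le>n. of_int (coeff T k) * (om l ^ (n - k) * (om l * ?t) ^ k))"
    unfolding S_def ev_sum by (simp add: ev_hom ev_monom e)
  also have "\<dots> = (\<Sum>k\<le>n. om l ^ n * (of_int (coeff T k) * ?t ^ k))"
  proof (intro sum.cong refl)
    fix k assume "k \<in> {..n}"
    then have "om l ^ n = om l ^ (n - k) * om l ^ k" by (simp flip: power_add)
    then show "of_int (coeff T k) * (om l ^ (n - k) * (om l * ?t) ^ k) = om l ^ n * (of_int (coeff T k) * ?t ^ k)"
      by (simp add: power_mult_distrib mult_ac)
  qed
  also have "\<dots> = om l ^ n * of_real (poly (map_poly of_int T) (t (l div 2)))"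
    by (simp add: poly_altdef degT sum_distrib_left)
  also have "\<dots> = 0" using t_root[OF place_less[OF assms]] by simp
  finally show ?thesis .
qed

lemma degree_S: "degree S = 2 * n" "lead_coeff S = 1"
proof -
  have dq: "degree ([:1, 0, 1:] ^ k :: int poly) = 2 * k" for k
    by (subst degree_power_eq) auto
  have dle: "degree (smult (coeff T k) (monom 1 (n - k) * [:1, 0, 1:] ^ k)) \<le> n + k" if "k \<le> n" for k
  proof -
    have "degree (monom 1 (n - k) * [:1, 0, 1:] ^ k :: int poly) \<le> (n - k) + 2 * k"
      by (rule order_trans[OF degree_mult_le]) (simp add: degree_monom_eq dq)
    then show ?thesis using that by (auto intro: order_trans[OF degree_smult_le])
  qed
  have "coeff S (2 * n) = (\<Sum>k\<le>n. if k = n then 1 else 0)"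
    unfolding S_def coeff_sum
  proof (intro sum.cong refl)
    fix k assume k: "k \<in> {..n}"
    show "coeff (smult (coeff T k) (monom 1 (n - k) * [:1, 0, 1:] ^ k)) (2 * n) = (if k = n then 1 else 0)"
    proof (cases "k = n")
      case True
      have "coeff ([:1, 0, 1:] ^ n :: int poly) (2 * n) = 1"
        using lead_coeff_power[of "[:1,0,1:]::int poly" n] dq[of n] by simp
      then show ?thesis using True monT by (simp add: monom_0)
    next
      case False
      then show ?thesis using dle[of k] k by (simp add: coeff_eq_0 del: coeff_smult)
    qed
  qed
  then have c: "coeff S (2 * n) = 1" by simp
  have "degree S \<le> 2 * n" unfolding S_def
    by (intro degree_sum_le order_trans[OF dle]) auto
  then show d: "degree S = 2 * n" using c by (intro antisym le_degree) auto
  show "lead_coeff S = 1" unfolding d by (rule c)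
qed

lemma S_0: "coeff S 0 = 1"
proof -
  have "coeff S 0 = (\<Sum>k\<le>n. if k = n then 1 else 0)"
    unfolding S_def coeff_sum
  proof (intro sum.cong refl)
    fix k assume k: "k \<in> {..n}"
    have "coeff ([:1, 0, 1:] ^ k :: int poly) 0 = 1" by (simp add: coeff_0_power)
    then show "coeff (smult (coeff T k) (monom 1 (n - k) * [:1, 0, 1:] ^ k)) 0 = (if k = n then 1 else 0)"
      using monT k by (auto simp: coeff_mult_0 coeff_monom)
  qed
  then show ?thesis by simp
qed

text \<open>Since S = 1 + x s, the inverse of x at a root of S is - s. Thus 1/w belongs to
  Z[w].\<close>

definition qinv :: "int poly" where "qinv = - poly_shift 1 S"

lemma ev_qinv: assumes "l < 2 * n" shows "ev qinv l = om (pr l)"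
proof -
  have "S = [:1:] + [:0,1:] * poly_shift 1 S" using poly_constant_coeff_split[of S] S_0 by simp
  then have "0 = ev ([:1:] + [:0,1:] * poly_shift 1 S) l" using ev_S[OF assms] by simp
  also have "\<dots> = 1 - om l * ev qinv l" by (simp only: ev_hom qinv_def) simp
  finally have "om l * ev qinv l = om l * om (pr l)" using om_prod[of l] by simp
  then show ?thesis by simp
qed

text \<open>The ring Z[w], an element being given by its tuple of conjugates. Only indices below 2n
  are embeddings; values elsewhere are arbitrary.\<close>

definition LZ :: "(nat \<Rightarrow> complex) set" where
  "LZ = {f. \<exists>p. \<forall>l<2 * n. f l = ev p l}"

lemma LZ_I: "f \<in> LZ" if "\<And>l. l < 2 * n \<Longrightarrow> f l = ev p l" using that by (auto simp: LZ_def)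

lemma LZ_closed:
  assumes "f \<in> LZ" "g \<in> LZ"
  shows "(\<lambda>l. f l + g l) \<in> LZ" "(\<lambda>l. f l * g l) \<in> LZ" "(\<lambda>l. f l - g l) \<in> LZ"
  using assms unfolding LZ_def mem_Collect_eq by (metis ev_hom(1), metis ev_hom(2), metis ev_hom(3))

lemma LZ_uminus: "f \<in> LZ \<Longrightarrow> (\<lambda>l. - f l) \<in> LZ"
  unfolding LZ_def mem_Collect_eq by (metis ev_hom(4))

lemma LZ_power: "f \<in> LZ \<Longrightarrow> (\<lambda>l. f l ^ k) \<in> LZ"
  unfolding LZ_def mem_Collect_eq by (metis ev_hom(7))

lemma LZ_basic: "om \<in> LZ" "(\<lambda>l. om (pr l)) \<in> LZ" "(\<lambda>l. of_int c) \<in> LZ"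
  by (rule LZ_I[of _ "[:0,1:]"], simp add: ev_hom, rule LZ_I[of _ qinv], simp add: ev_qinv,
      rule LZ_I[of _ "[:c:]"], simp add: ev_hom)

lemma LZ_t: "(\<lambda>l. of_real (t (l div 2))) \<in> LZ" and LZ_dl: "dl \<in> LZ"
  using LZ_closed(1,3)[OF LZ_basic(1,2)] by (auto simp: om_sum om_diff)

lemma LZ_bq: "(\<lambda>l. of_real (bq (l div 2))) \<in> LZ"
  using LZ_closed(1)[OF LZ_t LZ_basic(3)[of 3]] by (simp add: bq_def)

lemma LZ_bar: assumes "f \<in> LZ" shows "(\<lambda>l. f (pr l)) \<in> LZ"
proof -
  obtain p where p: "\<And>l. l < 2 * n \<Longrightarrow> f l = ev p l" using assms by (auto simp: LZ_def)
  have "(\<lambda>l. ev p (pr l)) \<in> LZ"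
  proof (induction p)
    case 0
    then show ?case using LZ_basic(3)[of 0] by (simp add: ev_hom)
  next
    case (pCons a p)
    have "ev (pCons a p) (pr l) = of_int a + om (pr l) * ev p (pr l)" for l by (simp add: ev_def of_int_hom.map_poly_pCons_hom)
    then show ?case using LZ_closed(1)[OF LZ_basic(3)[of a] LZ_closed(2)[OF LZ_basic(2) pCons(2)]] by simp
  qed
  then obtain p' where "\<forall>l<2*n. ev p (pr l) = ev p' l" by (auto simp: LZ_def)
  then show ?thesis by (intro LZ_I[of _ p']) (simp add: p)
qed

lemma LZ_sum_int: assumes "f \<in> LZ" shows "(\<Sum>l<2*n. f l) \<in> \<int>"
proof -
  obtain p where p: "\<And>l. l < 2 * n \<Longrightarrow> f l = ev p l" using assms by (auto simp: LZ_def)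
  have "(\<Sum>l<2*n. f l) = (\<Sum>l<2*n. poly (map_poly of_int p) (om l))"
    by (intro sum.cong) (auto simp: p ev_def)
  also have "\<dots> \<in> \<int>"
    using degree_S n2 om_inj ev_S by (intro sum_over_roots_int[of S]) (auto simp: ev_def)
  finally show ?thesis .
qed

text \<open>Functions on the embeddings that come from the real algebra $L \otimes \mathbb{R}$.\<close>

definition LR :: "(nat \<Rightarrow> complex) set" where
  "LR = {f. \<exists>f0 f1 :: nat \<Rightarrow> real. \<forall>l<2 * n. f l = of_real (f0 (l div 2)) + of_real (f1 (l div 2)) * dl l}"

lemma LR_I: "f \<in> LR" if "\<And>l. l < 2 * n \<Longrightarrow> f l = of_real (f0 (l div 2)) + of_real (f1 (l div 2)) * dl l"
  using that by (auto simp: LR_def)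

lemma LR_real: "(\<lambda>l. of_real (f (l div 2))) \<in> LR" by (rule LR_I[of _ f "\<lambda>_. 0"]) simp

lemma LR_add: assumes "f \<in> LR" "g \<in> LR" shows "(\<lambda>l. f l + g l) \<in> LR"
proof -
  obtain f0 f1 g0 g1 where
    "\<And>l. l < 2*n \<Longrightarrow> f l = of_real (f0 (l div 2)) + of_real (f1 (l div 2)) * dl l"
    "\<And>l. l < 2*n \<Longrightarrow> g l = of_real (g0 (l div 2)) + of_real (g1 (l div 2)) * dl l"
    using assms by (auto simp: LR_def)
  then show ?thesis
    by (intro LR_I[of _ "\<lambda>i. f0 i + g0 i" "\<lambda>i. f1 i + g1 i"]) (simp add: algebra_simps)
qed

lemma LR_mult: assumes "f \<in> LR" "g \<in> LR" shows "(\<lambda>l. f l * g l) \<in> LR"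
proof -
  obtain f0 f1 g0 g1 where fg:
    "\<And>l. l < 2*n \<Longrightarrow> f l = of_real (f0 (l div 2)) + of_real (f1 (l div 2)) * dl l"
    "\<And>l. l < 2*n \<Longrightarrow> g l = of_real (g0 (l div 2)) + of_real (g1 (l div 2)) * dl l"
    using assms by (auto simp: LR_def)
  have e: "(a + b * d) * (a' + b' * d) = (a * a' + b * b' * (d * d)) + (a * b' + b * a') * (d::complex)" for a b a' b' d
    by (simp add: algebra_simps)
  show ?thesis
    by (rule LR_I[of _ "\<lambda>i. f0 i * g0 i + f1 i * g1 i * disc i" "\<lambda>i. f0 i * g1 i + f1 i * g0 i"])
      (simp add: fg e dl_sq)
qed

lemma LR_bar: assumes "f \<in> LR" shows "(\<lambda>l. f (pr l)) \<in> LR"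
proof -
  obtain f0 f1 where fg:
    "\<And>l. l < 2*n \<Longrightarrow> f l = of_real (f0 (l div 2)) + of_real (f1 (l div 2)) * dl l"
    using assms by (auto simp: LR_def)
  show ?thesis by (rule LR_I[of _ f0 "\<lambda>i. - f1 i"]) (simp add: fg)
qed

lemma LR_dl: "dl \<in> LR" by (rule LR_I[of _ "\<lambda>_. 0" "\<lambda>_. 1"]) simp
lemma LR_om: "om \<in> LR" by (rule LR_I[of _ "\<lambda>i. t i / 2" "\<lambda>_. 1 / 2"]) (simp add: om_def field_simps)

lemma LR_poly: "(\<lambda>l. poly (map_poly of_real p) (om l)) \<in> LR"
proof (induction p)
  case 0
  then show ?case using LR_real[of "\<lambda>_. 0"] by simp
next
  case (pCons a p)
  then show ?case using LR_add[OF LR_real[of "\<lambda>_. a"] LR_mult[OF LR_om pCons(2)]] by simp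
qed

lemma LR_ev: "ev p \<in> LR"
proof -
  have "map_poly of_real (map_poly of_int p) = (map_poly of_int p :: complex poly)"
    by (intro poly_eqI) (simp add: coeff_map_poly)
  then show ?thesis using LR_poly[of "map_poly of_int p"] unfolding ev_def by simp
qed

lemma LR_diff: assumes "f \<in> LR" "g \<in> LR" shows "(\<lambda>l. f l - g l) \<in> LR"
  using LR_add[OF assms(1) LR_mult[OF LR_real[of "\<lambda>_. -1"] assms(2)]] by simp

text \<open>The coefficients over the places are real, and \<open>dl\<close> is purely imaginary
  where \<open>disc\<close> is negative (w on the unit circle) and real where it is positive (w
  real).\<close>

lemma LR_cnj: assumes "f \<in> LR" "l < 2 * n"
  shows "cnj (f l) = (if disc (l div 2) < 0 then f (pr l) else f l)"
proof -
  obtain f0 f1 where fg: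
    "\<And>l. l < 2*n \<Longrightarrow> f l = of_real (f0 (l div 2)) + of_real (f1 (l div 2)) * dl l"
    using assms by (auto simp: LR_def)
  show ?thesis using dl_neg[of l] dl_pos[of l] disc_nz[of "l div 2"] assms(2) by (auto simp: fg not_less_iff_gr_or_eq)
qed

text \<open>The embedding of the real quaternion algebra $L_{\mathbb{R}} \oplus L_{\mathbb{R}}u$ with $u^2 = x + 3$ into
  $\mathbb{C}^{2n}$.\<close>

definition Phi :: "(nat \<Rightarrow> complex) \<Rightarrow> (nat \<Rightarrow> complex) \<Rightarrow> complex vec" where
  "Phi a c = vec (2 * n) (\<lambda>l. al l * a l + of_real (rq (l div 2)) * al (pr l) * c l)"

lemma Phi_carrier [simp]: "Phi a c \<in> carrier_vec (2 * n)" "dim_vec (Phi a c) = 2 * n" by (auto simp: Phi_def)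

lemma Phi_cong: "(\<And>l. l < 2 * n \<Longrightarrow> a l = a' l) \<Longrightarrow> (\<And>l. l < 2 * n \<Longrightarrow> c l = c' l) \<Longrightarrow> Phi a c = Phi a' c'"
  by (auto simp: Phi_def)

lemma al_cnj: "l < 2 * n \<Longrightarrow> cnj (al l) = (if disc (l div 2) < 0 then al l else al (pr l))"
  using dl_neg[of l] dl_pos[of l] disc_nz[of "l div 2"] by (auto simp: al_def not_less_iff_gr_or_eq)

lemma al_cnj_pr: "l < 2 * n \<Longrightarrow> cnj (al (pr l)) = (if disc (l div 2) < 0 then al (pr l) else al l)"
  using al_cnj[of "pr l"] by simp

text \<open>The coordinate at \<open>l\<close> is one equation in \<open>a l\<close> and
  \<open>c l\<close>. Complex conjugation supplies a second, from the coordinate at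
  \<open>pr l\<close> or from the same one according to the sign of \<open>disc\<close>. The
  determinant of the system is a nonzero multiple of \<open>dl l\<close> times y.\<close>

lemma Phi_inj:
  assumes a: "a \<in> LR" and c: "c \<in> LR" and z: "Phi a c = 0\<^sub>v (2 * n)" and l: "l < 2 * n"
  shows "a l = 0 \<and> c l = 0"
proof -
  have z': "al l * a l + of_real (rq (l div 2)) * al (pr l) * c l = 0" if "l < 2 * n" for l
    using z that by (auto simp: Phi_def vec_eq_iff)
  let ?r = "of_real (rq (l div 2)) :: complex"
  have e1: "al l * a l + ?r * al (pr l) * c l = 0" using z'[OF l] .
  have e2: "al (pr l) * a l + ?r * al l * c l = 0"
  proof (cases "disc (l div 2) < 0")
    case True
    have "cnj (al (pr l) * a (pr l) + ?r * al l * c (pr l)) = 0" using z'[of "pr l"] l by simp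
    then show ?thesis using True LR_cnj[OF a, of "pr l"] LR_cnj[OF c, of "pr l"] al_cnj[OF l] al_cnj_pr[OF l] l by simp
  next
    case False
    have "cnj (al l * a l + ?r * al (pr l) * c l) = 0" using e1 by simp
    then show ?thesis using False LR_cnj[OF a l] LR_cnj[OF c l] al_cnj[OF l] al_cnj_pr[OF l] by simp
  qed
  have k: "al l * al l - al (pr l) * al (pr l) = 4 * \<i> * dl l * of_real (y (l div 2))"
    by (simp add: al_def algebra_simps)
  then have nz: "al l * al l - al (pr l) * al (pr l) \<noteq> 0" using dl_nz[OF l] y_nz[OF place_less[OF l]] by simp
  have "(al l * al l - al (pr l) * al (pr l)) * a l =
     al l * (al l * a l + ?r * al (pr l) * c l) - al (pr l) * (al (pr l) * a l + ?r * al l * c l)"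
    by (simp add: algebra_simps)
  then have "a l = 0" using e1 e2 nz by simp
  moreover have "?r * (al l * al l - al (pr l) * al (pr l)) * c l =
     al l * (al (pr l) * a l + ?r * al l * c l) - al (pr l) * (al l * a l + ?r * al (pr l) * c l)"
    by (simp add: algebra_simps)
  then have "c l = 0" using e1 e2 nz rq_pos[OF place_less[OF l]] by simp
  ultimately show ?thesis by simp
qed

text \<open>The columns are the images of w^k and w^k u for k < 2n, so the lattice is the order Z[w]
  + Z[w] u.\<close>

definition P :: "complex mat" where
  "P = mat (2 * n) (2 * (2 * n)) (\<lambda>(l, k). if k < 2 * n then al l * om l ^ k
      else of_real (rq (l div 2)) * al (pr l) * om l ^ (k - 2 * n))"

lemma P_carrier [simp]: "P \<in> carrier_mat (2 * n) (2 * (2 * n))" by (simp add: P_def)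

lemma P_mult:
  assumes z: "z \<in> carrier_vec (2 * (2 * n))"
  shows "P *\<^sub>v z = Phi (\<lambda>l. \<Sum>k<2*n. z $ k * om l ^ k) (\<lambda>l. \<Sum>k<2*n. z $ (2 * n + k) * om l ^ k)"
proof (rule eq_vecI)
  fix l assume "l < dim_vec (Phi (\<lambda>l. \<Sum>k<2*n. z $ k * om l ^ k) (\<lambda>l. \<Sum>k<2*n. z $ (2 * n + k) * om l ^ k))"
  then have l: "l < 2 * n" by simp
  have "(P *\<^sub>v z) $ l = (\<Sum>k<2*n+2*n. P $$ (l, k) * z $ k)"
    using l z by (simp add: P_def scalar_prod_def atLeast0LessThan mult_2)
  also have "\<dots> = (\<Sum>k<2*n. P $$ (l, k) * z $ k) + (\<Sum>k<2*n. P $$ (l, 2*n+k) * z $ (2*n+k))"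
    by (rule sum_lessThan_add)
  also have "\<dots> = Phi (\<lambda>l. \<Sum>k<2*n. z $ k * om l ^ k) (\<lambda>l. \<Sum>k<2*n. z $ (2 * n + k) * om l ^ k) $ l"
    using l by (simp add: Phi_def P_def sum_distrib_left mult_ac)
  finally show "(P *\<^sub>v z) $ l = \<dots>" .
qed (simp add: P_def)

lemma poly_sum_coeff:
  fixes p :: "'a::comm_ring_1 poly"
  assumes "degree p < N"
  shows "poly p x = (\<Sum>k<N. coeff p k * x ^ k)"
proof -
  have "poly p x = (\<Sum>k\<le>degree p. coeff p k * x ^ k)" by (rule poly_altdef)
  also have "\<dots> = (\<Sum>k<N. coeff p k * x ^ k)"
    using assms by (intro sum.mono_neutral_left) (auto simp: coeff_eq_0)
  finally show ?thesis .
qed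

lemma lattice_point_exists:
  assumes "a \<in> LZ" "c \<in> LZ"
  shows "\<exists>z :: int vec. z \<in> carrier_vec (2 * (2 * n)) \<and> P *\<^sub>v map_vec of_int z = Phi a c"
proof -
  have red: "\<exists>r. degree r < 2 * n \<and> (\<forall>l<2*n. f l = ev r l)" if f: "f \<in> LZ" for f
  proof -
    obtain p where p: "\<forall>l<2*n. f l = ev p l" using f by (auto simp: LZ_def)
    obtain q r where qr: "p = S * q + r" "degree r < 2 * n"
      using monic_division[of S p] degree_S n2 by auto
    have "\<forall>l<2*n. f l = ev r l" using p ev_S by (simp add: qr(1) ev_hom)
    then show ?thesis using qr(2) by blast
  qed
  obtain r s where r: "degree r < 2 * n" "\<And>l. l<2*n \<Longrightarrow> a l = ev r l" and s: "degree s < 2 * n" "\<And>l. l<2*n \<Longrightarrow> c l = ev s l"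
    using red[OF assms(1)] red[OF assms(2)] by blast
  define z where "z = vec (2 * (2 * n)) (\<lambda>k. if k < 2 * n then coeff r k else coeff s (k - 2 * n))"
  have z: "z \<in> carrier_vec (2 * (2 * n))" by (simp add: z_def)
  have ev_sum: "ev p l = (\<Sum>k<2*n. of_int (coeff p k) * om l ^ k)" if "degree p < 2 * n" for p l
    unfolding ev_def using that by (subst poly_sum_coeff[of _ "2 * n"]) auto
  have "P *\<^sub>v map_vec of_int z = Phi (ev r) (ev s)"
    by (subst P_mult) (use z in \<open>auto simp: z_def ev_sum r s intro!: Phi_cong sum.cong\<close>)
  also have "\<dots> = Phi a c" using r s by (intro Phi_cong) auto
  finally show ?thesis using z by blast
qed

lemma lattice_pts_eq: "lattice_pts (2 * n) P = {Phi a c | a c. a \<in> LZ \<and> c \<in> LZ}"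
proof (intro subset_antisym subsetI)
  fix v assume "v \<in> lattice_pts (2 * n) P"
  then obtain z :: "int vec" where z: "z \<in> carrier_vec (2 * (2 * n))" "v = P *\<^sub>v map_vec of_int z"
    by (auto simp: lattice_pts_def)
  have LZ: "(\<lambda>l. \<Sum>k<2*n. of_int (u k) * om l ^ k) \<in> LZ" for u
    by (rule LZ_I[of _ "\<Sum>k<2*n. smult (u k) (monom 1 k)"]) (simp add: ev_sum ev_hom ev_monom)
  have "v = Phi (\<lambda>l. \<Sum>k<2*n. of_int (z $ k) * om l ^ k) (\<lambda>l. \<Sum>k<2*n. of_int (z $ (2 * n + k)) * om l ^ k)"
    unfolding z(2) by (subst P_mult) (use z(1) in \<open>auto intro!: Phi_cong sum.cong\<close>)
  then show "v \<in> {Phi a c | a c. a \<in> LZ \<and> c \<in> LZ}"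
    using LZ[of "\<lambda>k. z $ k"] LZ[of "\<lambda>k. z $ (2 * n + k)"] by blast
next
  fix v assume "v \<in> {Phi a c | a c. a \<in> LZ \<and> c \<in> LZ}"
  then obtain a c where "v = Phi a c" "a \<in> LZ" "c \<in> LZ" by blast
  then obtain z :: "int vec" where "z \<in> carrier_vec (2 * (2 * n))" "v = P *\<^sub>v map_vec of_int z"
    using lattice_point_exists[of a c] by metis
  then show "v \<in> lattice_pts (2 * n) P" unfolding lattice_pts_def by blast
qed

text \<open>By \<open>Phi_inj\<close> the two halves of r are real polynomials of degree below 2n
  that vanish at the 2n distinct points \<open>om l\<close>.\<close>

lemma P_real_injective:
  fixes r :: "real vec"
  assumes r: "r \<in> carrier_vec (2 * (2 * n))" and z: "P *\<^sub>v map_vec complex_of_real r = 0\<^sub>v (2 * n)"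
  shows "r = 0\<^sub>v (2 * (2 * n))"
proof -
  define p where "p = (\<lambda>u :: nat \<Rightarrow> real. \<Sum>k<2*n. monom (u k) k)"
  have cp: "coeff (p u) k = (if k < 2 * n then u k else 0)" for u k
    by (simp add: p_def coeff_sum coeff_monom)
  have dp: "degree (p u) < 2 * n" for u
  proof -
    have "degree (p u) \<le> 2 * n - 1" by (rule degree_le) (auto simp: cp)
    then show ?thesis using n2 by simp
  qed
  have pp: "poly (map_poly of_real (p u)) x = (\<Sum>k<2*n. complex_of_real (u k) * x ^ k)" for u x
    by (subst poly_sum_coeff[of _ "2 * n"]) (auto simp: dp coeff_map_poly cp)
  let ?a = "\<lambda>k. r $ k" and ?c = "\<lambda>k. r $ (2 * n + k)"
  have "Phi (\<lambda>l. poly (map_poly of_real (p ?a)) (om l)) (\<lambda>l. poly (map_poly of_real (p ?c)) (om l)) = 0\<^sub>v (2 * n)"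
    unfolding pp z[symmetric] using r by (subst P_mult) (auto intro!: Phi_cong sum.cong)
  from Phi_inj[OF LR_poly LR_poly this]
  have 0: "poly (map_poly of_real (p ?a)) (om l) = 0" "poly (map_poly of_real (p ?c)) (om l) = 0" if "l < 2 * n" for l
    using that by auto
  have "map_poly complex_of_real (p u) = 0" if "\<And>l. l < 2 * n \<Longrightarrow> poly (map_poly of_real (p u)) (om l) = 0" for u
    using that dp[of u] n2 by (intro poly_eq_on_points[OF om_inj]) auto
  then have "map_poly complex_of_real (p ?a) = 0" "map_poly complex_of_real (p ?c) = 0" using 0 by blast+
  then have z: "r $ k = 0" "r $ (2 * n + k) = 0" if "k < 2 * n" for k
    using cp[of ?a k] cp[of ?c k] that
    by (metis coeff_0 coeff_map_poly of_real_0 of_real_eq_0_iff)+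
  show ?thesis
  proof (rule eq_vecI)
    fix k assume "k < dim_vec (0\<^sub>v (2 * (2 * n)) :: real vec)"
    then have k: "k < 2 * (2 * n)" by simp
    show "r $ k = 0\<^sub>v (2 * (2 * n)) $ k"
      using z(1)[of k] z(2)[of "k - 2 * n"] k by (cases "k < 2 * n") auto
  qed (use r in auto)
qed

lemma lattice: "is_lattice (2 * n) P"
  using P_real_injective P_carrier unfolding is_lattice_def by blast

end

section \<open>Simplicity\<close>

lemma complex_subspace_sum:
  fixes K :: nat
  assumes W: "complex_subspace g W" and w: "\<And>j. j < K \<Longrightarrow> w j \<in> W"
  shows "vec g (\<lambda>l. \<Sum>j<K. c j * w j $ l) \<in> W"
  using w
proof (induction K)
  case 0
  have "vec g (\<lambda>l. \<Sum>j<0. c j * w j $ l) = 0\<^sub>v g" by auto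
  then show ?case using W by (simp add: complex_subspace_def)
next
  case (Suc K)
  have "w K \<in> carrier_vec g" using W Suc.prems[of K] by (auto simp: complex_subspace_def)
  then have "vec g (\<lambda>l. \<Sum>j<Suc K. c j * w j $ l) = vec g (\<lambda>l. \<Sum>j<K. c j * w j $ l) + c K \<cdot>\<^sub>v w K"
    by auto
  moreover have "vec g (\<lambda>l. \<Sum>j<K. c j * w j $ l) \<in> W" "c K \<cdot>\<^sub>v w K \<in> W"
    using Suc W by (auto simp: complex_subspace_def)
  ultimately show ?case using W by (simp add: complex_subspace_def)
qed

lemma mult_mat_vec_sum:
  assumes "Q \<in> carrier_mat g k" "r \<in> carrier_vec k" "l < g"
  shows "(Q *\<^sub>v r) $ l = (\<Sum>j<k. Q $$ (l, j) * r $ j)"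
  using assms by (simp add: scalar_prod_def atLeast0LessThan)

context quaternion_torus
begin

text \<open>The complex structure is right multiplication by $\delta(p_1(t) + p_3(t)u)$ with $\delta = w - 1/w$.\<close>

definition generic :: "real poly \<Rightarrow> real poly \<Rightarrow> bool" where
  "generic p1 p3 \<longleftrightarrow> degree p1 < n \<and> degree p3 < n \<and>
    (\<forall>i<n. poly p1 (t i) = (1 / (disc i * y i) - y i) / 2 \<and>
           poly p3 (t i) = (- y i - 1 / (disc i * y i)) / (2 * rq i)) \<and>
    (\<forall>q q' :: nat \<Rightarrow> rat. (\<Sum>k<n. of_rat (q k) * coeff p1 k + of_rat (q' k) * coeff p3 k) = 0 \<longrightarrow>
       (\<forall>k<n. q k = 0 \<and> q' k = 0))"

lemma generic_independent:
  fixes q q' :: "nat \<Rightarrow> rat"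
  assumes "generic p1 p3" "(\<Sum>k<n. of_rat (q k) * coeff p1 k + of_rat (q' k) * coeff p3 k) = 0" "k < n"
  shows "q k = 0 \<and> q' k = 0"
  using assms(1) unfolding generic_def
  by (elim conjE) (erule allE[of _ q], erule allE[of _ q'], use assms(2,3) in simp)

text \<open>The image of x delta F for x = a + c u; moving u past delta = w - 1/w produces the minus
  sign.\<close>

definition g1 :: "(nat \<Rightarrow> real) \<Rightarrow> (nat \<Rightarrow> complex) \<Rightarrow> (nat \<Rightarrow> complex) \<Rightarrow> complex vec" where
  "g1 F a c = Phi (\<lambda>l. dl l * of_real (F (l div 2)) * a l) (\<lambda>l. - (dl l * of_real (F (l div 2)) * c l))"

text \<open>The image of x delta F u; the factor \<open>bq\<close> is u^2.\<close>

definition g2 :: "(nat \<Rightarrow> real) \<Rightarrow> (nat \<Rightarrow> complex) \<Rightarrow> (nat \<Rightarrow> complex) \<Rightarrow> complex vec" where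
  "g2 F a c = Phi (\<lambda>l. - (of_real (bq (l div 2)) * (dl l * of_real (F (l div 2)) * c l)))
     (\<lambda>l. dl l * of_real (F (l div 2)) * a l)"

lemma g_carrier [simp]: "g1 F a c \<in> carrier_vec (2 * n)" "g2 F a c \<in> carrier_vec (2 * n)"
  by (simp_all add: g1_def g2_def)

text \<open>The values prescribed in \<open>generic\<close> solve p1 + rq p3 = - y and (p1 - rq p3)
  disc y = 1. These equations say that delta (p1 + p3 u) has the vector (\<open>al l\<close>,
  \<open>al (pr l)\<close>) as an eigenvector with eigenvalue i.\<close>

lemma complex_structure:
  assumes g: "generic p1 p3" and l: "l < 2 * n"
  shows "\<i> * Phi a c $ l = g1 (\<lambda>i. poly p1 (t i)) a c $ l + g2 (\<lambda>i. poly p3 (t i)) a c $ l"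
proof -
  define i where "i = l div 2"
  have i: "i < n" using l i_def by simp
  note nz = disc_nz[OF i] y_nz[OF i] rq_pos[OF i]
  have p: "poly p1 (t i) = (1 / (disc i * y i) - y i) / 2" "poly p3 (t i) = (- y i - 1 / (disc i * y i)) / (2 * rq i)"
    using g i by (auto simp: generic_def)
  let ?p1 = "complex_of_real (poly p1 (t i))" and ?p3 = "complex_of_real (poly p3 (t i))" and ?r = "complex_of_real (rq i)"
  have rp: "rq i * poly p3 (t i) = (- y i - 1 / (disc i * y i)) / 2" unfolding p using nz by simp
  have half: "(x - z) / 2 + (- z - x) / 2 = - z" "(x - z) / 2 - (- z - x) / 2 = x" for x z :: real
    by (simp_all add: field_simps)
  have s1: "?p1 + ?r * ?p3 = - of_real (y i)" 
    unfolding of_real_mult[symmetric] of_real_add[symmetric] rp p(1) half of_real_minus ..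
  have s2: "(?p1 - ?r * ?p3) * of_real (disc i * y i) = 1"
    unfolding of_real_mult[symmetric] of_real_diff[symmetric] rp p(1) half of_real_eq_1_iff using nz by simp
  have key: "dl l * (al l * ?p1 + ?r * al (pr l) * ?p3) = \<i> * al l" if "l div 2 = i" for l
  proof -
    have "dl l * (al l * ?p1 + ?r * al (pr l) * ?p3) =
      dl l * (?p1 + ?r * ?p3) + \<i> * (dl l * dl l) * of_real (y i) * (?p1 - ?r * ?p3)"
      unfolding al_pr al_def that by (simp add: algebra_simps that)
    also have "\<dots> = - (dl l * of_real (y i)) + \<i> * ((?p1 - ?r * ?p3) * of_real (disc i * y i))"
      unfolding s1 dl_sq that by (simp add: mult_ac)
    also have "\<dots> = \<i> * al l" unfolding s2 al_def that by (simp add: algebra_simps)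
    finally show ?thesis .
  qed
  have k1: "dl l * (al l * ?p1 + ?r * al (pr l) * ?p3) = \<i> * al l" using key i_def by simp
  have "dl (pr l) * (al (pr l) * ?p1 + ?r * al (pr (pr l)) * ?p3) = \<i> * al (pr l)" using key[of "pr l"] i_def by simp
  then have k2: "- dl l * (al (pr l) * ?p1 + ?r * al l * ?p3) = \<i> * al (pr l)" by simp
  have b: "complex_of_real (bq i) = ?r * ?r" using rq_sq[OF i] by (metis of_real_mult)
  have "g1 (\<lambda>i. poly p1 (t i)) a c $ l + g2 (\<lambda>i. poly p3 (t i)) a c $ l =
    (dl l * (al l * ?p1 + ?r * al (pr l) * ?p3)) * a l + ?r * (- dl l * (al (pr l) * ?p1 + ?r * al l * ?p3)) * c l"
    using l unfolding g1_def g2_def Phi_def by (simp add: i_def[symmetric] b algebra_simps)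
  also have "\<dots> = \<i> * Phi a c $ l"
    unfolding k1 k2 using l by (simp add: Phi_def i_def[symmetric] algebra_simps)
  finally show ?thesis by simp
qed

lemma g_sum:
  assumes "l < 2 * n"
  shows "g1 (\<lambda>i. \<Sum>k<n. q k * t i ^ k) a c $ l = (\<Sum>k<n. of_real (q k) * g1 (\<lambda>i. t i ^ k) a c $ l)"
    "g2 (\<lambda>i. \<Sum>k<n. q k * t i ^ k) a c $ l = (\<Sum>k<n. of_real (q k) * g2 (\<lambda>i. t i ^ k) a c $ l)"
  using assms by (simp_all add: g1_def g2_def Phi_def sum_distrib_left sum_distrib_right algebra_simps
      flip: sum.distrib sum_negf sum_subtractf)

lemma g_lattice:
  assumes "a \<in> LZ" "c \<in> LZ"
  shows "\<exists>z :: int vec. z \<in> carrier_vec (2 * (2 * n)) \<and> P *\<^sub>v map_vec of_int z = g1 (\<lambda>i. t i ^ k) a c"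
    "\<exists>z :: int vec. z \<in> carrier_vec (2 * (2 * n)) \<and> P *\<^sub>v map_vec of_int z = g2 (\<lambda>i. t i ^ k) a c"
  unfolding g1_def g2_def of_real_power
  by (intro lattice_point_exists LZ_closed(2) LZ_uminus LZ_power LZ_t LZ_dl LZ_bq assms)+

text \<open>Expand $\<i>v \in W$ both in the coordinates of the complex structure and in lattice points of $W$. Applying
  coordinatewise an additive map $\mathbb{R} \to \mathbb{R}$ that is 1 on one coordinate of the complex structure and 0 on the others leaves a
  single term, which therefore lies in $W$.\<close>

lemma generic_closed:
  assumes gen: "generic p1 p3" and W: "complex_subspace (2 * n) W"
    and span: "real_span (2 * n) (W \<inter> lattice_pts (2 * n) P) = W"
    and a: "a \<in> LZ" and c: "c \<in> LZ" and v: "Phi a c \<in> W" and k: "k < n"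
  shows "g1 (\<lambda>i. t i ^ k) a c \<in> W \<and> g2 (\<lambda>i. t i ^ k) a c \<in> W"
proof -
  define N where "N = 2 * (2 * n)"
  define th where "th = (\<lambda>k. if k < n then coeff p1 k else coeff p3 (k - n))"
  define G where "G = (\<lambda>k. if k < n then g1 (\<lambda>i. t i ^ k) a c else g2 (\<lambda>i. t i ^ (k - n)) a c)"
  have "\<exists>z :: int vec. z \<in> carrier_vec N \<and> P *\<^sub>v map_vec of_int z = G k" for k
    using g_lattice[OF a c, folded N_def] by (simp add: G_def)
  then obtain E :: "nat \<Rightarrow> int vec" where E: "\<And>k. E k \<in> carrier_vec N" "\<And>k. P *\<^sub>v map_vec of_int (E k) = G k" by metis
  have split: "(\<Sum>k<n + n. f k) = (\<Sum>k<n. f k) + (\<Sum>k<n. f (n + k))" for f :: "nat \<Rightarrow> 'b::comm_monoid_add"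
    by (rule sum_lessThan_add)
  have li: "\<forall>k<n + n. q k = 0" if "(\<Sum>k<n + n. of_rat (q k) * th k) = 0" for q :: "nat \<Rightarrow> rat"
  proof -
    have "(\<Sum>k<n. of_rat (q k) * coeff p1 k + of_rat (q (n + k)) * coeff p3 k) = 0"
      using that unfolding split by (simp add: th_def sum.distrib)
    note 0 = generic_independent[OF gen this]
    show ?thesis
    proof (intro allI impI)
      fix k assume "k < n + n"
      then show "q k = 0" using 0[of k] 0[of "k - n"] by (cases "k < n") auto
    qed
  qed
  have p: "poly p x = (\<Sum>k<n. coeff p k * x ^ k)" if "degree p < n" for p and x :: real
    using that by (rule poly_sum_coeff)
  have iG: "\<i> * Phi a c $ l = (\<Sum>k<n + n. of_real (th k) * G k $ l)" if l: "l < 2 * n" for l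
  proof -
    have "\<i> * Phi a c $ l = g1 (\<lambda>i. \<Sum>k<n. coeff p1 k * t i ^ k) a c $ l + g2 (\<lambda>i. \<Sum>k<n. coeff p3 k * t i ^ k) a c $ l"
      using complex_structure[OF gen l] p gen unfolding generic_def by simp
    then show ?thesis unfolding g_sum[OF l] split by (simp add: th_def G_def)
  qed
  have "\<i> \<cdot>\<^sub>v Phi a c \<in> W" using W v by (auto simp: complex_subspace_def)
  then have "\<i> \<cdot>\<^sub>v Phi a c \<in> real_span (2 * n) (W \<inter> lattice_pts (2 * n) P)" unfolding span .
  then obtain Q r K where Q: "Q \<in> carrier_mat (2 * n) K" "\<And>j. j < K \<Longrightarrow> col Q j \<in> W \<inter> lattice_pts (2 * n) P"
    and r: "r \<in> carrier_vec K" and e: "\<i> \<cdot>\<^sub>v Phi a c = Q *\<^sub>v map_vec complex_of_real r"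
    unfolding real_span_def by blast
  have "\<forall>j. \<exists>z :: int vec. j < K \<longrightarrow> z \<in> carrier_vec N \<and> P *\<^sub>v map_vec of_int z = col Q j"
    using Q(2) unfolding lattice_pts_def N_def by fastforce
  then obtain Z :: "nat \<Rightarrow> int vec" where Z: "\<And>j. j < K \<Longrightarrow> Z j \<in> carrier_vec N"
    "\<And>j. j < K \<Longrightarrow> P *\<^sub>v map_vec of_int (Z j) = col Q j" by metis
  have PE: "(\<Sum>m<N. P $$ (l, m) * of_int (E k $ m)) = G k $ l" if "l < 2 * n" for k l
    unfolding E(2)[symmetric] using that E(1)[of k]
    by (subst mult_mat_vec_sum[OF P_carrier[folded N_def]]) (auto intro!: sum.cong)
  have PZ: "(\<Sum>m<N. P $$ (l, m) * of_int (Z j $ m)) = Q $$ (l, j)" if "l < 2 * n" "j < K" for j l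
  proof -
    have "Q $$ (l, j) = (P *\<^sub>v map_vec of_int (Z j)) $ l" unfolding Z(2)[OF that(2)] using that Q(1) by simp
    then show ?thesis using that Z(1)[of j]
      by (subst (asm) mult_mat_vec_sum[OF P_carrier[folded N_def]]) (auto intro!: sum.cong)
  qed
  \<comment> \<open>The difference of the real lattice coordinates of the two expansions of i v; P
    kills it, so it vanishes.\<close>
  define R where "R = vec N (\<lambda>m. (\<Sum>k<n + n. th k * of_int (E k $ m)) - (\<Sum>j<K. r $ j * of_int (Z j $ m)))"
  have "P *\<^sub>v map_vec complex_of_real R = 0\<^sub>v (2 * n)"
  proof (rule eq_vecI)
    fix l assume "l < dim_vec (0\<^sub>v (2 * n) :: complex vec)"
    then have l: "l < 2 * n" by simp
    have "(P *\<^sub>v map_vec complex_of_real R) $ l = (\<Sum>m<N. P $$ (l, m) *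
        ((\<Sum>k<n + n. of_real (th k) * of_int (E k $ m)) - (\<Sum>j<K. of_real (r $ j) * of_int (Z j $ m))))"
      using l by (subst mult_mat_vec_sum[OF P_carrier[folded N_def]]) (auto simp: R_def intro!: sum.cong)
    also have "\<dots> = (\<Sum>m<N. \<Sum>k<n + n. of_real (th k) * (P $$ (l, m) * of_int (E k $ m)))
       - (\<Sum>m<N. \<Sum>j<K. of_real (r $ j) * (P $$ (l, m) * of_int (Z j $ m)))"
      by (simp add: right_diff_distrib sum_subtractf sum_distrib_left mult.left_commute)
    also have "\<dots> = (\<Sum>k<n + n. of_real (th k) * G k $ l) - (\<Sum>j<K. of_real (r $ j) * Q $$ (l, j))"
      by (subst (1 2) sum.swap) (simp add: sum_distrib_left[symmetric] PE[OF l] PZ[OF l])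
    also have "(\<Sum>j<K. of_real (r $ j) * Q $$ (l, j)) = (Q *\<^sub>v map_vec complex_of_real r) $ l"
      using Q(1) r l by (subst mult_mat_vec_sum[OF Q(1)]) (auto simp: mult.commute intro!: sum.cong)
    also have "\<dots> = \<i> * Phi a c $ l" unfolding e[symmetric] using l by simp
    finally show "(P *\<^sub>v map_vec complex_of_real R) $ l = 0\<^sub>v (2 * n) $ l" using iG[OF l] l by simp
  qed (simp add: P_def)
  then have R0: "R = 0\<^sub>v N" by (intro P_real_injective[folded N_def]) (simp_all add: R_def)
  have rel: "(\<Sum>k<n + n. th k * of_int (E k $ m)) = (\<Sum>j<K. r $ j * of_int (Z j $ m))" if "m < N" for m
  proof -
    have "R $ m = 0" unfolding R0 using that by simp
    then show ?thesis using that by (simp add: R_def)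
  qed
  have GW: "G k0 \<in> W" if k0: "k0 < n + n" for k0
  proof -
    obtain f where f: "\<And>x y. f (x + y) = f x + f y" "\<And>k. k < n + n \<Longrightarrow> f (th k) = (if k = k0 then 1 else (0::real))"
      using rational_dual_functional[where th = th, OF li k0] by blast
    \<comment> \<open>Additivity gives linearity over the integers, which suffices because the
      lattice coordinates \<open>E\<close> and \<open>Z\<close> are integers.\<close>
    have f0: "f 0 = 0" using f(1)[of 0 0] by simp
    have fneg: "f (- x) = - f x" for x using f(1)[of x "- x"] f0 by simp
    have fnat: "f (x * of_nat j) = f x * of_nat j" for x j
      by (induction j) (simp_all add: f0 f(1) algebra_simps)
    have fint: "f (x * of_int j) = f x * of_int j" for x j
      by (cases j rule: int_cases2) (simp_all add: fnat fneg)
    have fsum: "f (\<Sum>k<M. g k) = (\<Sum>k<M. f (g k))" for M and g :: "nat \<Rightarrow> real"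
      by (induction M) (simp_all add: f0 f(1))
    have "of_int (E k0 $ m) = (\<Sum>j<K. f (r $ j) * of_int (Z j $ m))" if "m < N" for m
    proof -
      have "(\<Sum>k<n + n. f (th k) * of_int (E k $ m)) = (\<Sum>j<K. f (r $ j) * of_int (Z j $ m))"
        using arg_cong[OF rel[OF that], of f] by (simp only: fsum fint)
      moreover have "(\<Sum>k<n + n. f (th k) * of_int (E k $ m)) = (\<Sum>k<n + n. if k = k0 then of_int (E k0 $ m) else 0)"
        by (intro sum.cong) (auto simp: f(2))
      ultimately show ?thesis using k0 by simp
    qed
    from arg_cong[OF this, of _ complex_of_real]
    have Em: "complex_of_int (E k0 $ m) = (\<Sum>j<K. of_real (f (r $ j)) * of_int (Z j $ m))" if "m < N" for m
      using that by simp
    have "G k0 = vec (2 * n) (\<lambda>l. \<Sum>j<K. of_real (f (r $ j)) * col Q j $ l)"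
    proof (rule eq_vecI)
      fix l assume "l < dim_vec (vec (2 * n) (\<lambda>l. \<Sum>j<K. of_real (f (r $ j)) * col Q j $ l))"
      then have l: "l < 2 * n" by simp
      have "G k0 $ l = (\<Sum>m<N. \<Sum>j<K. of_real (f (r $ j)) * (P $$ (l, m) * of_int (Z j $ m)))"
        unfolding PE[OF l, symmetric] by (intro sum.cong) (simp_all add: Em sum_distrib_left mult.left_commute)
      also have "\<dots> = (\<Sum>j<K. of_real (f (r $ j)) * Q $$ (l, j))"
        by (subst sum.swap) (simp add: sum_distrib_left[symmetric] PZ[OF l])
      also have "\<dots> = (\<Sum>j<K. of_real (f (r $ j)) * col Q j $ l)" using Q(1) l by (intro sum.cong) auto
      finally show "G k0 $ l = vec (2 * n) (\<lambda>l. \<Sum>j<K. of_real (f (r $ j)) * col Q j $ l) $ l" using l by simp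
    qed (simp add: G_def)
    then show ?thesis using complex_subspace_sum[OF W, of K "col Q"] Q(2) by simp
  qed
  show ?thesis using GW[of k] GW[of "n + k"] k by (simp add: G_def)
qed

section \<open>From single right multiplications to right ideals\<close>

lemma g_dim [simp]: "dim_vec (g1 F a c) = 2 * n" "dim_vec (g2 F a c) = 2 * n"
  by (simp_all add: g1_def g2_def)

lemma pr_unique: "l div 2 = m div 2 \<Longrightarrow> l \<noteq> m \<Longrightarrow> l = pr m"
  unfolding pr_def by presburger

text \<open>Polynomials in t of degree below n take arbitrary values at the n places, so the powers
  of t span all real functions F.\<close>

lemma generic_closed_interpolated:
  assumes gen: "generic p1 p3" and W: "complex_subspace (2 * n) W"
    and span: "real_span (2 * n) (W \<inter> lattice_pts (2 * n) P) = W"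
    and a: "a \<in> LZ" and c: "c \<in> LZ" and v: "Phi a c \<in> W"
  shows "g1 F a c \<in> W" "g2 F a c \<in> W"
proof -
  obtain p where p: "degree p < n" "\<forall>i<n. poly p (t i) = F i"
    using interpolation_exists[OF t_inj, of F] n2 by auto
  have F: "F i = (\<Sum>k<n. coeff p k * t i ^ k)" if "i < n" for i
    using p poly_sum_coeff[OF p(1)] that by metis
  have "g1 F a c = g1 (\<lambda>i. \<Sum>k<n. coeff p k * t i ^ k) a c" "g2 F a c = g2 (\<lambda>i. \<Sum>k<n. coeff p k * t i ^ k) a c"
    unfolding g1_def g2_def using F by (auto intro!: Phi_cong)
  moreover have "g1 (\<lambda>i. \<Sum>k<n. coeff p k * t i ^ k) a c = vec (2 * n) (\<lambda>l. \<Sum>k<n. of_real (coeff p k) * g1 (\<lambda>i. t i ^ k) a c $ l)"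
    by (rule eq_vecI) (auto simp: g_sum)
  moreover have "g2 (\<lambda>i. \<Sum>k<n. coeff p k * t i ^ k) a c = vec (2 * n) (\<lambda>l. \<Sum>k<n. of_real (coeff p k) * g2 (\<lambda>i. t i ^ k) a c $ l)"
    by (rule eq_vecI) (auto simp: g_sum)
  ultimately show "g1 F a c \<in> W" "g2 F a c \<in> W"
    using complex_subspace_sum[OF W, of n "\<lambda>k. g1 (\<lambda>i. t i ^ k) a c"]
      complex_subspace_sum[OF W, of n "\<lambda>k. g2 (\<lambda>i. t i ^ k) a c"]
      generic_closed[OF gen W span a c v] by auto
qed

text \<open>Closure is available for right multiplication by delta F and delta F u only. Applied to
  x and to x delta it yields x times delta^2 f0, delta^2 f1 delta, delta^2 h0 u and delta^2 h1 delta
  u, whose sum is x (m1 + m2 u) times delta^2 = \<open>disc\<close>.\<close>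

lemma right_ideal:
  assumes gen: "generic p1 p3" and W: "complex_subspace (2 * n) W"
    and span: "real_span (2 * n) (W \<inter> lattice_pts (2 * n) P) = W"
    and a: "a \<in> LZ" and c: "c \<in> LZ" and v: "Phi a c \<in> W"
    and m1: "m1 \<in> LR" and m2: "m2 \<in> LR"
  shows "Phi (\<lambda>l. of_real (disc (l div 2)) * (a l * m1 l + of_real (bq (l div 2)) * c l * m2 (pr l)))
             (\<lambda>l. of_real (disc (l div 2)) * (a l * m2 l + c l * m1 (pr l))) \<in> W" (is "?X \<in> W")
proof -
  obtain f0 f1 where f: "\<And>l. l < 2*n \<Longrightarrow> m1 l = of_real (f0 (l div 2)) + of_real (f1 (l div 2)) * dl l"
    using m1 by (auto simp: LR_def)
  obtain h0 h1 where h: "\<And>l. l < 2*n \<Longrightarrow> m2 l = of_real (h0 (l div 2)) + of_real (h1 (l div 2)) * dl l"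
    using m2 by (auto simp: LR_def)
  \<comment> \<open>x delta is again a lattice point, as another application of the closure property
    requires.\<close>
  let ?a = "\<lambda>l. dl l * a l" and ?c = "\<lambda>l. - (dl l * c l)"
  have a': "?a \<in> LZ" "?c \<in> LZ" by (intro LZ_closed(2) LZ_uminus LZ_dl a c)+
  have "g1 (\<lambda>_. 1) a c = Phi ?a ?c" by (simp add: g1_def)
  then have v': "Phi ?a ?c \<in> W" using generic_closed_interpolated(1)[OF gen W span a c v, of "\<lambda>_. 1"] by simp
  note cl = generic_closed_interpolated[OF gen W span a c v] generic_closed_interpolated[OF gen W span a' v']
  have "?X = g1 f0 ?a ?c + g1 (\<lambda>i. disc i * f1 i) a c + g2 h0 ?a ?c + g2 (\<lambda>i. disc i * h1 i) a c" (is "_ = ?Y")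
  proof (rule eq_vecI)
    fix l assume "l < dim_vec ?Y"
    then have l: "l < 2 * n" by (simp add: g2_def)
    have d: "complex_of_real (disc (l div 2)) = dl l * dl l" by (simp add: dl_sq)
    show "?X $ l = ?Y $ l"
      using l by (simp add: g1_def g2_def Phi_def f h d) (simp add: algebra_simps)
  qed (simp add: g2_def)
  moreover have "?Y \<in> W" using cl W unfolding complex_subspace_def by blast
  ultimately show ?thesis by simp
qed

text \<open>The reduced norm of a + c u at the place below \<open>l\<close>.\<close>

definition nrd :: "(nat \<Rightarrow> complex) \<Rightarrow> (nat \<Rightarrow> complex) \<Rightarrow> nat \<Rightarrow> complex" where
  "nrd a c l = a l * a (pr l) - of_real (bq (l div 2)) * (c l * c (pr l))"

lemma LR_norm_real:
  assumes "a \<in> LR" "c \<in> LR"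
  shows "\<exists>N. \<forall>l<2*n. nrd a c l = of_real (N (l div 2))"
proof -
  obtain f0 f1 h0 h1 where f: "\<And>l. l < 2*n \<Longrightarrow> a l = of_real (f0 (l div 2)) + of_real (f1 (l div 2)) * dl l"
    and h: "\<And>l. l < 2*n \<Longrightarrow> c l = of_real (h0 (l div 2)) + of_real (h1 (l div 2)) * dl l"
    using assms by (auto simp: LR_def)
  have e: "(x + z * d) * (x - z * d) = x * x - z * z * (d * d)" for x z d :: complex
    by (simp add: algebra_simps)
  show ?thesis
    by (intro exI[of _ "\<lambda>i. f0 i * f0 i - f1 i * f1 i * disc i - bq i * (h0 i * h0 i - h1 i * h1 i * disc i)"])
      (auto simp: nrd_def f h e dl_sq)
qed

text \<open>w^2 = t w - 1 gives Z[w] = Z[t] + Z[t] w.\<close>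

lemma ev_decompose:
  "\<exists>A B :: int poly. \<forall>l. ev p l = of_real (poly (map_poly of_int A) (t (l div 2))) + of_real (poly (map_poly of_int B) (t (l div 2))) * om l"
proof (induction p)
    case 0
    then show ?case by (intro exI[of _ 0]) (simp add: ev_hom)
  next
    case (pCons a p)
    then obtain A B :: "int poly" where AB: "\<And>l. ev p l = of_real (poly (map_poly of_int A) (t (l div 2))) + of_real (poly (map_poly of_int B) (t (l div 2))) * om l"
      by blast
    interpret r: map_poly_comm_ring_hom "of_int :: int \<Rightarrow> real" ..
    have sq: "om l * om l = of_real (t (l div 2)) * om l - 1" for l
      unfolding om_sum[of l, symmetric] by (simp add: algebra_simps om_prod)
    have "ev (pCons a p) l = of_real (poly (map_poly of_int ([:a:] - B)) (t (l div 2)))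
       + of_real (poly (map_poly of_int (A + [:0,1:] * B)) (t (l div 2))) * om l" for l
    proof -
      let ?A = "complex_of_real (poly (map_poly of_int A) (t (l div 2)))" and ?B = "complex_of_real (poly (map_poly of_int B) (t (l div 2)))"
      have "ev (pCons a p) l = of_int a + om l * ev p l" by (simp add: ev_def of_int_hom.map_poly_pCons_hom)
      also have "\<dots> = of_int a + (?A * om l + ?B * (om l * om l))" unfolding AB by (simp add: algebra_simps)
      also have "\<dots> = (of_int a - ?B) + (?A + of_real (t (l div 2)) * ?B) * om l" unfolding sq by (simp add: algebra_simps)
      finally show ?thesis by (simp add: hom_distribs)
    qed
    then show ?case by blast
qed

text \<open>In the basis 1, w, u, w u over Z[t] the reduced norm is the form of
  \<open>quaternion_norm_nonzero\<close> evaluated at t. Its vanishing at one place means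
  divisibility by T, which forces all four components to vanish everywhere.\<close>

lemma norm_nonzero:
  assumes a: "a \<in> LZ" and c: "c \<in> LZ" and nz: "Phi a c \<noteq> 0\<^sub>v (2 * n)" and l: "l < 2 * n"
  shows "nrd a c l \<noteq> 0"
proof
  assume 0: "nrd a c l = 0"
  obtain p where p: "\<And>l. l < 2 * n \<Longrightarrow> a l = ev p l" using a by (auto simp: LZ_def)
  obtain s where s: "\<And>l. l < 2 * n \<Longrightarrow> c l = ev s l" using c by (auto simp: LZ_def)
  obtain A B where AB: "\<And>l. l < 2 * n \<Longrightarrow> ev p l = of_real (poly (map_poly of_int A) (t (l div 2))) + of_real (poly (map_poly of_int B) (t (l div 2))) * om l"
    using ev_decompose[of p] by blast
  obtain C E where CE: "\<And>l. l < 2 * n \<Longrightarrow> ev s l = of_real (poly (map_poly of_int C) (t (l div 2))) + of_real (poly (map_poly of_int E) (t (l div 2))) * om l"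
    using ev_decompose[of s] by blast
  interpret r: map_poly_comm_ring_hom "of_int :: int \<Rightarrow> real" ..
  have nf: "(x + z * om l) * (x + z * om (pr l)) = x * x + of_real (t (l div 2)) * x * z + z * z" for x z
  proof -
    have "(x + z * om l) * (x + z * om (pr l)) = x * x + (om l + om (pr l)) * x * z + z * z * (om l * om (pr l))"
      by (simp add: algebra_simps)
    then show ?thesis unfolding om_sum om_prod by simp
  qed
  let ?e = "\<lambda>U :: int poly. poly (map_poly of_int U) (t (l div 2)) :: real"
  have ac: "a l = of_real (?e A) + of_real (?e B) * om l" "a (pr l) = of_real (?e A) + of_real (?e B) * om (pr l)"
    "c l = of_real (?e C) + of_real (?e E) * om l" "c (pr l) = of_real (?e C) + of_real (?e E) * om (pr l)"
    using p[OF l] p[of "pr l"] s[OF l] s[of "pr l"] AB[OF l] AB[of "pr l"] CE[OF l] CE[of "pr l"] l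
    by simp_all
  have e: "?e (nform A B - [:3,1:] * nform C E) = (?e A * ?e A + t (l div 2) * ?e A * ?e B + ?e B * ?e B)
     - (3 + t (l div 2)) * (?e C * ?e C + t (l div 2) * ?e C * ?e E + ?e E * ?e E)"
  proof -
    have "?e (U + V) = ?e U + ?e V" "?e (U - V) = ?e U - ?e V" "?e (U * V) = ?e U * ?e V" for U V
      by (simp_all add: hom_distribs)
    moreover have "?e [:0,1:] = t (l div 2)" "?e [:3,1:] = 3 + t (l div 2)" by simp_all
    ultimately show ?thesis unfolding nform_def by (simp only:)
  qed
  have "nrd a c l = of_real (?e (nform A B - [:3,1:] * nform C E))"
    unfolding nrd_def ac nf e bq_def by simp
  then have "poly (map_poly of_int (nform A B - [:3,1:] * nform C E)) (t (l div 2)) = (0::real)"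
    using 0 by simp
  then have "T dvd nform A B - [:3,1:] * nform C E"
    by (rule root_imp_dvd[OF t_root[OF place_less[OF l]]])
  then have d: "T dvd A \<and> T dvd B \<and> T dvd C \<and> T dvd E" by (rule quaternion_norm_nonzero)
  have z: "poly (map_poly of_int U) (t i) = (0::real)" if "T dvd U" "i < n" for U i
    using that t_root[OF that(2)] by (auto simp: dvd_def hom_distribs)
  have "a l = 0" "c l = 0" if "l < 2 * n" for l
    using that d z[OF _ place_less[OF that]] by (simp_all add: p s AB CE)
  then have "Phi a c = 0\<^sub>v (2 * n)" by (auto simp: Phi_def)
  then show False using nz by simp
qed

text \<open>The multiplier is the inverse of a + c u (its quaternion conjugate over the reduced
  norm) times the target x1 + x2 u; \<open>G\<close> also contains 1/disc, against the factor in
  \<open>right_ideal\<close>.\<close>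

lemma right_ideal_everything:
  assumes gen: "generic p1 p3" and W: "complex_subspace (2 * n) W"
    and span: "real_span (2 * n) (W \<inter> lattice_pts (2 * n) P) = W"
    and a: "a \<in> LZ" and c: "c \<in> LZ" and v: "Phi a c \<in> W" and nz: "Phi a c \<noteq> 0\<^sub>v (2 * n)"
    and x: "x1 \<in> LR" "x2 \<in> LR"
  shows "Phi x1 x2 \<in> W"
proof -
  have "f \<in> LR" if f: "f \<in> LZ" for f
  proof -
    obtain p where "\<And>l. l < 2 * n \<Longrightarrow> f l = ev p l" using f by (auto simp: LZ_def)
    then show ?thesis using LR_ev[of p] unfolding LR_def by auto
  qed
  then have ac: "a \<in> LR" "c \<in> LR" using a c by auto
  obtain N where N: "\<And>l. l < 2 * n \<Longrightarrow> nrd a c l = of_real (N (l div 2))" using LR_norm_real[OF ac] by blast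
  define G where "G = (\<lambda>i. 1 / (disc i * N i))"
  define m1 where "m1 = (\<lambda>l. of_real (G (l div 2)) * (a (pr l) * x1 l - of_real (bq (l div 2)) * (c l * x2 (pr l))))"
  define m2 where "m2 = (\<lambda>l. of_real (G (l div 2)) * (a (pr l) * x2 l - c l * x1 (pr l)))"
  have "m1 \<in> LR" "m2 \<in> LR" unfolding m1_def m2_def
    by (intro LR_mult LR_real LR_diff LR_bar[of a] LR_bar[of x1] LR_bar[of x2] ac x)+
  from right_ideal[OF gen W span a c v this]
  have "Phi (\<lambda>l. of_real (disc (l div 2)) * (a l * m1 l + of_real (bq (l div 2)) * c l * m2 (pr l)))
             (\<lambda>l. of_real (disc (l div 2)) * (a l * m2 l + c l * m1 (pr l))) \<in> W" (is "Phi ?u ?w \<in> W") .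
  moreover have "Phi ?u ?w = Phi x1 x2"
  proof (rule Phi_cong)
    fix l assume l: "l < 2 * n"
    have "N (l div 2) \<noteq> 0" using norm_nonzero[OF a c nz l] N[OF l] by simp
    then have "complex_of_real (disc (l div 2)) * (of_real (G (l div 2)) * nrd a c l) = 1"
      using disc_nz[OF place_less[OF l]] N[OF l] by (simp add: G_def flip: of_real_mult)
    then have e: "of_real (disc (l div 2)) * (of_real (G (l div 2)) * (nrd a c l * z)) = z" for z
      by (metis mult.assoc mult_1)
    have "?u l = of_real (disc (l div 2)) * (of_real (G (l div 2)) * (nrd a c l * x1 l))"
      by (simp add: m1_def m2_def nrd_def algebra_simps)
    then show "?u l = x1 l" using e by simp
    have "?w l = of_real (disc (l div 2)) * (of_real (G (l div 2)) * (nrd a c l * x2 l))"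
      by (simp add: m1_def m2_def nrd_def algebra_simps)
    then show "?w l = x2 l" using e by simp
  qed
  ultimately show ?thesis by simp
qed

lemma simple_torus:
  assumes gen: "generic p1 p3" and W: "complex_subspace (2 * n) W"
    and span: "real_span (2 * n) (W \<inter> lattice_pts (2 * n) P) = W" and W0: "W \<noteq> {0\<^sub>v (2 * n)}"
  shows "W = carrier_vec (2 * n)"
proof -
  have "\<exists>v\<in>W \<inter> lattice_pts (2 * n) P. v \<noteq> 0\<^sub>v (2 * n)"
  proof (rule ccontr)
    assume no: "\<not> ?thesis"
    have "w = 0\<^sub>v (2 * n)" if "w \<in> W" for w
    proof -
      have "w \<in> real_span (2 * n) (W \<inter> lattice_pts (2 * n) P)" using that span by simp
      then obtain Q r k where Q: "Q \<in> carrier_mat (2 * n) k" "\<forall>j<k. col Q j \<in> W \<inter> lattice_pts (2 * n) P"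
        "r \<in> carrier_vec k" "w = Q *\<^sub>v map_vec complex_of_real r" unfolding real_span_def by blast
      have q0: "Q $$ (l, j) = 0" if "l < 2 * n" "j < k" for l j
      proof -
        have "col Q j = 0\<^sub>v (2 * n)" using no Q(2) that by blast
        then have "col Q j $ l = 0" using that by simp
        then show ?thesis using that Q(1) by simp
      qed
      show ?thesis
      proof (rule eq_vecI)
        show "dim_vec w = dim_vec (0\<^sub>v (2 * n) :: complex vec)" using Q by simp
        fix l assume "l < dim_vec (0\<^sub>v (2 * n) :: complex vec)"
        then have l: "l < 2 * n" by simp
        have "w $ l = (\<Sum>j<k. Q $$ (l, j) * map_vec complex_of_real r $ j)"
          unfolding Q(4) using Q(1,3) l by (intro mult_mat_vec_sum) auto
        also have "\<dots> = 0" using q0[OF l] by simp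
        finally show "w $ l = 0\<^sub>v (2 * n) $ l" using l by simp
      qed
    qed
    then show False using W0 W by (auto simp: complex_subspace_def)
  qed
  then obtain a c where ac: "a \<in> LZ" "c \<in> LZ" "Phi a c \<in> W" "Phi a c \<noteq> 0\<^sub>v (2 * n)"
    unfolding lattice_pts_eq by blast
  \<comment> \<open>Taking x/2 and x/(2 rq) as the two components makes \<open>Phi\<close> return x
    itself, since \<open>al l + al (pr l) = 2\<close>.\<close>
  have unit: "vec (2 * n) x \<in> W" if x: "x \<in> LR" for x
  proof -
    define w where "w = (\<lambda>l. of_real (1 / rq (l div 2)) * x l)"
    have half: "(\<lambda>l. of_real (1 / 2) * x l) \<in> LR" using LR_mult[OF LR_real[of "\<lambda>_. 1 / 2"] x] by simp
    have "(\<lambda>l. of_real (1 / rq (l div 2)) * (of_real (1 / 2) * x l)) \<in> LR"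
      using LR_mult[OF LR_real[of "\<lambda>i. 1 / rq i"] half] by simp
    from right_ideal_everything[OF gen W span ac half this]
    have "Phi (\<lambda>l. of_real (1 / 2) * x l) (\<lambda>l. of_real (1 / rq (l div 2)) * (of_real (1 / 2) * x l)) \<in> W" .
    moreover have "Phi (\<lambda>l. of_real (1 / 2) * x l) (\<lambda>l. of_real (1 / rq (l div 2)) * (of_real (1 / 2) * x l)) = vec (2 * n) x"
    proof (rule eq_vecI)
      fix l assume "l < dim_vec (vec (2 * n) x)"
      then have l: "l < 2 * n" by simp
      have "Phi (\<lambda>l. of_real (1 / 2) * x l) (\<lambda>l. of_real (1 / rq (l div 2)) * (of_real (1 / 2) * x l)) $ l
         = (al l + al (pr l)) * (x l / 2)"
        using l rq_pos[OF place_less[OF l]] by (simp add: Phi_def field_simps)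
      then show "Phi (\<lambda>l. of_real (1 / 2) * x l) (\<lambda>l. of_real (1 / rq (l div 2)) * (of_real (1 / 2) * x l)) $ l = vec (2 * n) x $ l"
        using l by (simp add: al_add)
    qed simp
    ultimately show ?thesis by simp
  qed
  \<comment> \<open>\<open>dl\<close> has opposite values at the two embeddings above a place, so a
    complex combination of 1 and \<open>dl\<close> at that place isolates one of them.\<close>
  have basis: "vec (2 * n) (\<lambda>l. if l = m then 1 else 0) \<in> W" if m: "m < 2 * n" for m
  proof -
    let ?f = "\<lambda>i. if i = m div 2 then 1 else (0::real)"
    have "vec (2 * n) (\<lambda>l. of_real (?f (l div 2))) \<in> W" "vec (2 * n) (\<lambda>l. of_real (?f (l div 2)) * dl l) \<in> W"
      by (intro unit LR_mult LR_real[of ?f] LR_dl)+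
    then have "(1 / 2) \<cdot>\<^sub>v vec (2 * n) (\<lambda>l. of_real (?f (l div 2))) + (1 / (2 * dl m)) \<cdot>\<^sub>v vec (2 * n) (\<lambda>l. of_real (?f (l div 2)) * dl l) \<in> W"
      using W unfolding complex_subspace_def by blast
    moreover have "(1 / 2) \<cdot>\<^sub>v vec (2 * n) (\<lambda>l. of_real (?f (l div 2))) + (1 / (2 * dl m)) \<cdot>\<^sub>v vec (2 * n) (\<lambda>l. of_real (?f (l div 2)) * dl l)
       = vec (2 * n) (\<lambda>l. if l = m then 1 else 0)"
    proof (rule eq_vecI)
      fix l assume "l < dim_vec (vec (2 * n) (\<lambda>l. if l = m then 1 else (0::complex)))"
      then have l: "l < 2 * n" by simp
      consider "l = m" | "l = pr m" "l \<noteq> m" | "l div 2 \<noteq> m div 2" using pr_unique by blast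
      then show "((1 / 2) \<cdot>\<^sub>v vec (2 * n) (\<lambda>l. of_real (?f (l div 2))) + (1 / (2 * dl m)) \<cdot>\<^sub>v vec (2 * n) (\<lambda>l. of_real (?f (l div 2)) * dl l)) $ l
       = vec (2 * n) (\<lambda>l. if l = m then 1 else 0) $ l"
        by cases (use l dl_nz[OF m] in auto)
    qed simp
    ultimately show ?thesis by simp
  qed
  have "v \<in> W" if v: "v \<in> carrier_vec (2 * n)" for v
  proof -
    have "vec (2 * n) (\<lambda>l. \<Sum>m<2*n. v $ m * vec (2 * n) (\<lambda>l. if l = m then 1 else 0) $ l) \<in> W"
      by (intro complex_subspace_sum[OF W] basis)
    moreover have "vec (2 * n) (\<lambda>l. \<Sum>m<2*n. v $ m * vec (2 * n) (\<lambda>l. if l = m then 1 else 0) $ l) = v"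
      using v by (intro eq_vecI) (auto simp: if_distrib cong: if_cong)
    ultimately show ?thesis by simp
  qed
  then show ?thesis using W unfolding complex_subspace_def by blast
qed
end

section \<open>Polarization\<close>

lemma sum_pairs:
  fixes f :: "nat \<Rightarrow> 'a::comm_monoid_add"
  shows "(\<Sum>l<2*n. f l) = (\<Sum>i<n. f (2 * i) + f (2 * i + 1))"
  by (induction n) (simp_all add: add.assoc)

text \<open>Here w is on the unit circle: \<open>dl\<close> is i d, the entries 1 - d y and 1 + d y
  of \<open>al\<close> are real, and the second embedding is the complex conjugate of the first. k
  stands for 1/y.\<close>

lemma polarization_elliptic_place:
  fixes d y r \<beta> k :: real and a c m e :: complex
  assumes k: "k * y = 1"
  defines "z \<equiv> (1 - d * y) * a + r * (1 + d * y) * c" and "z' \<equiv> (1 + d * y) * cnj a + r * (1 - d * y) * cnj c"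
    and "w \<equiv> (1 - d * y) * m + r * (1 + d * y) * e" and "w' \<equiv> (1 + d * y) * cnj m + r * (1 - d * y) * cnj e"
  shows "Im (of_real ((1 + r * \<beta>) * k) * (cnj (z - z') * (w - w')) + of_real ((1 - r * \<beta>) * k) * (cnj (z + z') * (w + w')))
    = Re (4 * (\<i> * d * (cnj a * m - r * r * (cnj c * e) + r * r * \<beta> * (a * e - c * m))
             + - (\<i> * d) * (a * cnj m - r * r * (c * cnj e) + r * r * \<beta> * (cnj a * cnj e - cnj c * cnj m))))"
proof -
  have yk: "y * k = 1" using k by (simp add: mult.commute)
  define D where "D = - d * y"
  have Dk: "D * k = - d" using yk by (simp add: D_def mult.assoc)
  have zw: "Re (z - z') = 2 * D * (Re a - r * Re c)" "Im (z - z') = 2 * (Im a + r * Im c)"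
    "Re (z + z') = 2 * (Re a + r * Re c)" "Im (z + z') = 2 * D * (Im a - r * Im c)"
    "Re (w - w') = 2 * D * (Re m - r * Re e)" "Im (w - w') = 2 * (Im m + r * Im e)"
    "Re (w + w') = 2 * (Re m + r * Re e)" "Im (w + w') = 2 * D * (Im m - r * Im e)"
    by (simp_all add: z_def z'_def w_def w'_def D_def algebra_simps)
  have cj: "Im (of_real s * (cnj x * y) + of_real s' * (cnj x' * y')) =
    s * (Re x * Im y - Im x * Re y) + s' * (Re x' * Im y' - Im x' * Re y')" for s s' x y x' y'
    by simp
  have "Im (of_real ((1 + r * \<beta>) * k) * (cnj (z - z') * (w - w')) + of_real ((1 - r * \<beta>) * k) * (cnj (z + z') * (w + w')))
    = 4 * (D * k) * ((1 + r * \<beta>) * ((Re a - r * Re c) * (Im m + r * Im e) - (Im a + r * Im c) * (Re m - r * Re e))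
      + (1 - r * \<beta>) * ((Re a + r * Re c) * (Im m - r * Im e) - (Im a - r * Im c) * (Re m + r * Re e)))"
    unfolding cj zw by (simp add: algebra_simps)
  also have "\<dots> = Re (4 * (\<i> * d * (cnj a * m - r * r * (cnj c * e) + r * r * \<beta> * (a * e - c * m))
             + - (\<i> * d) * (a * cnj m - r * r * (c * cnj e) + r * r * \<beta> * (cnj a * cnj e - cnj c * cnj m))))"
    unfolding Dk by (simp add: algebra_simps)
  finally show ?thesis .
qed

text \<open>Here w is real: the two embeddings give independent real components, and the entries of
  \<open>al\<close> are complex conjugates. The sign of 1 + r \<beta> is opposite to the elliptic
  case, which is why r \<beta> has to be below 1 at one kind of place and above 1 at the
  other.\<close>

lemma polarization_hyperbolic_place:
  fixes d y r \<beta> k a a' c c' m m' e e' :: real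
  assumes k: "k * y = 1"
  defines "z \<equiv> (1 + \<i> * d * y) * a + r * (1 - \<i> * d * y) * c" and "z' \<equiv> (1 - \<i> * d * y) * a' + r * (1 + \<i> * d * y) * c'"
    and "w \<equiv> (1 + \<i> * d * y) * m + r * (1 - \<i> * d * y) * e" and "w' \<equiv> (1 - \<i> * d * y) * m' + r * (1 + \<i> * d * y) * e'"
  shows "Im (of_real (- (1 + r * \<beta>) * k) * (cnj (z - z') * (w - w')) + of_real ((1 - r * \<beta>) * k) * (cnj (z + z') * (w + w')))
    = 4 * (d * (a' * m - r * r * (c' * e) + r * r * \<beta> * (a * e - c * m))
             + - d * (a * m' - r * r * (c * e') + r * r * \<beta> * (a' * e' - c' * m')))"
proof -
  have yk: "y * k = 1" using k by (simp add: mult.commute)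
  define D where "D = d * y"
  have Dk: "D * k = d" using yk by (simp add: D_def mult.assoc)
  have zw: "Re (z - z') = (a - a') + r * (c - c')" "Im (z - z') = D * ((a + a') - r * (c + c'))"
    "Re (z + z') = (a + a') + r * (c + c')" "Im (z + z') = D * ((a - a') - r * (c - c'))"
    "Re (w - w') = (m - m') + r * (e - e')" "Im (w - w') = D * ((m + m') - r * (e + e'))"
    "Re (w + w') = (m + m') + r * (e + e')" "Im (w + w') = D * ((m - m') - r * (e - e'))"
    by (simp_all add: z_def z'_def w_def w'_def D_def algebra_simps)
  have cj: "Im (of_real s * (cnj x * y) + of_real s' * (cnj x' * y')) =
    s * (Re x * Im y - Im x * Re y) + s' * (Re x' * Im y' - Im x' * Re y')" for s s' x y x' y'
    by simp
  have "Im (of_real (- (1 + r * \<beta>) * k) * (cnj (z - z') * (w - w')) + of_real ((1 - r * \<beta>) * k) * (cnj (z + z') * (w + w')))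
    = (D * k) * (- (1 + r * \<beta>) * (((a - a') + r * (c - c')) * ((m + m') - r * (e + e')) - ((a + a') - r * (c + c')) * ((m - m') + r * (e - e')))
      + (1 - r * \<beta>) * (((a + a') + r * (c + c')) * ((m - m') - r * (e - e')) - ((a - a') - r * (c - c')) * ((m + m') + r * (e + e'))))"
    unfolding cj zw by (simp add: algebra_simps)
  also have "\<dots> = 4 * (d * (a' * m - r * r * (c' * e) + r * r * \<beta> * (a * e - c * m))
             + - d * (a * m' - r * r * (c * e') + r * r * \<beta> * (a' * e' - c' * m')))"
    unfolding Dk by (simp add: algebra_simps)
  finally show ?thesis .
qed

context quaternion_torus
begin

text \<open>The Riemann form is, up to sign conventions, the trace of $\delta(1 + \beta u)\,x\bar{y}$ with $\delta = w - 1/w$ and $\beta = 2(t/2)^{2N}$. For large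
  $N$ the square $\delta^2(1 - (t+3)\beta^2)$ is totally negative, which makes the form definite at every place. The factor $2^{2N}$
  in the Hermitian matrix clears denominators.\<close>

definition be :: "nat \<Rightarrow> nat \<Rightarrow> real" where "be N i = 2 * (t i / 2) ^ (2 * N)"
text \<open>As u acts at a place by \<open>rq\<close> times the swap of the coordinates, the form is
  diagonal in their difference and their sum; \<open>h1\<close> and \<open>h2\<close> are the
  diagonal entries.\<close>

definition h1 :: "nat \<Rightarrow> nat \<Rightarrow> real" where "h1 N i = (if disc i < 0 then 1 + rq i * be N i else - (1 + rq i * be N i)) * (1 / y i)"
definition h2 :: "nat \<Rightarrow> nat \<Rightarrow> real" where "h2 N i = (1 - rq i * be N i) * (1 / y i)"

definition herm_mat :: "nat \<Rightarrow> complex mat" where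
  "herm_mat N = mat (2 * n) (2 * n) (\<lambda>(l, m). if l div 2 \<noteq> m div 2 then 0
     else of_real (2 ^ (2 * N) * (if l = m then h2 N (l div 2) + h1 N (l div 2) else h2 N (l div 2) - h1 N (l div 2))))"

lemma herm_form_herm_mat:
  "herm_form (2 * n) (herm_mat N) v w = (\<Sum>i<n. of_real (2 ^ (2 * N)) *
     (of_real (h1 N i) * (cnj (v $ (2 * i) - v $ (2 * i + 1)) * (w $ (2 * i) - w $ (2 * i + 1)))
    + of_real (h2 N i) * (cnj (v $ (2 * i) + v $ (2 * i + 1)) * (w $ (2 * i) + w $ (2 * i + 1)))))"
proof -
  have "herm_form (2 * n) (herm_mat N) v w = (\<Sum>i<n. \<Sum>j<n.
      (cnj (v $ (2 * i)) * herm_mat N $$ (2 * i, 2 * j) * w $ (2 * j) + cnj (v $ (2 * i)) * herm_mat N $$ (2 * i, 2 * j + 1) * w $ (2 * j + 1))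
    + (cnj (v $ (2 * i + 1)) * herm_mat N $$ (2 * i + 1, 2 * j) * w $ (2 * j) + cnj (v $ (2 * i + 1)) * herm_mat N $$ (2 * i + 1, 2 * j + 1) * w $ (2 * j + 1)))"
    unfolding herm_form_def sum_pairs by (simp only: sum.distrib)
  also have "\<dots> = (\<Sum>i<n. \<Sum>j<n. if j = i then of_real (2 ^ (2 * N)) *
     (of_real (h1 N i) * (cnj (v $ (2 * i) - v $ (2 * i + 1)) * (w $ (2 * i) - w $ (2 * i + 1)))
    + of_real (h2 N i) * (cnj (v $ (2 * i) + v $ (2 * i + 1)) * (w $ (2 * i) + w $ (2 * i + 1)))) else 0)"
    by (intro sum.cong refl) (auto simp: herm_mat_def algebra_simps)
  also have "\<dots> = (\<Sum>i<n. of_real (2 ^ (2 * N)) *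
     (of_real (h1 N i) * (cnj (v $ (2 * i) - v $ (2 * i + 1)) * (w $ (2 * i) - w $ (2 * i + 1)))
    + of_real (h2 N i) * (cnj (v $ (2 * i) + v $ (2 * i + 1)) * (w $ (2 * i) + w $ (2 * i + 1)))))"
    by (intro sum.cong refl) simp
  finally show ?thesis .
qed

definition pol :: "nat \<Rightarrow> (nat \<Rightarrow> complex) \<Rightarrow> (nat \<Rightarrow> complex) \<Rightarrow> (nat \<Rightarrow> complex) \<Rightarrow> (nat \<Rightarrow> complex) \<Rightarrow> nat \<Rightarrow> complex" where
  "pol N a c m e l = dl l * (a (pr l) * m l - of_real (bq (l div 2)) * (c (pr l) * e l)
     + of_real (bq (l div 2)) * of_real (be N (l div 2)) * (a l * e l - c l * m l))"

lemma LZ_LR: assumes f: "f \<in> LZ" shows "f \<in> LR"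
proof -
  obtain p where "\<And>l. l < 2 * n \<Longrightarrow> f l = ev p l" using f by (auto simp: LZ_def)
  then show ?thesis using LR_ev[of p] unfolding LR_def by auto
qed

lemma Im_place:
  assumes i: "i < n" and LR: "a \<in> LR" "c \<in> LR" "m \<in> LR" "e \<in> LR"
  defines "v \<equiv> Phi a c" and "w \<equiv> Phi m e"
  shows "Im (of_real (h1 N i) * (cnj (v $ (2 * i) - v $ (2 * i + 1)) * (w $ (2 * i) - w $ (2 * i + 1)))
    + of_real (h2 N i) * (cnj (v $ (2 * i) + v $ (2 * i + 1)) * (w $ (2 * i) + w $ (2 * i + 1))))
    = Re (4 * (pol N a c m e (2 * i) + pol N a c m e (2 * i + 1)))"
proof -
  define l where "l = 2 * i"
  have l: "l < 2 * n" "l div 2 = i" "pr l = 2 * i + 1" "2 * i + 1 < 2 * n" "pr (2 * i + 1) = 2 * i" "(2 * i + 1) div 2 = i"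
    using i by (auto simp: l_def pr_def)
  have dl': "dl (2 * i + 1) = - dl (2 * i)" by (metis dl_pr l(3) l_def)
  have yk: "1 / y i * y i = 1" using y_nz[OF i] by simp
  have b: "bq i = rq i * rq i" using rq_sq[OF i] by simp
  have vw: "Phi f g $ (2 * i) = al (2 * i) * f (2 * i) + of_real (rq i) * al (2 * i + 1) * g (2 * i)"
    "Phi f g $ (2 * i + 1) = al (2 * i + 1) * f (2 * i + 1) + of_real (rq i) * al (2 * i) * g (2 * i + 1)" for f g
    using l l_def by (simp_all add: Phi_def)
  have pr2: "pr (2 * i) = 2 * i + 1" using l(3) l_def by simp
  show ?thesis
  proof (cases "disc i < 0")
    case True
    define d where "d = Im (dl (2 * i))"
    have "cnj (dl (2 * i)) = - dl (2 * i)" using dl_neg[of l] True l l_def by simp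
    then have d: "dl (2 * i) = \<i> * of_real d" by (simp add: complex_eq_iff d_def)
    have al: "al (2 * i) = of_real (1 - d * y i)" "al (2 * i + 1) = of_real (1 + d * y i)"
      unfolding al_def dl' d l(6) by (simp_all add: complex_eq_iff)
    have cj: "f (2 * i + 1) = cnj (f (2 * i))" if "f \<in> LR" for f
      using LR_cnj[OF that l(1)] True l l_def by simp
    note cjs = cj[OF LR(1)] cj[OF LR(2)] cj[OF LR(3)] cj[OF LR(4)]
    have p: "pol N a c m e (2 * i) = \<i> * d * (cnj (a (2 * i)) * m (2 * i) - rq i * rq i * (cnj (c (2 * i)) * e (2 * i))
        + rq i * rq i * be N i * (a (2 * i) * e (2 * i) - c (2 * i) * m (2 * i)))"
      "pol N a c m e (2 * i + 1) = - (\<i> * d) * (a (2 * i) * cnj (m (2 * i)) - rq i * rq i * (c (2 * i) * cnj (e (2 * i)))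
        + rq i * rq i * be N i * (cnj (a (2 * i)) * cnj (e (2 * i)) - cnj (c (2 * i)) * cnj (m (2 * i))))"
      unfolding pol_def dl' d l(5,6) pr2 cjs by (simp_all add: b)
    show ?thesis
      unfolding p polarization_elliptic_place[OF yk, symmetric]
      unfolding v_def w_def vw al cjs h1_def h2_def using True by simp
  next
    case False
    then have pos: "disc i > 0" using disc_nz[OF i] by simp
    define d where "d = Re (dl (2 * i))"
    have "cnj (dl (2 * i)) = dl (2 * i)" using dl_pos[of l] pos l l_def by simp
    then have d: "dl (2 * i) = of_real d" by (simp add: complex_eq_iff d_def)
    have al: "al (2 * i) = 1 + \<i> * d * y i" "al (2 * i + 1) = 1 - \<i> * d * y i"
      unfolding al_def dl' d l(6) by (simp_all add: complex_eq_iff)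
    have cj: "f (2 * i) = of_real (Re (f (2 * i))) \<and> f (2 * i + 1) = of_real (Re (f (2 * i + 1)))" if "f \<in> LR" for f
      using LR_cnj[OF that l(1)] LR_cnj[OF that l(4)] False l l_def by (simp add: complex_eq_iff)
    have R: "Re (4 * (of_real x + of_real z)) = 4 * (x + z)" for x z by simp
    obtain A A' C C' M M' E E' where ac: "a (2 * i) = complex_of_real A" "a (2 * i + 1) = complex_of_real A'"
      "c (2 * i) = complex_of_real C" "c (2 * i + 1) = complex_of_real C'"
      "m (2 * i) = complex_of_real M" "m (2 * i + 1) = complex_of_real M'"
      "e (2 * i) = complex_of_real E" "e (2 * i + 1) = complex_of_real E'"
      using cj[OF LR(1)] cj[OF LR(2)] cj[OF LR(3)] cj[OF LR(4)] by blast
    have p: "pol N a c m e (2 * i) = of_real (d * (A' * M - rq i * rq i * (C' * E) + rq i * rq i * be N i * (A * E - C * M)))"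
      "pol N a c m e (2 * i + 1) = of_real (- d * (A * M' - rq i * rq i * (C * E') + rq i * rq i * be N i * (A' * E' - C' * M')))"
      unfolding pol_def dl' d l(5,6) pr2 ac by (simp_all add: b)
    show ?thesis
      unfolding p R polarization_hyperbolic_place[OF yk, symmetric]
      unfolding v_def w_def vw al ac h1_def h2_def using False by simp
  qed
qed

lemma pol_integral:
  assumes "a \<in> LZ" "c \<in> LZ" "m \<in> LZ" "e \<in> LZ"
  shows "2 ^ (2 * N) * (\<Sum>l<2*n. pol N a c m e l) \<in> \<int>"
proof -
  define f where "f = (\<lambda>l. dl l * (of_int (2 ^ (2 * N)) * (a (pr l) * m l - of_real (bq (l div 2)) * (c (pr l) * e l))
     + of_real (bq (l div 2)) * (of_int 2 * of_real (t (l div 2)) ^ (2 * N)) * (a l * e l - c l * m l)))"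
  have "f \<in> LZ" unfolding f_def
    by (intro LZ_closed LZ_power LZ_dl LZ_bq LZ_t LZ_bar[of a] LZ_bar[of c] LZ_basic(3) assms)
  moreover have "2 ^ (2 * N) * pol N a c m e l = f l" for l
  proof -
    have "complex_of_real (2 ^ (2 * N) * be N (l div 2)) = of_int 2 * of_real (t (l div 2)) ^ (2 * N)"
      by (simp add: be_def power_divide)
    then have k: "2 ^ (2 * N) * complex_of_real (be N (l div 2)) = of_int 2 * of_real (t (l div 2)) ^ (2 * N)"
      by simp
    show ?thesis unfolding pol_def f_def k[symmetric] by (simp add: algebra_simps)
  qed
  ultimately show ?thesis using LZ_sum_int by (simp add: sum_distrib_left)
qed

text \<open>Where \<open>disc\<close> is negative, y and 1 - rq be are positive. Where it is
  positive, |t| > 2 gives be >= 2 and t > -5/2 gives bq >= 1/2, so rq be > 1: now 1 - rq be is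
  negative, and so is y.\<close>

lemma abelian_variety:
  assumes sg: "\<And>i. i < n \<Longrightarrow> if disc i < 0 then y i > 0 else y i < 0"
    and N: "\<And>i. i < n \<Longrightarrow> disc i < 0 \<Longrightarrow> rq i * be N i < 1"
  shows "is_abelian_variety (2 * n) P"
proof -
  have be0: "be N i \<ge> 0" for i by (simp add: be_def power_mult)
  have h: "h1 N i > 0 \<and> h2 N i > 0" if i: "i < n" for i
  proof -
    have p: "1 + rq i * be N i > 0" using be0[of i] rq_pos[OF i] by (simp add: add_pos_nonneg)
    show ?thesis
    proof (cases "disc i < 0")
      case True
      then show ?thesis using sg[OF i] N[OF i] p by (simp add: h1_def h2_def)
    next
      case False
      then have "(t i)\<^sup>2 > 4" using disc_nz[OF i] by (simp add: disc_def)
      then have "(t i / 2)\<^sup>2 \<ge> 1" by (simp add: power_divide)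
      then have b2: "be N i \<ge> 2" unfolding be_def power_mult using one_le_power by simp
      have "(rq i * be N i)\<^sup>2 = bq i * (be N i)\<^sup>2" using rq_sq[OF i] by (simp add: power2_eq_square mult_ac)
      also have "\<dots> \<ge> 1 / 2 * 2\<^sup>2"
        using t_bound[OF i] b2 by (intro mult_mono power_mono) (auto simp: bq_def abs_if split: if_splits)
      finally have "1\<^sup>2 < (rq i * be N i)\<^sup>2" by simp
      then have "1 < rq i * be N i" using power_less_imp_less_base be0[of i] rq_pos[OF i] by (metis less_imp_le mult_nonneg_nonneg)
      then show ?thesis using False sg[OF i] p by (simp add: h1_def h2_def divide_simps mult_neg_neg)
    qed
  qed
  show ?thesis unfolding is_abelian_variety_def
  proof (intro conjI exI[of _ "herm_mat N"] allI impI ballI)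
    show "is_lattice (2 * n) P" by (rule lattice)
    show "herm_mat N \<in> carrier_mat (2 * n) (2 * n)" by (simp add: herm_mat_def)
    show "herm_mat N $$ (j, i) = cnj (herm_mat N $$ (i, j))" if "i < 2 * n" "j < 2 * n" for i j
      using that by (auto simp: herm_mat_def)
    show "Re (herm_form (2 * n) (herm_mat N) v v) > 0" if v: "v \<in> carrier_vec (2 * n)" "v \<noteq> 0\<^sub>v (2 * n)" for v
    proof -
      have cn: "cnj z * z = of_real ((cmod z)\<^sup>2)" for z by (metis complex_norm_square mult.commute)
      define f where "f = (\<lambda>i. 2 ^ (2 * N) * (h1 N i * (cmod (v $ (2 * i) - v $ (2 * i + 1)))\<^sup>2 + h2 N i * (cmod (v $ (2 * i) + v $ (2 * i + 1)))\<^sup>2))"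
      have e: "herm_form (2 * n) (herm_mat N) v v = of_real (\<Sum>i<n. f i)"
        unfolding herm_form_herm_mat cn f_def by simp
      have f0: "f i \<ge> 0" if "i < n" for i using h[OF that] by (simp add: f_def)
      obtain l where l: "l < 2 * n" "v $ l \<noteq> 0" using v by (metis carrier_vecD eq_vecI index_zero_vec)
      define i where "i = l div 2"
      have i: "i < n" using l i_def by simp
      have "v $ (2 * i) - v $ (2 * i + 1) \<noteq> 0 \<or> v $ (2 * i) + v $ (2 * i + 1) \<noteq> 0"
      proof (rule ccontr)
        assume "\<not> ?thesis"
        then have "v $ (2 * i) = 0 \<and> v $ (2 * i + 1) = 0" by simp
        moreover have "l = 2 * i \<or> l = 2 * i + 1" unfolding i_def by linarith
        ultimately show False using l by auto
      qed
      then have "h1 N i * (cmod (v $ (2 * i) - v $ (2 * i + 1)))\<^sup>2 + h2 N i * (cmod (v $ (2 * i) + v $ (2 * i + 1)))\<^sup>2 > 0"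
        using h[OF i]
        by (elim disjE) (intro add_pos_nonneg mult_pos_pos, simp_all, intro add_nonneg_pos mult_pos_pos, simp_all)
      then have "f i > 0" unfolding f_def by simp
      then have "(\<Sum>i<n. f i) > 0" using f0 i by (intro sum_pos2[of _ i]) auto
      then show ?thesis unfolding e by simp
    qed
    fix v w assume vw: "v \<in> lattice_pts (2 * n) P" "w \<in> lattice_pts (2 * n) P"
    obtain a c where ac: "v = Phi a c" "a \<in> LZ" "c \<in> LZ" using vw(1) unfolding lattice_pts_eq by blast
    obtain m e where me: "w = Phi m e" "m \<in> LZ" "e \<in> LZ" using vw(2) unfolding lattice_pts_eq by blast
    have rI: "Im (of_real x * z) = x * Im z" for x z by simp
    have "Im (herm_form (2 * n) (herm_mat N) v w) = (\<Sum>i<n. 2 ^ (2 * N) * Re (4 * (pol N a c m e (2 * i) + pol N a c m e (2 * i + 1))))"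
      unfolding herm_form_herm_mat Im_sum rI ac(1) me(1)
      using Im_place[OF _ LZ_LR[OF ac(2)] LZ_LR[OF ac(3)] LZ_LR[OF me(2)] LZ_LR[OF me(3)]]
      by (intro sum.cong refl) simp
    also have "\<dots> = Re (4 * (2 ^ (2 * N) * (\<Sum>l<2*n. pol N a c m e l)))"
    proof -
      have "2 ^ (2 * N) * (\<Sum>l<2*n. pol N a c m e l) = of_real (2 ^ (2 * N)) * (\<Sum>i<n. pol N a c m e (2 * i) + pol N a c m e (2 * i + 1))"
        unfolding sum_pairs by simp
      moreover have "Re (4 * (of_real x * z)) = x * Re (4 * z)" for x z by simp
      ultimately show ?thesis by (simp only: sum_distrib_left Re_sum)
    qed
    also obtain z where "2 ^ (2 * N) * (\<Sum>l<2*n. pol N a c m e l) = of_int z"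
      using pol_integral[OF ac(2,3) me(2,3)] by (rule Ints_cases)
    finally show "Im (herm_form (2 * n) (herm_mat N) v w) \<in> \<int>" by simp
  qed
qed
end

section \<open>The automorphism and its dynamical degree\<close>

lemma spectrum_diag_mat:
  fixes d :: "nat \<Rightarrow> 'a::field"
  shows "spectrum (mat k k (\<lambda>(i, j). if i = j then d i else 0)) = d ` {..<k}"
proof -
  let ?A = "mat k k (\<lambda>(i, j). if i = j then d i else 0)"
  have A: "?A \<in> carrier_mat k k" by simp
  have "char_poly ?A = (\<Prod>a\<leftarrow>diag_mat ?A. [:- a, 1:])"
    by (rule char_poly_upper_triangular[OF A]) (auto intro!: upper_triangularI)
  then have "eigenvalue ?A x \<longleftrightarrow> x \<in> set (diag_mat ?A)" for x
    unfolding eigenvalue_root_char_poly[OF A] by (auto simp: poly_prod_list prod_list_zero_iff)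
  moreover have "set (diag_mat ?A) = d ` {..<k}" by (auto simp: diag_mat_def)
  ultimately show ?thesis unfolding spectrum_def by auto
qed

lemma first_dyn_degree_diag:
  assumes "g > 0"
  shows "first_dyn_degree g (mat g g (\<lambda>(i, j). if i = j then d i else 0)) =
    Max ((\<lambda>p. cmod (d (p div g)) * cmod (d (p mod g))) ` {..<g * g})"
proof -
  let ?A = "mat g g (\<lambda>(i, j). if i = j then d i else 0)"
  have ix: "p div g < g" "p mod g < g" if "p < g * g" for p
    using that assms by (auto simp: less_mult_imp_div_less)
  have "pullback11 g ?A = mat (g * g) (g * g) (\<lambda>(p, q). if p = q then d (p div g) * cnj (d (p mod g)) else 0)"
  proof (rule eq_matI)
    fix p q assume pq: "p < dim_row (mat (g * g) (g * g) (\<lambda>(p, q). if p = q then d (p div g) * cnj (d (p mod g)) else 0))"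
      "q < dim_col (mat (g * g) (g * g) (\<lambda>(p, q). if p = q then d (p div g) * cnj (d (p mod g)) else 0))"
    then have pq': "p < g * g" "q < g * g" by auto
    have "p = q \<longleftrightarrow> p div g = q div g \<and> p mod g = q mod g" by (metis div_mult_mod_eq)
    then show "pullback11 g ?A $$ (p, q) = mat (g * g) (g * g) (\<lambda>(p, q). if p = q then d (p div g) * cnj (d (p mod g)) else 0) $$ (p, q)"
      using pq' ix by (auto simp: pullback11_def)
  qed (auto simp: pullback11_def)
  then show ?thesis unfolding first_dyn_degree_def spectral_radius_def
    by (simp add: spectrum_diag_mat[where d = "\<lambda>p. d (p div g) * cnj (d (p mod g))"] image_image norm_mult)
qed

context quaternion_torus
begin

definition unit_mat :: "complex mat" where
  "unit_mat = mat (2 * n) (2 * n) (\<lambda>(i, j). if i = j then om i else 0)"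

lemma unit_mat_Phi: "unit_mat *\<^sub>v Phi a c = Phi (\<lambda>l. om l * a l) (\<lambda>l. om l * c l)"
proof (rule eq_vecI)
  fix l assume "l < dim_vec (Phi (\<lambda>l. om l * a l) (\<lambda>l. om l * c l))"
  then have l: "l < 2 * n" by simp
  have "(unit_mat *\<^sub>v Phi a c) $ l = (\<Sum>j<2*n. unit_mat $$ (l, j) * Phi a c $ j)"
    using l by (intro mult_mat_vec_sum) (auto simp: unit_mat_def)
  also have "\<dots> = (\<Sum>j<2*n. if j = l then om l * Phi a c $ l else 0)"
    using l by (intro sum.cong) (auto simp: unit_mat_def)
  also have "\<dots> = Phi (\<lambda>l. om l * a l) (\<lambda>l. om l * c l) $ l"
    using l by (simp add: Phi_def algebra_simps)
  finally show "(unit_mat *\<^sub>v Phi a c) $ l = \<dots>" .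
qed (simp add: unit_mat_def)

text \<open>Onto the lattice because 1/w also lies in Z[w].\<close>

lemma torus_aut: "is_torus_aut (2 * n) P unit_mat"
proof -
  have "(\<lambda>v. unit_mat *\<^sub>v v) ` lattice_pts (2 * n) P = lattice_pts (2 * n) P"
  proof (intro subset_antisym subsetI)
    fix v assume "v \<in> (\<lambda>v. unit_mat *\<^sub>v v) ` lattice_pts (2 * n) P"
    then obtain a c where ac: "a \<in> LZ" "c \<in> LZ" "v = unit_mat *\<^sub>v Phi a c" unfolding lattice_pts_eq by blast
    then show "v \<in> lattice_pts (2 * n) P"
      unfolding lattice_pts_eq unit_mat_Phi using LZ_closed(2)[OF LZ_basic(1)] by blast
  next
    fix v assume "v \<in> lattice_pts (2 * n) P"
    then obtain a c where ac: "a \<in> LZ" "c \<in> LZ" "v = Phi a c" unfolding lattice_pts_eq by blast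
    have "v = unit_mat *\<^sub>v Phi (\<lambda>l. om (pr l) * a l) (\<lambda>l. om (pr l) * c l)"
      unfolding unit_mat_Phi ac(3) by (rule Phi_cong) (simp_all add: mult.assoc[symmetric] om_prod)
    moreover have "Phi (\<lambda>l. om (pr l) * a l) (\<lambda>l. om (pr l) * c l) \<in> lattice_pts (2 * n) P"
      unfolding lattice_pts_eq using LZ_closed(2)[OF LZ_basic(2)] ac by blast
    ultimately show "v \<in> (\<lambda>v. unit_mat *\<^sub>v v) ` lattice_pts (2 * n) P" by blast
  qed
  then show ?thesis by (simp add: is_torus_aut_def unit_mat_def)
qed

text \<open>If w is on the unit circle at this place, there is nothing to estimate. Otherwise |w| <=
  (|t| + sqrt(t^2 - 4)) / 2, which increases with |t| and equals x at |t| = x + 1/x.\<close>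

lemma norm_om_le:
  assumes l: "l < 2 * n" and x: "x > 1" and t: "\<bar>t (l div 2)\<bar> < x + 1 / x"
  shows "cmod (om l) < x"
proof (cases "disc (l div 2) < 0")
  case True
  have "cnj (om l) = om (pr l)" using LR_cnj[OF LR_om l] True by simp
  then have "(cmod (om l))\<^sup>2 = 1"
    using om_prod[of l] by (metis complex_norm_square of_real_eq_1_iff)
  then have "cmod (om l) = 1" using power2_eq_imp_eq[of "cmod (om l)" 1] by simp
  then show ?thesis using x by simp
next
  case False
  let ?t = "t (l div 2)" and ?D = "disc (l div 2)"
  have "?t\<^sup>2 < (x + 1 / x)\<^sup>2" using power_strict_mono[OF t, of 2] by simp
  also have "(x + 1 / x)\<^sup>2 = (x - 1 / x)\<^sup>2 + 4" using x by (simp add: power2_eq_square field_simps)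
  finally have "?D < (x - 1 / x)\<^sup>2" by (simp add: disc_def)
  moreover have "x - 1 / x > 0" using x by (simp add: field_simps less_1_mult)
  ultimately have s: "sqrt ?D < x - 1 / x" by (simp add: real_less_lsqrt)
  have "cmod (om l) = cmod (of_real ?t + dl l) / 2" by (simp add: om_def norm_divide)
  also have "\<dots> \<le> (\<bar>?t\<bar> + cmod (dl l)) / 2" using norm_triangle_ineq[of "of_real ?t" "dl l"] by simp
  also have "cmod (dl l) = sqrt ?D" using False by (simp add: dl_def norm_mult)
  also have "(\<bar>?t\<bar> + sqrt ?D) / 2 < x" using add_strict_mono[OF t s] by simp
  finally show ?thesis .
qed

lemma norm_om_0: assumes "t 0 > 2" shows "cmod (om 0) > 1"
proof -
  have "4 < (t 0)\<^sup>2" using power_strict_mono[OF assms, of 2] by simp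
  then have "disc 0 > 0" by (simp add: disc_def)
  then have "om 0 = of_real ((t 0 + sqrt (disc 0)) / 2)" by (simp add: om_def dl_def csqrt_of_real_nonneg)
  then have "cmod (om 0) = \<bar>(t 0 + sqrt (disc 0)) / 2\<bar>" by (simp only: norm_of_real)
  moreover have "(t 0 + sqrt (disc 0)) / 2 > 1" 
  proof -
    have "sqrt (disc 0) > 0" using \<open>disc 0 > 0\<close> by simp
    from add_strict_mono[OF assms this] show ?thesis by simp
  qed
  ultimately show ?thesis using abs_ge_self[of "(t 0 + sqrt (disc 0)) / 2"] by (metis order_less_le_trans)
qed

lemma dyn_degree_bounds:
  assumes x: "x > 1" and t: "\<And>i. i < n \<Longrightarrow> \<bar>t i\<bar> < x + 1 / x" and t0: "t 0 > 2"
  shows "1 < first_dyn_degree (2 * n) unit_mat" "first_dyn_degree (2 * n) unit_mat < x\<^sup>2"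
proof -
  let ?g = "2 * n"
  have g: "?g > 0" using n2 by simp
  let ?S = "(\<lambda>p. cmod (om (p div ?g)) * cmod (om (p mod ?g))) ` {..<?g * ?g}"
  have e: "first_dyn_degree ?g unit_mat = Max ?S" unfolding unit_mat_def by (rule first_dyn_degree_diag[OF g])
  have ne: "finite ?S" "?S \<noteq> {}" using g by (auto simp: lessThan_empty_iff)
  have "1 * 1 < cmod (om 0) * cmod (om 0)" using norm_om_0[OF t0] by (intro mult_strict_mono) auto
  moreover have "cmod (om 0) * cmod (om 0) \<in> ?S" using g by (intro image_eqI[of _ _ 0]) auto
  ultimately show "1 < first_dyn_degree ?g unit_mat" unfolding e using ne by (auto simp: Max_gr_iff)
  have "cmod (om (p div ?g)) * cmod (om (p mod ?g)) < x\<^sup>2" if p: "p < ?g * ?g" for p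
  proof -
    have "p div ?g < ?g" "p mod ?g < ?g" using p g by (auto simp: less_mult_imp_div_less)
    then have "cmod (om (p div ?g)) < x" "cmod (om (p mod ?g)) < x" using norm_om_le[OF _ x t[OF place_less]] by auto
    then show ?thesis unfolding power2_eq_square by (intro mult_strict_mono') auto
  qed
  then show "first_dyn_degree ?g unit_mat < x\<^sup>2" unfolding e using ne by (auto simp: Max_less_iff)
qed

end

theorem theoremD:
  fixes \<epsilon> :: real
  assumes "\<epsilon> > 0"
  shows "\<exists>g P A. is_simple_abelian_variety g P \<and> is_torus_aut g P A \<and>
           1 < first_dyn_degree g A \<and> first_dyn_degree g A < 1 + \<epsilon>"
proof -
  \<comment> \<open>The cap 2 makes x + 1/x at most 5/2, the bound on t in
    \<open>quaternion_torus\<close>; the square root is there because the degree is a product of two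
    absolute values of conjugates of w.\<close>
  define x where "x = min 2 (sqrt (1 + \<epsilon>))"
  have x: "1 < x" "x \<le> 2" using assms by (auto simp: x_def)
  have x2: "x\<^sup>2 \<le> 1 + \<epsilon>"
  proof -
    have "x\<^sup>2 \<le> (sqrt (1 + \<epsilon>))\<^sup>2" using x by (intro power_mono) (auto simp: x_def)
    then show ?thesis using assms by simp
  qed
  define r where "r = (x + 1 / x) / 2"
  have "0 < (x - 1) * (x - 1)" using x by simp
  then have r: "r > 1" using x by (simp add: r_def field_simps)
  obtain T n t where T: "eisenstein3 T n" "inj_on t {..<n}"
    "\<forall>i<n. poly (map_poly of_int T) (t i) = 0 \<and> \<bar>t i\<bar> < 2 * r" "t 0 > 2"
    using eisenstein_interval[OF r] by metis
  interpret eisenstein3 T n by (rule T)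
  have tb: "\<bar>t i\<bar> < x + 1 / x" if "i < n" for i
  proof -
    have "2 * r = x + 1 / x" by (simp add: r_def)
    then show ?thesis using T(3) that by metis
  qed
  have "0 \<le> (2 - x) * (2 * x - 1)" using x by simp
  then have "x + 1 / x \<le> 5 / 2" using x by (simp add: field_simps)
  then have tb': "\<bar>t i\<bar> < 5 / 2" if "i < n" for i using tb[OF that] by linarith
  \<comment> \<open>A provisional y: \<open>disc\<close>, \<open>rq\<close> and \<open>be\<close>
    depend on t alone and enter the choice of the actual y.\<close>
  interpret A: quaternion_torus T n t "\<lambda>_. 1"
    by unfold_locales (use T tb' in auto)
  note disc_def = A.disc_def and disc_nz = A.disc_nz
  have rq_nz: "A.rq i \<noteq> 0" if "i < n" for i using A.rq_pos[OF that] by simp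
  \<comment> \<open>Positivity of the polarization prescribes the sign of y at each place.\<close>
  define sg :: "nat \<Rightarrow> real" where "sg = (\<lambda>i. if A.disc i < 0 then 1 else -1)"
  \<comment> \<open>The values in \<open>generic\<close> after substituting y_i = sg_i z^(i+1);
    distinct exponents let a single parameter z serve all places.\<close>
  have "\<exists>z>0. \<forall>p1 p3. degree p1 < n \<longrightarrow> degree p3 < n \<longrightarrow>
    (\<forall>i<n. poly p1 (t i) = (1 / (2 * A.disc i * sg i)) / z ^ (i + 1) + (- sg i / 2) * z ^ (i + 1) \<and>
           poly p3 (t i) = (- 1 / (2 * A.rq i * A.disc i * sg i)) / z ^ (i + 1) + (- sg i / (2 * A.rq i)) * z ^ (i + 1)) \<longrightarrow>
    (\<forall>q q' :: nat \<Rightarrow> rat. (\<Sum>k<n. of_rat (q k) * coeff p1 k + of_rat (q' k) * coeff p3 k) = 0 \<longrightarrow>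
       (\<forall>k<n. q k = 0 \<and> q' k = 0))"
    using rq_nz disc_nz n2 T(2)
    by (intro generic_interpolation) (auto simp: sg_def field_simps)
  then obtain z where z: "z > 0" and zgen: "\<And>p1 p3 q q' k. degree p1 < n \<Longrightarrow> degree p3 < n \<Longrightarrow>
    (\<forall>i<n. poly p1 (t i) = (1 / (2 * A.disc i * sg i)) / z ^ (i + 1) + (- sg i / 2) * z ^ (i + 1) \<and>
           poly p3 (t i) = (- 1 / (2 * A.rq i * A.disc i * sg i)) / z ^ (i + 1) + (- sg i / (2 * A.rq i)) * z ^ (i + 1)) \<Longrightarrow>
    (\<Sum>k<n. of_rat (q k) * coeff p1 k + of_rat (q' k) * coeff p3 k) = 0 \<Longrightarrow> k < n \<Longrightarrow> q k = 0 \<and> q' k = 0"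
    by blast
  define y where "y = (\<lambda>i. sg i * z ^ (i + 1))"
  have y: "if A.disc i < 0 then y i > 0 else y i < 0" for i using z by (auto simp: y_def sg_def)
  interpret Q: quaternion_torus T n t y
  proof
    show "inj_on t {..<n}" by (rule T)
    show "y i \<noteq> 0" for i using y[of i] by (metis less_irrefl)
  qed (use T(3) tb' in blast)+
  have n0: "n > 0" using n2 by simp
  obtain p1 where p1: "degree p1 < n" "\<forall>i<n. poly p1 (t i) = (1 / (A.disc i * y i) - y i) / 2"
    using interpolation_exists[OF T(2) n0, of "\<lambda>i. (1 / (A.disc i * y i) - y i) / 2"] by blast
  obtain p3 where p3: "degree p3 < n" "\<forall>i<n. poly p3 (t i) = (- y i - 1 / (A.disc i * y i)) / (2 * A.rq i)"
    using interpolation_exists[OF T(2) n0, of "\<lambda>i. (- y i - 1 / (A.disc i * y i)) / (2 * A.rq i)"] by blast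
  have v: "\<forall>i<n. poly p1 (t i) = (1 / (2 * A.disc i * sg i)) / z ^ (i + 1) + (- sg i / 2) * z ^ (i + 1) \<and>
           poly p3 (t i) = (- 1 / (2 * A.rq i * A.disc i * sg i)) / z ^ (i + 1) + (- sg i / (2 * A.rq i)) * z ^ (i + 1)"
    using p1(2) p3(2) by (simp add: y_def diff_divide_distrib add_divide_distrib mult_ac)
  have gen: "Q.generic p1 p3"
    unfolding Q.generic_def using p1 p3 zgen[OF p1(1) p3(1) v] by blast
  \<comment> \<open>At these places |t/2| < 1, so \<open>be\<close> tends to 0.\<close>
  have "\<exists>N. \<forall>i<n. A.disc i < 0 \<longrightarrow> A.rq i * A.be N i < 1"
  proof -
    have "\<forall>\<^sub>F N in sequentially. A.disc i < 0 \<longrightarrow> A.rq i * A.be N i < 1" for i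
    proof (cases "A.disc i < 0")
      case True
      then have "(t i / 2)\<^sup>2 < 1" by (simp add: disc_def power_divide)
      then have lim: "(\<lambda>N. ((t i / 2)\<^sup>2) ^ N) \<longlonglongrightarrow> 0" by (intro LIMSEQ_power_zero) simp
      have "(\<lambda>N. A.rq i * (2 * ((t i / 2)\<^sup>2) ^ N)) \<longlonglongrightarrow> A.rq i * (2 * 0)"
        by (intro tendsto_mult tendsto_const lim)
      then have "\<forall>\<^sub>F N in sequentially. A.rq i * (2 * ((t i / 2)\<^sup>2) ^ N) < 1" by (intro order_tendstoD(2)) auto
      then show ?thesis by (simp add: A.be_def power_mult)
    qed simp
    then have "\<forall>\<^sub>F N in sequentially. \<forall>i\<in>{..<n}. A.disc i < 0 \<longrightarrow> A.rq i * A.be N i < 1"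
      by (intro eventually_ball_finite) auto
    then show ?thesis by (auto simp: eventually_sequentially)
  qed
  then obtain N where N: "\<And>i. i < n \<Longrightarrow> A.disc i < 0 \<Longrightarrow> A.rq i * A.be N i < 1" by blast
  have "is_abelian_variety (2 * n) Q.P" using Q.abelian_variety[OF y N] by blast
  then have "is_simple_abelian_variety (2 * n) Q.P"
    unfolding is_simple_abelian_variety_def using Q.simple_torus[OF gen] n2 by auto
  then show ?thesis
    using Q.torus_aut Q.dyn_degree_bounds[OF x(1) tb T(4)] x2 by (meson order_less_le_trans)
qed

end
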